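(* Let $\Omega\subset\mathbb{R}^n$, $n\ge2$, be a bounded domain, and assume that the generalized N-function $G$ satisfies conditions (G0), (G1), (G2), that the Carathéodory functions $A$ and $B$ satisfy the structure conditions $(\mathcal{A}_1)$, $(\mathcal{A}_2)$, $(\mathcal{B})$, and that the generalized N-functions $H_1,H_2$ satisfy $(\mathcal{H}_1)$–$(\mathcal{H}_4)$ (all conditions being those listed in the context). If $u\in W^{1,G(x,t)}(\Omega)$ is a weak solution of the Dirichlet problem $$\operatorname{div}A(x,u,Du)+B(x,u,Du)=0\ \text{ in }\Omega,\qquad u=0\ \text{ on }\partial\Omega,$$ then $u\in L^\infty(\Omega)$.
   Context: Generalized N-function: a function $G(x,t)$ that for a.e. $x$ is even, continuous and convex in $t$ and strictly increasing in $t\ge 0$, is measurable in $x$ for each $t$, satisfies $G(x,0)=0$ and $G(x,t)>0$ for $t>0$, and, for a.e. $x$, $\lim_{t\to0}G(x,t)/t=0$ and $\lim_{t\to\infty}G(x,t)/t=\infty$. We write $G(x,t)=\int_0^{|t|}g(x,s)\,ds$ with $g(x,\cdot)$ the right derivative of $G(x,\cdot)$ on $[0,\infty)$ (extended oddly). $G^{-1}(x,\cdot)$ is the inverse of $G(x,\cdot)$ on $[0,\infty)$, and $\widetilde G(x,t)=\sup_{s\ge0}\{ts-G(x,s)\}$ is the complementary function, with inverse $\widetilde G^{-1}(x,\cdot)$ (same notation for other N-functions). Spaces: $L^{G(x,t)}(\Omega)$ is the set of measurable $u$ with $\int_\Omega G(x,\lambda u)\,dx<\infty$ for some $\lambda>0$,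 with norm $\|u\|_{L^{G(x,t)}(\Omega)}=\inf\{\lambda>0:\int_\Omega G(x,u/\lambda)\,dx\le1\}$; $W^{1,G(x,t)}(\Omega)=\{u\in L^{G(x,t)}(\Omega):|Du|\in L^{G(x,t)}(\Omega)\}$ with norm $\|u\|_{L^{G(x,t)}(\Omega)}+\||Du|\|_{L^{G(x,t)}(\Omega)}$; $W^{1,G(x,t)}_0(\Omega)$ is the completion of $C_0^\infty(\Omega)$ in it. Conditions on $G$: (G0) there are constants $1<g^-\le g^+<n$ with $g^-\le\frac{g(x,t)t}{G(x,t)}\le g^+$ for all $x\in\mathbb{R}^n$, $t>0$. (G1) there is $F\ge1$ with $F^{-1}\le G(x,1)\le F$ for a.e. $x\in\mathbb{R}^n$. (G2) there is $\mu\in(0,1]$ such that for every ball $B\subset\mathbb{R}^n$ with $|B|\le1$, every $t\in[1,1/|B|]$ and a.e. $x,y\in B$: $\mu G^{-1}(x,t)\le G^{-1}(y,t)$. Sobolev conjugate: $G^*(x,t)=G(x,N^{-1}(x,t))$, where $N(x,t)=\left(\int_0^t\left(\frac{\tau}{G(x,\tau)}\right)^{\frac1{n-1}}d\tau\right)^{\frac{n-1}{n}}$. Order relations for generalized N-functions: $G_1\prec\prec G_2$ means that for every $k>0$, $\lim_{t\to\infty}G_1(x,kt)/G_2(x,t)=0$ uniformly in $x\in\Omega$; $G_1\prec G_2$ means there are $C_1,C_2>0$ and $0\le\varphi\in L^1(\Omega)$ with $G_1(x,t)\le C_1G_2(x,C_2t)+\varphi(x)$ for a.e. $x\in\Omega$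 and all $t\ge0$. Structure conditions: $A:\Omega\times\mathbb{R}\times\mathbb{R}^n\to\mathbb{R}^n$ and $B:\Omega\times\mathbb{R}\times\mathbb{R}^n\to\mathbb{R}$ are Carathéodory functions, and with positive constants $a_i,b_j$, $(\mathcal{A}_1)$ $A(x,u,\eta)\cdot\eta\ge a_4G(x,|\eta|)-a_5H_1(x,|u|)-a_6$; $(\mathcal{A}_2)$ $|A(x,u,\eta)|\le a_1g(x,|\eta|)+a_2P(x,|u|)+a_3$; $(\mathcal{B})$ $|B(x,u,\eta)|\le b_1M(x,|\eta|)+b_2h_1(x,|u|)+b_3$; where $M(x,t)=\widetilde{H_1}^{-1}(x,G(x,t))$ and $P(x,t)=\widetilde G^{-1}(x,H_1(x,t))$. Conditions on the generalized N-functions $H_i(x,t)=\int_0^th_i(x,s)\,ds$, $i=1,2$, with constants $F_1,F_2>1$: $(\mathcal{H}_1)$ $F_i^{-1}\le H_i(x,1)\le F_i$ for all $x\in\Omega$; $(\mathcal{H}_2)$ there are constants $h_i^\pm$ with $g^+\le h_i^-\le\frac{h_i(x,t)t}{H_i(x,t)}\le h_i^+\le g_*^-:=\frac{ng^-}{n-g^-}$ for all $x\in\Omega$, $t>0$; $(\mathcal{H}_3)$ $\int_\Omega H_i(x,t)\,dx<\infty$ for $t>0$; $(\mathcal{H}_4)$ $G\prec H_i\prec\prec G^*$. Weak solution of the Dirichlet problem: $u\in W^{1,G(x,t)}(\Omega)$ with $u=0$ on $\partial\Omega$ (i.e. $u\in W_0^{1,G(x,t)}(\Omega)$) such that $$\int_\Omega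 A(x,u,Du)\cdot Dv\,dx-\int_\Omega B(x,u,Du)\,v\,dx=0\qquad\text{for all }v\in W_0^{1,G(x,t)}(\Omega).$$ *)

theory Defs
  imports "HOL-Analysis.Analysis"
begin

definition gen_N_function :: "(real^'n) set \<Rightarrow> (real^'n \<Rightarrow> real \<Rightarrow> real) \<Rightarrow> bool" where
  "gen_N_function S G \<longleftrightarrow>
     (\<forall>t. (\<lambda>x. G x t) \<in> borel_measurable (lebesgue_on S)) \<and>
     (AE x in lebesgue_on S.
        (\<forall>t. G x (- t) = G x t) \<and>
        continuous_on UNIV (G x) \<and>
        convex_on UNIV (G x) \<and>
        strict_mono_on {0..} (G x) \<and>
        G x 0 = 0 \<and>
        (\<forall>t>0. G x t > 0) \<and>
        ((\<lambda>t. G x t / t) \<longlongrightarrow> 0) (at 0) \<and>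
        filterlim (\<lambda>t. G x t / t) at_top at_top)"

text \<open>For a generalized N-function \<open>G\<close> this is the function \<open>g\<close> of
  \<open>G(x,t) = \<integral>\<^sub>0\<^sup>|\<^sup>t\<^sup>| g(x,s) ds\<close>: the right derivative on \<open>[0,\<infinity>)\<close>, extended oddly.\<close>

definition N_deriv :: "(real^'n \<Rightarrow> real \<Rightarrow> real) \<Rightarrow> real^'n \<Rightarrow> real \<Rightarrow> real" where
  "N_deriv G x t =
     (if t \<ge> 0 then vector_derivative (G x) (at t within {t..})
      else - vector_derivative (G x) (at (- t) within {- t..}))"

definition N_inv :: "(real^'n \<Rightarrow> real \<Rightarrow> real) \<Rightarrow> real^'n \<Rightarrow> real \<Rightarrow> real" where
  "N_inv G x = the_inv_into {0..} (G x)"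

definition N_compl :: "(real^'n \<Rightarrow> real \<Rightarrow> real) \<Rightarrow> real^'n \<Rightarrow> real \<Rightarrow> real" where
  "N_compl G x t = (SUP s\<in>{0..}. t * s - G x s)"

text \<open>The functions \<open>N\<close> and \<open>G\<^sup>*\<close> are meant for \<open>t \<ge> 0\<close> only.\<close>

definition sobolev_N :: "(real^'n \<Rightarrow> real \<Rightarrow> real) \<Rightarrow> real^'n \<Rightarrow> real \<Rightarrow> real" where
  "sobolev_N G x t =
     (integral {0..t} (\<lambda>\<tau>. (\<tau> / G x \<tau>) powr (1 / (real CARD('n) - 1))))
       powr ((real CARD('n) - 1) / real CARD('n))"

definition sobolev_conj :: "(real^'n \<Rightarrow> real \<Rightarrow> real) \<Rightarrow> real^'n \<Rightarrow> real \<Rightarrow> real" where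
  "sobolev_conj G x t = G x (N_inv (sobolev_N G) x t)"

definition N_prec ::
  "(real^'n) set \<Rightarrow> (real^'n \<Rightarrow> real \<Rightarrow> real) \<Rightarrow> (real^'n \<Rightarrow> real \<Rightarrow> real) \<Rightarrow> bool" where
  "N_prec \<Omega> G1 G2 \<longleftrightarrow>
     (\<exists>C1>0. \<exists>C2>0. \<exists>\<phi>. integrable (lebesgue_on \<Omega>) \<phi> \<and> (AE x in lebesgue_on \<Omega>. 0 \<le> \<phi> x) \<and>
        (AE x in lebesgue_on \<Omega>. \<forall>t\<ge>0. G1 x t \<le> C1 * G2 x (C2 * t) + \<phi> x))"

definition N_precprec ::
  "(real^'n) set \<Rightarrow> (real^'n \<Rightarrow> real \<Rightarrow> real) \<Rightarrow> (real^'n \<Rightarrow> real \<Rightarrow> real) \<Rightarrow> bool" where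
  "N_precprec \<Omega> G1 G2 \<longleftrightarrow>
     (\<forall>k>0. uniform_limit \<Omega> (\<lambda>t x. G1 x (k * t) / G2 x t) (\<lambda>x. 0) at_top)"

text \<open>Elements of the spaces are represented by functions on the whole of \<open>\<real>\<^sup>n\<close>;
  their values outside \<open>\<Omega>\<close> are irrelevant.\<close>

definition L_space :: "(real^'n) set \<Rightarrow> (real^'n \<Rightarrow> real \<Rightarrow> real) \<Rightarrow> (real^'n \<Rightarrow> real) set" where
  "L_space \<Omega> G = {u \<in> borel_measurable (lebesgue_on \<Omega>).
     \<exists>l>0. (\<integral>\<^sup>+x. ennreal (G x (l * u x)) \<partial>lebesgue_on \<Omega>) < \<infinity>}"

definition L_norm :: "(real^'n) set \<Rightarrow> (real^'n \<Rightarrow> real \<Rightarrow> real) \<Rightarrow> (real^'n \<Rightarrow> real) \<Rightarrow> real" where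
  "L_norm \<Omega> G u = Inf {l. l > 0 \<and> (\<integral>\<^sup>+x. ennreal (G x (u x / l)) \<partial>lebesgue_on \<Omega>) \<le> 1}"

definition partial_deriv :: "'n \<Rightarrow> (real^'n \<Rightarrow> real) \<Rightarrow> real^'n \<Rightarrow> real" where
  "partial_deriv i f x = frechet_derivative f (at x) (axis i 1)"

primrec C_k :: "nat \<Rightarrow> (real^'n \<Rightarrow> real) \<Rightarrow> bool" where
  "C_k 0 f \<longleftrightarrow> continuous_on UNIV f"
| "C_k (Suc k) f \<longleftrightarrow> f differentiable_on UNIV \<and> (\<forall>i. C_k k (partial_deriv i f))"

text \<open>\<open>C\<^sub>0\<^sup>\<infinity>(\<Omega>)\<close>: smooth functions with compact support in \<open>\<Omega>\<close>, extended by zero.\<close>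

definition test_functions :: "(real^'n) set \<Rightarrow> (real^'n \<Rightarrow> real) set" where
  "test_functions \<Omega> =
     {\<phi>. (\<forall>k. C_k k \<phi>) \<and> compact (closure {x. \<phi> x \<noteq> 0}) \<and> closure {x. \<phi> x \<noteq> 0} \<subseteq> \<Omega>}"

definition locally_integrable ::
  "(real^'n) set \<Rightarrow> (real^'n \<Rightarrow> 'b::{banach, second_countable_topology}) \<Rightarrow> bool" where
  "locally_integrable \<Omega> f \<longleftrightarrow> (\<forall>K. compact K \<and> K \<subseteq> \<Omega> \<longrightarrow> set_integrable lebesgue K f)"

definition has_weak_gradient ::
  "(real^'n) set \<Rightarrow> (real^'n \<Rightarrow> real) \<Rightarrow> (real^'n \<Rightarrow> real^'n) \<Rightarrow> bool" where
  "has_weak_gradient \<Omega> u U \<longleftrightarrow>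
     locally_integrable \<Omega> u \<and> locally_integrable \<Omega> U \<and>
     (\<forall>\<phi>\<in>test_functions \<Omega>. \<forall>i.
        (LINT x|lebesgue_on \<Omega>. u x * partial_deriv i \<phi> x) =
        - (LINT x|lebesgue_on \<Omega>. U x $ i * \<phi> x))"

text \<open>The weak gradient is unique up to null sets; we fix one representative.\<close>

definition weak_gradient :: "(real^'n) set \<Rightarrow> (real^'n \<Rightarrow> real) \<Rightarrow> real^'n \<Rightarrow> real^'n" where
  "weak_gradient \<Omega> u = (SOME U. has_weak_gradient \<Omega> u U)"

definition W1_space :: "(real^'n) set \<Rightarrow> (real^'n \<Rightarrow> real \<Rightarrow> real) \<Rightarrow> (real^'n \<Rightarrow> real) set" where
  "W1_space \<Omega> G = {u \<in> L_space \<Omega> G.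
     (\<exists>U. has_weak_gradient \<Omega> u U) \<and> (\<lambda>x. norm (weak_gradient \<Omega> u x)) \<in> L_space \<Omega> G}"

definition W1_norm :: "(real^'n) set \<Rightarrow> (real^'n \<Rightarrow> real \<Rightarrow> real) \<Rightarrow> (real^'n \<Rightarrow> real) \<Rightarrow> real" where
  "W1_norm \<Omega> G u = L_norm \<Omega> G u + L_norm \<Omega> G (\<lambda>x. norm (weak_gradient \<Omega> u x))"

text \<open>The completion of \<open>C\<^sub>0\<^sup>\<infinity>(\<Omega>)\<close> inside \<open>W\<^sup>1\<^sup>,\<^sup>G(\<Omega>)\<close>, i.e. its closure in norm.\<close>

definition W10_space :: "(real^'n) set \<Rightarrow> (real^'n \<Rightarrow> real \<Rightarrow> real) \<Rightarrow> (real^'n \<Rightarrow> real) set" where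
  "W10_space \<Omega> G = {u \<in> W1_space \<Omega> G.
     \<exists>\<phi>. (\<forall>k::nat. \<phi> k \<in> test_functions \<Omega>) \<and>
         (\<lambda>k. W1_norm \<Omega> G (\<lambda>x. u x - \<phi> k x)) \<longlonglongrightarrow> 0}"

definition L_infinity :: "(real^'n) set \<Rightarrow> (real^'n \<Rightarrow> real) set" where
  "L_infinity \<Omega> = {u \<in> borel_measurable (lebesgue_on \<Omega>).
     \<exists>C. AE x in lebesgue_on \<Omega>. \<bar>u x\<bar> \<le> C}"

definition cond_G0 :: "(real^'n \<Rightarrow> real \<Rightarrow> real) \<Rightarrow> real \<Rightarrow> real \<Rightarrow> bool" where
  "cond_G0 G gm gp \<longleftrightarrow>
     1 < gm \<and> gm \<le> gp \<and> gp < real CARD('n) \<and>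
     (\<forall>x. \<forall>t>0. gm \<le> N_deriv G x t * t / G x t \<and> N_deriv G x t * t / G x t \<le> gp)"

definition cond_G1 :: "(real^'n \<Rightarrow> real \<Rightarrow> real) \<Rightarrow> bool" where
  "cond_G1 G \<longleftrightarrow> (\<exists>F\<ge>1. AE x in lebesgue. inverse F \<le> G x 1 \<and> G x 1 \<le> F)"

definition cond_G2 :: "(real^'n \<Rightarrow> real \<Rightarrow> real) \<Rightarrow> bool" where
  "cond_G2 G \<longleftrightarrow>
     (\<exists>\<mu>. 0 < \<mu> \<and> \<mu> \<le> 1 \<and>
        (\<forall>c r. r > 0 \<and> measure lebesgue (ball c r) \<le> 1 \<longrightarrow>
           (\<forall>t\<in>{1..1 / measure lebesgue (ball c r)}.
              AE x in lebesgue_on (ball c r). AE y in lebesgue_on (ball c r).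
                \<mu> * N_inv G x t \<le> N_inv G y t)))"

text \<open>Conditions on the functions \<open>H\<^sub>i\<close>; \<open>gm\<close> and \<open>gp\<close> are the exponents \<open>g\<^sup>-\<close>, \<open>g\<^sup>+\<close> of \<open>G\<close>.\<close>

definition cond_H1 :: "(real^'n) set \<Rightarrow> (real^'n \<Rightarrow> real \<Rightarrow> real) \<Rightarrow> bool" where
  "cond_H1 \<Omega> H \<longleftrightarrow> (\<exists>F>1. \<forall>x\<in>\<Omega>. inverse F \<le> H x 1 \<and> H x 1 \<le> F)"

definition cond_H2 ::
  "(real^'n) set \<Rightarrow> (real^'n \<Rightarrow> real \<Rightarrow> real) \<Rightarrow> real \<Rightarrow> real \<Rightarrow> bool" where
  "cond_H2 \<Omega> H gm gp \<longleftrightarrow>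
     (\<exists>hm hp. gp \<le> hm \<and> hp \<le> real CARD('n) * gm / (real CARD('n) - gm) \<and>
        (\<forall>x\<in>\<Omega>. \<forall>t>0. hm \<le> N_deriv H x t * t / H x t \<and> N_deriv H x t * t / H x t \<le> hp))"

definition cond_H3 :: "(real^'n) set \<Rightarrow> (real^'n \<Rightarrow> real \<Rightarrow> real) \<Rightarrow> bool" where
  "cond_H3 \<Omega> H \<longleftrightarrow> (\<forall>t>0. (\<integral>\<^sup>+x. ennreal (H x t) \<partial>lebesgue_on \<Omega>) < \<infinity>)"

definition cond_H4 ::
  "(real^'n) set \<Rightarrow> (real^'n \<Rightarrow> real \<Rightarrow> real) \<Rightarrow> (real^'n \<Rightarrow> real \<Rightarrow> real) \<Rightarrow> bool" where
  "cond_H4 \<Omega> G H \<longleftrightarrow> N_prec \<Omega> G H \<and> N_precprec \<Omega> H (sobolev_conj G)"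

definition caratheodory ::
  "(real^'n) set \<Rightarrow> (real^'n \<Rightarrow> real \<Rightarrow> real^'n \<Rightarrow> 'b::topological_space) \<Rightarrow> bool" where
  "caratheodory \<Omega> f \<longleftrightarrow>
     (\<forall>s \<eta>. (\<lambda>x. f x s \<eta>) \<in> borel_measurable (lebesgue_on \<Omega>)) \<and>
     (AE x in lebesgue_on \<Omega>. continuous_on UNIV (\<lambda>(s, \<eta>). f x s \<eta>))"

definition M_fun ::
  "(real^'n \<Rightarrow> real \<Rightarrow> real) \<Rightarrow> (real^'n \<Rightarrow> real \<Rightarrow> real) \<Rightarrow> real^'n \<Rightarrow> real \<Rightarrow> real" where
  "M_fun G H x t = N_inv (N_compl H) x (G x t)"

definition P_fun ::
  "(real^'n \<Rightarrow> real \<Rightarrow> real) \<Rightarrow> (real^'n \<Rightarrow> real \<Rightarrow> real) \<Rightarrow> real^'n \<Rightarrow> real \<Rightarrow> real" where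
  "P_fun G H x t = N_inv (N_compl G) x (H x t)"

definition cond_A1 ::
  "(real^'n) set \<Rightarrow> (real^'n \<Rightarrow> real \<Rightarrow> real) \<Rightarrow> (real^'n \<Rightarrow> real \<Rightarrow> real) \<Rightarrow>
     (real^'n \<Rightarrow> real \<Rightarrow> real^'n \<Rightarrow> real^'n) \<Rightarrow> bool" where
  "cond_A1 \<Omega> G H A \<longleftrightarrow>
     (\<exists>a4>0. \<exists>a5>0. \<exists>a6>0. AE x in lebesgue_on \<Omega>. \<forall>s \<eta>.
        A x s \<eta> \<bullet> \<eta> \<ge> a4 * G x (norm \<eta>) - a5 * H x \<bar>s\<bar> - a6)"

definition cond_A2 ::
  "(real^'n) set \<Rightarrow> (real^'n \<Rightarrow> real \<Rightarrow> real) \<Rightarrow> (real^'n \<Rightarrow> real \<Rightarrow> real) \<Rightarrow>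
     (real^'n \<Rightarrow> real \<Rightarrow> real^'n \<Rightarrow> real^'n) \<Rightarrow> bool" where
  "cond_A2 \<Omega> G H A \<longleftrightarrow>
     (\<exists>a1>0. \<exists>a2>0. \<exists>a3>0. AE x in lebesgue_on \<Omega>. \<forall>s \<eta>.
        norm (A x s \<eta>) \<le> a1 * N_deriv G x (norm \<eta>) + a2 * P_fun G H x \<bar>s\<bar> + a3)"

definition cond_B ::
  "(real^'n) set \<Rightarrow> (real^'n \<Rightarrow> real \<Rightarrow> real) \<Rightarrow> (real^'n \<Rightarrow> real \<Rightarrow> real) \<Rightarrow>
     (real^'n \<Rightarrow> real \<Rightarrow> real^'n \<Rightarrow> real) \<Rightarrow> bool" where
  "cond_B \<Omega> G H B \<longleftrightarrow>
     (\<exists>b1>0. \<exists>b2>0. \<exists>b3>0. AE x in lebesgue_on \<Omega>. \<forall>s \<eta>.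
        \<bar>B x s \<eta>\<bar> \<le> b1 * M_fun G H x (norm \<eta>) + b2 * N_deriv H x \<bar>s\<bar> + b3)"

text \<open>The Bochner integral of a non-integrable function is \<open>0\<close>, so the existence of the
  two integrals is part of the definition.\<close>

definition weak_solution ::
  "(real^'n) set \<Rightarrow> (real^'n \<Rightarrow> real \<Rightarrow> real) \<Rightarrow> (real^'n \<Rightarrow> real \<Rightarrow> real^'n \<Rightarrow> real^'n) \<Rightarrow>
     (real^'n \<Rightarrow> real \<Rightarrow> real^'n \<Rightarrow> real) \<Rightarrow> (real^'n \<Rightarrow> real) \<Rightarrow> bool" where
  "weak_solution \<Omega> G A B u \<longleftrightarrow>
     u \<in> W10_space \<Omega> G \<and>
     (\<forall>v\<in>W10_space \<Omega> G.
        integrable (lebesgue_on \<Omega>) (\<lambda>x. A x (u x) (weak_gradient \<Omega> u x) \<bullet> weak_gradient \<Omega> v x) \<and>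
        integrable (lebesgue_on \<Omega>) (\<lambda>x. B x (u x) (weak_gradient \<Omega> u x) * v x) \<and>
        (LINT x|lebesgue_on \<Omega>. A x (u x) (weak_gradient \<Omega> u x) \<bullet> weak_gradient \<Omega> v x) -
        (LINT x|lebesgue_on \<Omega>. B x (u x) (weak_gradient \<Omega> u x) * v x) = 0)"

end

theory Submission
  imports Defs "HOL-Real_Asymp.Real_Asymp"
begin

text \<open>
  Let \<open>p = g\<^sup>-\<close>, \<open>q = n p / (n - p)\<close> and \<open>A(k) = {x. k \<le> \<bar>u x\<bar>}\<close>; write \<open>E(k)\<close> for the integral of
  \<open>\<bar>Du\<bar>\<^sup>p\<close> over \<open>A(k)\<close> and \<open>I(k)\<close> for that of \<open>\<bar>u\<bar>\<^sup>q\<close>. The bounds on the logarithmic derivatives of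
  \<open>G\<close> and \<open>H\<^sub>1\<close> integrate to power bounds: \<open>t\<^sup>p \<le> 1 + F G(x,t)\<close>, and \<open>H\<^sub>1(x,t) \<le> F' t\<^sup>q\<close> for
  \<open>t \<ge> 1\<close>, since the exponent of \<open>H\<^sub>1\<close> is at most the Sobolev exponent \<open>q\<close> of \<open>p\<close>. Hence \<open>u\<close>
  satisfies the energy inequality of a \<open>p\<close>-Laplace type equation with lower order terms of critical
  growth, and De Giorgi's iteration for that problem bounds it.

  Two inequalities drive the iteration. Testing the equation with the part of \<open>u\<close> that exceeds
  \<open>k\<close> in absolute value gives the Caccioppoli inequality \<open>E(k) \<le> C I(k)\<close> for \<open>k \<ge> 1\<close> (lemma
  \<open>Caccioppoli\<close>). The role of the Sobolev embedding is played by the level set inequality: for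
  \<open>0 < k < h\<close>, the number \<open>(h - k) \<bar>A(h)\<bar>\<close> is at most \<open>C \<bar>A(k)\<bar> powr (1/n)\<close> times the integral of
  \<open>\<bar>Du\<bar>\<close> over \<open>A(k) - A(h)\<close> (lemma \<open>level_set_inequality\<close>). It comes from
  \<open>\<integral> \<bar>v(x + z) - v(x)\<bar> dx \<le> \<bar>z\<bar> \<integral> \<bar>Dv\<bar>\<close> by averaging over \<open>z\<close> in a ball of volume
  \<open>2 \<bar>A(k)\<bar>\<close>: for each \<open>x \<in> A(h)\<close> at least half of the points \<open>x + z\<close> lie outside \<open>A(k)\<close>.

  Summing the level set inequality over the levels \<open>2\<^sup>j k\<close> gives
  \<open>I(k) \<le> C (k\<^sup>q \<bar>A(k)\<bar> + E(k) powr (q/p))\<close> (lemma \<open>tail_powr_le\<close>). For \<open>k = 1\<close> this shows that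
  \<open>\<bar>u\<bar>\<^sup>q\<close> is integrable. For large \<open>k\<close> the energy \<open>E(k)\<close> is small, and because \<open>q/p > 1\<close> its power is
  absorbed by the left hand side of the Caccioppoli inequality, which leaves
  \<open>E(k) \<le> C k\<^sup>q \<bar>A(k)\<bar>\<close>. For the levels \<open>l(j) = K (2 - 1/2\<^sup>j)\<close> the numbers \<open>Y(j) = K\<^sup>q \<bar>A(l(j))\<bar>\<close> then
  satisfy \<open>Y(j+1) \<le> C 2\<^sup>j Y(j) powr (1 + 1/n)\<close>. As \<open>Y(0) \<le> I(K)\<close> is small for large \<open>K\<close>, they
  tend to \<open>0\<close>, so that \<open>\<bar>u\<bar> \<le> 2 K\<close> almost everywhere (lemma \<open>bounded_if_Caccioppoli\<close>).

  The admissible test functions are limits of smooth functions, so the excess over a level is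
  approximated by smooth functions of \<open>u\<close>. That these belong to the zero boundary value space and
  obey the chain rule is lemma \<open>W10_space_compose\<close>; it needs the scaling of the modular and the
  uniqueness of weak gradients, and the latter needs smooth bump functions.
\<close>

section \<open>Smooth functions\<close>

lemma partial_deriv_eq:
  assumes "(f has_derivative D) (at x)"
  shows "partial_deriv i f x = D (axis i 1)"
  unfolding partial_deriv_def using frechet_derivative_at[OF assms] by simp

lemma C_k_differentiable: "C_k (Suc k) f \<Longrightarrow> (f has_derivative frechet_derivative f (at x)) (at x)"
  by (simp add: differentiable_on_def frechet_derivative_works)

lemma C_k_pred: "C_k (Suc k) f \<Longrightarrow> C_k k f"
proof (induction k arbitrary: f)
  case 0
  then show ?case by (simp add: differentiable_imp_continuous_on)
next
  case (Suc k)
  then show ?case by (metis C_k.simps(2))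
qed

lemma C_k_imp_continuous: "C_k k f \<Longrightarrow> continuous_on UNIV f"
  by (induction k) (auto simp: differentiable_imp_continuous_on)

lemma C_k_const [simp]: "C_k k (\<lambda>x. c)"
proof (induction k arbitrary: c)
  case (Suc k)
  have "partial_deriv i (\<lambda>x. c) = (\<lambda>x. 0)" for i :: 'a
    by (rule ext) (simp add: partial_deriv_eq[OF has_derivative_const])
  with Suc show ?case by (simp add: differentiable_on_const)
qed simp

lemma C_k_add: "C_k k f \<Longrightarrow> C_k k g \<Longrightarrow> C_k k (\<lambda>x. f x + g x)"
proof (induction k arbitrary: f g)
  case 0
  then show ?case by (simp add: continuous_on_add)
next
  case (Suc k)
  have "partial_deriv i (\<lambda>x. f x + g x) = (\<lambda>x. partial_deriv i f x + partial_deriv i g x)" for i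
    by (rule ext, subst partial_deriv_eq[OF has_derivative_add[OF C_k_differentiable C_k_differentiable, OF Suc.prems]])
      (simp add: partial_deriv_def)
  with Suc show ?case by (simp add: differentiable_on_add)
qed

lemma C_k_mult: "C_k k f \<Longrightarrow> C_k k g \<Longrightarrow> C_k k (\<lambda>x. f x * g x)"
proof (induction k arbitrary: f g)
  case 0
  then show ?case by (simp add: continuous_on_mult)
next
  case (Suc k)
  have "partial_deriv i (\<lambda>x. f x * g x) = (\<lambda>x. f x * partial_deriv i g x + partial_deriv i f x * g x)" for i
    by (rule ext, subst partial_deriv_eq[OF has_derivative_mult[OF C_k_differentiable C_k_differentiable, OF Suc.prems]])
      (simp add: partial_deriv_def)
  moreover have "C_k k f" "C_k k g"
    using Suc.prems by (blast intro: C_k_pred)+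
  ultimately show ?case using Suc by (auto simp: differentiable_on_mult intro!: C_k_add)
qed

lemma C_k_prod: "finite S \<Longrightarrow> (\<And>i. i \<in> S \<Longrightarrow> C_k k (f i)) \<Longrightarrow> C_k k (\<lambda>x. \<Prod>i\<in>S. f i x)"
  by (induction S rule: finite_induct) (auto intro: C_k_mult)

lemma partial_deriv_compose:
  assumes "(F has_real_derivative F' (\<phi> x)) (at (\<phi> x))" "(\<phi> has_derivative D) (at x)"
  shows "partial_deriv i (\<lambda>x. F (\<phi> x)) x = F' (\<phi> x) * partial_deriv i \<phi> x"
proof -
  have "((\<lambda>x. F (\<phi> x)) has_derivative (\<lambda>h. F' (\<phi> x) * D h)) (at x)"
    using has_derivative_compose[OF assms(2) assms(1)[unfolded has_field_derivative_def]] by simp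
  from partial_deriv_eq[OF this] partial_deriv_eq[OF assms(2)] show ?thesis by simp
qed

text \<open>A function of one variable is presented with its sequence of derivatives, because for the
  functions needed here all derivatives come from a recursion on polynomials.\<close>

definition smooth_real :: "(real \<Rightarrow> real) \<Rightarrow> bool" where
  "smooth_real F \<longleftrightarrow> (\<exists>D. D 0 = F \<and> (\<forall>m x. (D m has_real_derivative D (Suc m) x) (at x)))"

text \<open>The chain rule turns \<open>D m\<close> into \<open>D (Suc m)\<close>, so the induction has to treat all
  derivatives of the outer function at once.\<close>

lemma C_k_compose_aux:
  assumes D: "\<And>m x. (D m has_real_derivative D (Suc m) x) (at x)"
  shows "C_k k \<phi> \<Longrightarrow> C_k k (\<lambda>x. D m (\<phi> x))"
proof (induction k arbitrary: m)
  case 0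
  have "continuous_on UNIV (D m)"
    using D by (meson DERIV_continuous continuous_at_imp_continuous_on)
  with 0 show ?case
    by (auto intro: continuous_on_compose2)
next
  case (Suc k)
  have "partial_deriv i (\<lambda>x. D m (\<phi> x)) = (\<lambda>x. D (Suc m) (\<phi> x) * partial_deriv i \<phi> x)" for i
    by (rule ext, rule partial_deriv_compose[where F="D m" and F'="D (Suc m)", OF D C_k_differentiable[OF Suc.prems]])
  moreover have "(\<lambda>x. D m (\<phi> x)) differentiable_on UNIV"
    unfolding differentiable_on_def differentiable_def
    using has_derivative_compose[OF C_k_differentiable[OF Suc.prems] D[unfolded has_field_derivative_def]]
    by blast
  ultimately show ?case
    using Suc.prems Suc.IH[OF C_k_pred] by (auto intro!: C_k_mult)
qed

lemma C_k_compose: "smooth_real F \<Longrightarrow> C_k k \<phi> \<Longrightarrow> C_k k (\<lambda>x. F (\<phi> x))"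
  unfolding smooth_real_def using C_k_compose_aux[where m=0] by metis

lemma C_k_affine: "C_k k (\<lambda>x::real^'n. c * x $ i + d)"
proof (cases k)
  case (Suc m)
  have d: "((\<lambda>x. c * x $ i + d) has_derivative (\<lambda>h. c * h $ i)) (at x)" for x :: "real^'n"
    by (auto intro!: derivative_eq_intros bounded_linear.has_derivative[OF bounded_linear_vec_nth])
  have "partial_deriv j (\<lambda>x. c * x $ i + d) = (\<lambda>x. c * axis j 1 $ i)" for j
    by (rule ext, rule partial_deriv_eq[OF d])
  with d Suc show ?thesis
    by (auto simp: differentiable_on_def differentiable_def)
qed (auto intro!: continuous_intros)

lemma smooth_real_uminus: "smooth_real F \<Longrightarrow> smooth_real (\<lambda>t. - F t)"
  unfolding smooth_real_def by (elim exE, rule_tac x="\<lambda>m x. - D m x" in exI)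
    (auto intro!: derivative_eq_intros)

lemma smooth_real_add: "smooth_real F \<Longrightarrow> smooth_real G \<Longrightarrow> smooth_real (\<lambda>t. F t + G t)"
  unfolding smooth_real_def
  by (elim exE, rule_tac x="\<lambda>m x. D m x + Da m x" in exI) (auto intro!: derivative_eq_intros)

lemma smooth_real_diff: "smooth_real F \<Longrightarrow> smooth_real G \<Longrightarrow> smooth_real (\<lambda>t. F t - G t)"
  using smooth_real_add[of F "\<lambda>t. - G t"] smooth_real_uminus[of G] by simp

lemma smooth_real_affine:
  assumes "smooth_real F"
  shows "smooth_real (\<lambda>t. F (a * t + b))"
proof -
  obtain D where D: "D 0 = F" "\<And>m x. (D m has_real_derivative D (Suc m) x) (at x)"
    using assms unfolding smooth_real_def by blast
  have "((\<lambda>t. a ^ m * D m (a * t + b)) has_real_derivative a ^ Suc m * D (Suc m) (a * t + b)) (at t)" for m t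
    by (rule derivative_eq_intros DERIV_chain2[OF D(2)] | simp)+
  with D(1) show ?thesis
    unfolding smooth_real_def by (intro exI[of _ "\<lambda>m t. a ^ m * D m (a * t + b)"]) auto
qed

lemma smooth_real_imp_deriv:
  assumes "smooth_real F" "\<And>t. (F has_real_derivative F' t) (at t)"
  shows "continuous_on UNIV F'"
proof -
  obtain D where D: "D 0 = F" "\<And>m x. (D m has_real_derivative D (Suc m) x) (at x)"
    using assms unfolding smooth_real_def by blast
  have "F' t = D 1 t" for t
    using D(1) D(2)[of 0 t] assms(2)[of t] by (auto intro: DERIV_unique)
  then have "F' = D 1" ..
  then show ?thesis using D(2)[of 1]
    by (metis DERIV_isCont continuous_at_imp_continuous_on)
qed

text \<open>The derivatives of \<open>exp (- 1 / x)\<close> have the form \<open>p (1 / x) * exp (- 1 / x)\<close> with a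
  polynomial \<open>p\<close>, and all of these tend to \<open>0\<close> at \<open>0\<close>.\<close>

definition flat_exp :: "real poly \<Rightarrow> real \<Rightarrow> real" where
  "flat_exp p x = (if x \<le> 0 then 0 else poly p (1 / x) * exp (- (1 / x)))"

lemma poly_mult_exp_minus_at_top: "((\<lambda>y::real. poly p y * exp (- y)) \<longlongrightarrow> 0) at_top"
proof (induction p)
  case (pCons a p)
  have *: "((\<lambda>y::real. y ^ k * exp (- y)) \<longlongrightarrow> 0) at_top" for k
    using tendsto_power_div_exp_0[of k] by (simp add: exp_minus field_simps)
  have "((\<lambda>y::real. poly p y * y * exp (- y)) \<longlongrightarrow> 0) at_top" for p
  proof -
    have "((\<lambda>y::real. \<Sum>i\<le>degree p. coeff p i * (y ^ Suc i * exp (- y))) \<longlongrightarrow> (\<Sum>i\<le>degree p. coeff p i * 0)) at_top"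
      by (intro tendsto_intros *)
    then show ?thesis
      by (simp add: poly_altdef sum_distrib_right sum_distrib_left mult_ac)
  qed
  from tendsto_add[OF tendsto_mult[OF tendsto_const[of a] *[of 0]] this[of p]] show ?case
    by (simp add: algebra_simps)
qed simp

lemma has_real_derivative_flat_exp:
  "(flat_exp p has_real_derivative flat_exp (monom 1 2 * (p - pderiv p)) x) (at x)"
proof -
  consider "x > 0" | "x < 0" | "x = 0" by linarith
  then show ?thesis
  proof cases
    case 1
    have "((\<lambda>x. poly p (1 / x) * exp (- (1 / x))) has_real_derivative
        poly (monom 1 2 * (p - pderiv p)) (1 / x) * exp (- (1 / x))) (at x)"
      using 1 by (auto intro!: derivative_eq_intros DERIV_chain2[OF poly_DERIV]
          simp: poly_monom field_simps power2_eq_square)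
    then have "(flat_exp p has_real_derivative
        poly (monom 1 2 * (p - pderiv p)) (1 / x) * exp (- (1 / x))) (at x)"
      by (rule has_field_derivative_transform_within_open[where S="{0<..}"])
        (use 1 in \<open>auto simp: flat_exp_def\<close>)
    then show ?thesis using 1 by (simp add: flat_exp_def)
  next
    case 2
    have "(flat_exp p has_real_derivative 0) (at x)"
      by (rule has_field_derivative_transform_within_open[where S="{..<0}" and f="\<lambda>x. 0"])
        (use 2 in \<open>auto simp: flat_exp_def\<close>)
    then show ?thesis using 2 by (simp add: flat_exp_def)
  next
    case 3
    have "((\<lambda>y. poly (pCons 0 p) y * exp (- y)) \<longlongrightarrow> 0) at_top"
      by (rule poly_mult_exp_minus_at_top)
    then have "((\<lambda>h. poly (pCons 0 p) (inverse h) * exp (- inverse h)) \<longlongrightarrow> 0) (at_right 0)"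
      by (rule filterlim_compose[OF _ filterlim_inverse_at_top_right])
    then have "((\<lambda>h. flat_exp p h / h) \<longlongrightarrow> 0) (at_right 0)"
      by (rule Lim_transform_eventually)
        (auto simp: flat_exp_def field_simps eventually_at_filter)
    moreover have "((\<lambda>h. flat_exp p h / h) \<longlongrightarrow> 0) (at_left 0)"
      by (rule Lim_transform_eventually[OF tendsto_const])
        (auto simp: flat_exp_def eventually_at_filter)
    ultimately have "((\<lambda>h. flat_exp p h / h) \<longlongrightarrow> 0) (at 0)"
      by (simp add: filterlim_split_at)
    then show ?thesis using 3
      by (simp add: has_field_derivative_iff flat_exp_def)
  qed
qed

lemma smooth_real_flat_exp: "smooth_real (flat_exp p)"
  unfolding smooth_real_def
  by (rule exI[of _ "\<lambda>m. flat_exp (((\<lambda>p. monom 1 2 * (p - pderiv p)) ^^ m) p)"])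
    (use has_real_derivative_flat_exp in auto)

lemma smooth_real_one_minus_exp: "smooth_real (\<lambda>t. 1 - exp (- c * t))"
  unfolding smooth_real_def
  by (rule exI[of _ "\<lambda>m t. (if m = 0 then 1 else 0) - (- c) ^ m * exp (- c * t)"])
    (auto intro!: derivative_eq_intros)

section \<open>Test functions\<close>

lemma test_functions_zero_outside:
  "\<phi> \<in> test_functions \<Omega> \<Longrightarrow> x \<notin> \<Omega> \<Longrightarrow> \<phi> x = 0"
  unfolding test_functions_def using closure_subset[of "{x. \<phi> x \<noteq> 0}"] by auto

lemma test_functions_if_vanishes:
  assumes "\<phi> \<in> test_functions \<Omega>" "\<And>k. C_k k \<psi>" "\<And>x. \<phi> x = 0 \<Longrightarrow> \<psi> x = 0"
  shows "\<psi> \<in> test_functions \<Omega>"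
proof -
  have s: "closure {x. \<psi> x \<noteq> 0} \<subseteq> closure {x. \<phi> x \<noteq> 0}"
    by (rule closure_mono) (use assms(3) in auto)
  have "compact (closure {x. \<psi> x \<noteq> 0})"
    using compact_Int_closed[of "closure {x. \<phi> x \<noteq> 0}" "closure {x. \<psi> x \<noteq> 0}"] s assms(1)
    by (simp add: test_functions_def Int_absorb1)
  with s assms show ?thesis by (auto simp: test_functions_def)
qed

lemma test_functions_compose:
  "\<phi> \<in> test_functions \<Omega> \<Longrightarrow> smooth_real F \<Longrightarrow> F 0 = 0 \<Longrightarrow> (\<lambda>x. F (\<phi> x)) \<in> test_functions \<Omega>"
  by (rule test_functions_if_vanishes[where \<phi>=\<phi>]) (auto simp: test_functions_def intro: C_k_compose)

lemma test_functions_mult: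
  "\<phi> \<in> test_functions \<Omega> \<Longrightarrow> \<psi> \<in> test_functions \<Omega> \<Longrightarrow> (\<lambda>x. \<phi> x * \<psi> x) \<in> test_functions \<Omega>"
  by (rule test_functions_if_vanishes[where \<phi>=\<phi>]) (auto simp: test_functions_def intro: C_k_mult)

lemma test_functions_derivative:
  assumes "\<phi> \<in> test_functions \<Omega>"
  shows "(\<phi> has_derivative (\<lambda>h. (\<chi> i. partial_deriv i \<phi> x) \<bullet> h)) (at x)"
proof -
  have "C_k (Suc 0) \<phi>" using assms unfolding test_functions_def by blast
  from C_k_differentiable[OF this] have D: "(\<phi> has_derivative frechet_derivative \<phi> (at x)) (at x)" .
  then have lin: "linear (frechet_derivative \<phi> (at x))"
    by (rule has_derivative_linear)
  have "frechet_derivative \<phi> (at x) = (\<lambda>h. (\<chi> i. partial_deriv i \<phi> x) \<bullet> h)"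
  proof
    fix h
    have "frechet_derivative \<phi> (at x) h = frechet_derivative \<phi> (at x) (\<Sum>i\<in>UNIV. (h $ i) *\<^sub>R axis i 1)"
      using basis_expansion[of h] by (simp add: scalar_mult_eq_scaleR)
    also have "\<dots> = (\<chi> i. partial_deriv i \<phi> x) \<bullet> h"
      by (simp add: linear_sum[OF lin] linear_scale[OF lin] inner_vec_def partial_deriv_def mult.commute)
    finally show "frechet_derivative \<phi> (at x) h = (\<chi> i. partial_deriv i \<phi> x) \<bullet> h" .
  qed
  with D show ?thesis by simp
qed

definition grad :: "(real^'n \<Rightarrow> real) \<Rightarrow> real^'n \<Rightarrow> real^'n" where
  "grad \<phi> x = (\<chi> i. partial_deriv i \<phi> x)"

lemma test_functions_continuous:
  assumes "\<phi> \<in> test_functions \<Omega>"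
  shows "continuous_on UNIV \<phi>" "continuous_on UNIV (partial_deriv i \<phi>)" "continuous_on UNIV (grad \<phi>)"
proof -
  have "C_k (Suc 0) \<phi>" using assms unfolding test_functions_def by blast
  then have *: "continuous_on UNIV (partial_deriv i \<phi>)" for i by simp
  then show "continuous_on UNIV (partial_deriv i \<phi>)" .
  show "continuous_on UNIV \<phi>"
    using \<open>C_k (Suc 0) \<phi>\<close> C_k_imp_continuous by blast
  show "continuous_on UNIV (grad \<phi>)"
    using * by (auto intro!: continuous_on_vec_lambda simp: grad_def[abs_def])
qed

lemma partial_deriv_zero_outside_support:
  assumes "\<phi> \<in> test_functions \<Omega>" "x \<notin> closure {x. \<phi> x \<noteq> 0}"
  shows "partial_deriv i \<phi> x = 0"
proof -
  have "\<phi> y = 0" if "y \<in> - closure {x. \<phi> x \<noteq> 0}" for y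
    using that closure_subset[of "{x. \<phi> x \<noteq> 0}"] by auto
  note eq = this[symmetric]
  have "(\<phi> has_derivative (\<lambda>h. 0)) (at x)"
  proof (rule has_derivative_transform_within_open[where f="\<lambda>_. 0" and s="- closure {x. \<phi> x \<noteq> 0}"])
    show "x \<in> - closure {x. \<phi> x \<noteq> 0}" using assms(2) by simp
  qed (rule has_derivative_const, rule open_Compl[OF closed_closure], rule eq)
  from partial_deriv_eq[OF this] show ?thesis .
qed

lemma test_functions_bounded:
  assumes "\<phi> \<in> test_functions \<Omega>"
  obtains R C where "R > 0" "C > 0" "\<And>x. \<bar>\<phi> x\<bar> \<le> C" "\<And>x. norm (grad \<phi> x) \<le> C"
    "\<And>x. norm x > R \<Longrightarrow> \<phi> x = 0"
proof -
  let ?K = "closure {x. \<phi> x \<noteq> 0}"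
  have K: "compact ?K" using assms by (simp add: test_functions_def)
  obtain R where R: "\<And>x. x \<in> ?K \<Longrightarrow> norm x \<le> R"
    using compact_imp_bounded[OF K] by (auto simp: bounded_iff)
  have "compact (\<phi> ` ?K)" "compact (grad \<phi> ` ?K)"
    by (intro compact_continuous_image continuous_on_subset[OF test_functions_continuous(1)[OF assms]]
      continuous_on_subset[OF test_functions_continuous(3)[OF assms]] K; simp)+
  then have "bounded (\<phi> ` ?K)" "bounded (grad \<phi> ` ?K)"
    by (auto intro: compact_imp_bounded)
  then obtain C1 C2 where C: "\<And>x. x \<in> ?K \<Longrightarrow> norm (\<phi> x) \<le> C1" "\<And>x. x \<in> ?K \<Longrightarrow> norm (grad \<phi> x) \<le> C2"
    unfolding bounded_iff by blast
  let ?C = "max 1 (max C1 C2)"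
  have "\<phi> x = 0" "grad \<phi> x = 0" if "x \<notin> ?K" for x
    using that partial_deriv_zero_outside_support[OF assms that] closure_subset[of "{x. \<phi> x \<noteq> 0}"]
    by (auto simp: grad_def vec_eq_iff)
  note outside = this
  have "\<bar>\<phi> x\<bar> \<le> ?C \<and> norm (grad \<phi> x) \<le> ?C" for x
  proof (cases "x \<in> ?K")
    case True
    from C[OF this] show ?thesis by (auto simp: le_max_iff_disj)
  next
    case False
    from outside[OF this] show ?thesis by (simp add: le_max_iff_disj)
  qed
  moreover have "\<phi> x = 0" if "norm x > max 1 R" for x
  proof -
    have "x \<notin> ?K" using that R[of x] by auto
    then show ?thesis using closure_subset[of "{x. \<phi> x \<noteq> 0}"] by auto
  qed
  ultimately show ?thesis
    by (intro that[of "max 1 R" ?C]) auto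
qed

lemma grad_compose:
  assumes "\<phi> \<in> test_functions \<Omega>" "\<And>t. (F has_real_derivative F' t) (at t)"
  shows "grad (\<lambda>x. F (\<phi> x)) x = F' (\<phi> x) *\<^sub>R grad \<phi> x"
  unfolding grad_def vec_eq_iff
  using partial_deriv_compose[where F=F and F'=F', OF assms(2) test_functions_derivative[OF assms(1)]]
  by auto

section \<open>Weak gradients\<close>

lemma test_functions_lipschitz:
  assumes "\<phi> \<in> test_functions \<Omega>" "\<And>x. norm (grad \<phi> x) \<le> C"
  shows "\<bar>\<phi> x - \<phi> y\<bar> \<le> C * norm (x - y)"
proof -
  have "norm (\<phi> x - \<phi> y) \<le> C * norm (x - y)"
  proof (rule differentiable_bound[where S=UNIV and f'="\<lambda>x h. grad \<phi> x \<bullet> h"])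
    show "(\<phi> has_derivative (\<lambda>h. grad \<phi> x \<bullet> h)) (at x)" for x
      using test_functions_derivative[OF assms(1)] by (simp add: grad_def)
    show "onorm (\<lambda>h. grad \<phi> x \<bullet> h) \<le> C" for x
    proof (rule onorm_bound)
      show "0 \<le> C" using assms(2)[of x] norm_ge_zero order.trans by blast
      show "norm (grad \<phi> x \<bullet> h) \<le> C * norm h" for h
        using Cauchy_Schwarz_ineq2[of "grad \<phi> x" h] assms(2)[of x]
        by (smt (verit) mult_right_mono norm_ge_zero real_norm_def)
    qed
  qed auto
  then show ?thesis by simp
qed

text \<open>Difference quotients turn translation invariance of the integral into statements about
  derivatives: the integral of a derivative vanishes, and a translate differs from the function by
  at most the integral of the gradient.\<close>

lemma difference_quotients_bounded_convergence:
  assumes "\<phi> \<in> test_functions \<Omega>"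
  defines "Q \<equiv> \<lambda>m z x. real (Suc m) * (\<phi> (x + z /\<^sub>R real (Suc m)) - \<phi> x)"
  shows "(\<lambda>m. Q m z x) \<longlonglongrightarrow> grad \<phi> x \<bullet> z"
    and "\<exists>w. integrable lborel w \<and> (\<forall>m x. norm (Q m z x) \<le> w x)"
proof -
  show "(\<lambda>m. Q m z x) \<longlonglongrightarrow> grad \<phi> x \<bullet> z"
  proof -
    have "((\<lambda>t. \<phi> (x + t *\<^sub>R z)) has_derivative (\<lambda>t. grad \<phi> x \<bullet> (t *\<^sub>R z))) (at 0)"
      using test_functions_derivative[OF assms(1), of x]
      by (intro has_derivative_compose[where f="\<lambda>t. x + t *\<^sub>R z" and g=\<phi> and g'="\<lambda>h. grad \<phi> x \<bullet> h"])
        (auto simp: grad_def intro!: derivative_eq_intros)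
    moreover have "(*) (grad \<phi> x \<bullet> z) = (\<lambda>t. grad \<phi> x \<bullet> (t *\<^sub>R z))"
      by (auto simp: mult.commute)
    ultimately have "((\<lambda>t. \<phi> (x + t *\<^sub>R z)) has_real_derivative grad \<phi> x \<bullet> z) (at 0)"
      unfolding has_field_derivative_def by metis
    then have lim: "((\<lambda>t. (\<phi> (x + t *\<^sub>R z) - \<phi> x) / t) \<longlongrightarrow> grad \<phi> x \<bullet> z) (at 0)"
      by (simp add: has_field_derivative_iff)
    have "filterlim (\<lambda>m. inverse (real (Suc m))) (at 0) sequentially"
      unfolding filterlim_at using LIMSEQ_inverse_real_of_nat by auto
    from filterlim_compose[OF lim this] show ?thesis
      by (simp add: Q_def mult.commute divide_inverse)
  qed
  obtain R C where RC: "R > 0" "C > 0" "\<And>x. norm (grad \<phi> x) \<le> C" "\<And>x. norm x > R \<Longrightarrow> \<phi> x = 0"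
    using test_functions_bounded[OF assms(1)] by metis
  let ?w = "\<lambda>x. indicator (cball 0 (R + norm z)) x * (C * norm z)"
  have "norm (Q m z x) \<le> ?w x" for m x
  proof (cases "x \<in> cball 0 (R + norm z)")
    case True
    have "norm (Q m z x) = real (Suc m) * \<bar>\<phi> (x + z /\<^sub>R real (Suc m)) - \<phi> x\<bar>"
      by (simp add: Q_def abs_mult)
    also have "\<dots> \<le> real (Suc m) * (C * norm (x + z /\<^sub>R real (Suc m) - x))"
      by (intro mult_left_mono test_functions_lipschitz[OF assms(1) RC(3)]) auto
    also have "\<dots> = C * norm z" by (simp add: field_simps)
    finally show ?thesis using True by simp
  next
    case False
    have "norm (z /\<^sub>R real (Suc m)) \<le> norm z" 
      using mult_left_mono[of 1 "1 + real m" "norm z"] by (simp add: divide_simps)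
    then have "norm (x + z /\<^sub>R real (Suc m)) > R" "norm x > R"
      using False norm_triangle_ineq4[of "x + z /\<^sub>R real (Suc m)" "z /\<^sub>R real (Suc m)"]
        norm_ge_zero[of z] by (auto simp del: norm_ge_zero)
    then show ?thesis using RC(4) False by (simp add: Q_def)
  qed
  moreover have "integrable lborel ?w"
    by (intro integrable_mult_left integrable_real_indicator) (use emeasure_bounded_finite[of "cball 0 (R + norm z)"] in auto)
  ultimately show "\<exists>w. integrable lborel w \<and> (\<forall>m x. norm (Q m z x) \<le> w x)" by blast
qed

lemma continuous_compact_support_integrable:
  fixes f :: "real^'n \<Rightarrow> 'b::{banach, second_countable_topology}"
  assumes "continuous_on UNIV f" "\<And>x. norm x > R \<Longrightarrow> f x = 0"
  shows "integrable lborel f"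
proof -
  have "integrable lborel (\<lambda>x. indicator (cball 0 R) x *\<^sub>R f x)"
    by (rule borel_integrable_compact) (auto intro: continuous_on_subset[OF assms(1)])
  also have "(\<lambda>x. indicator (cball 0 R) x *\<^sub>R f x) = f"
    using assms(2) by (fastforce simp: indicator_def)
  finally show ?thesis .
qed

lemma test_functions_integrable:
  assumes "\<phi> \<in> test_functions \<Omega>"
  shows "integrable lborel \<phi>"
proof -
  obtain R where "\<And>x. norm x > R \<Longrightarrow> \<phi> x = 0"
    using test_functions_bounded[OF assms] by metis
  then show ?thesis
    using test_functions_continuous(1)[OF assms] by (rule continuous_compact_support_integrable[rotated])
qed

lemma lborel_integral_translate:
  fixes f :: "real^'n \<Rightarrow> real"
  assumes [measurable]: "f \<in> borel_measurable borel"
  shows "(LINT x|lborel. f (x + z)) = (LINT x|lborel. f x)"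
  using integral_distr[of "(+) z" lborel borel f] lborel_distr_plus[of z] assms
  by (simp add: add.commute)

lemma integral_partial_deriv_eq_0:
  assumes "\<phi> \<in> test_functions \<Omega>"
  shows "(LINT x|lborel. partial_deriv i \<phi> x) = 0"
proof -
  let ?z = "axis i (1::real)"
  let ?Q = "\<lambda>m x. real (Suc m) * (\<phi> (x + ?z /\<^sub>R real (Suc m)) - \<phi> x)"
  have [measurable]: "\<phi> \<in> borel_measurable borel" "partial_deriv i \<phi> \<in> borel_measurable borel"
    using test_functions_continuous[OF assms] by (auto intro: borel_measurable_continuous_onI)
  obtain w where w: "integrable lborel w" "\<And>m x. norm (?Q m x) \<le> w x"
    using difference_quotients_bounded_convergence(2)[OF assms, of ?z] by blast
  have "(\<lambda>m. ?Q m x) \<longlonglongrightarrow> partial_deriv i \<phi> x" for x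
    using difference_quotients_bounded_convergence(1)[OF assms, where z = ?z and x = x]
    by (simp add: inner_axis grad_def)
  then have "(\<lambda>m. LINT x|lborel. ?Q m x) \<longlonglongrightarrow> (LINT x|lborel. partial_deriv i \<phi> x)"
    using w by (intro integral_dominated_convergence[where w=w]) auto
  moreover have "(LINT x|lborel. ?Q m x) = 0" for m
  proof -
    have i: "integrable lborel (\<lambda>x. \<phi> (x + ?z /\<^sub>R real (Suc m)))"
    proof -
      have "integrable (distr lborel borel ((+) (?z /\<^sub>R real (Suc m)))) \<phi>"
        unfolding lborel_distr_plus by (rule test_functions_integrable[OF assms])
      from integrable_distr[OF _ this] show ?thesis by (simp add: add.commute)
    qed
    show ?thesis
      using Bochner_Integration.integral_diff[OF i test_functions_integrable[OF assms]]
        lborel_integral_translate[of \<phi> "?z /\<^sub>R real (Suc m)"] by simp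
  qed
  ultimately show ?thesis by (simp add: LIMSEQ_const_iff)
qed

lemma partial_deriv_zero_outside:
  assumes "\<phi> \<in> test_functions \<Omega>" "x \<notin> \<Omega>"
  shows "partial_deriv i \<phi> x = 0"
  using assms partial_deriv_zero_outside_support[OF assms(1)] by (auto simp: test_functions_def)

lemma integral_lebesgue_on_eq:
  fixes f :: "real^'n \<Rightarrow> real"
  assumes "\<Omega> \<in> sets lebesgue" "\<And>x. x \<notin> \<Omega> \<Longrightarrow> f x = 0"
  shows "(LINT x|lebesgue_on \<Omega>. f x) = (LINT x|lebesgue. f x)"
  using assms by (subst integral_restrict_space) (auto intro!: Bochner_Integration.integral_cong simp: indicator_def)

lemma integrable_lebesgue_on_iff:
  fixes f :: "real^'n \<Rightarrow> 'b::{banach, second_countable_topology}"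
  assumes "\<Omega> \<in> sets lebesgue" "\<And>x. x \<notin> \<Omega> \<Longrightarrow> f x = 0"
  shows "integrable (lebesgue_on \<Omega>) f \<longleftrightarrow> integrable lebesgue f"
  using assms by (subst integrable_restrict_space) (auto intro!: Bochner_Integration.integrable_cong simp: indicator_def)

lemma continuous_locally_integrable:
  fixes f :: "real^'n \<Rightarrow> 'b::{banach, second_countable_topology}"
  assumes "continuous_on UNIV f"
  shows "locally_integrable \<Omega> f"
  unfolding locally_integrable_def set_integrable_def
proof (intro allI impI)
  fix K assume "compact K \<and> K \<subseteq> \<Omega>"
  then have K: "compact K" by simp
  have "integrable lborel (\<lambda>x. indicator K x *\<^sub>R f x)"
    by (rule borel_integrable_compact[OF K]) (auto intro: continuous_on_subset[OF assms])
  moreover have [measurable]: "K \<in> sets borel" "f \<in> borel_measurable borel"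
    using K borel_compact borel_measurable_continuous_onI[OF assms] by auto
  then have "(\<lambda>x. indicator K x *\<^sub>R f x) \<in> borel_measurable lborel" by measurable
  ultimately show "integrable lebesgue (\<lambda>x. indicator K x *\<^sub>R f x)"
    by (simp add: integrable_completion)
qed

lemma test_function_has_weak_gradient:
  assumes "open \<Omega>" "\<phi> \<in> test_functions \<Omega>"
  shows "has_weak_gradient \<Omega> \<phi> (grad \<phi>)"
  unfolding has_weak_gradient_def
proof (intro conjI ballI allI)
  show "locally_integrable \<Omega> \<phi>" "locally_integrable \<Omega> (grad \<phi>)"
    using test_functions_continuous[OF assms(2)] by (auto intro: continuous_locally_integrable)
  fix \<psi> i assume \<psi>: "\<psi> \<in> test_functions \<Omega>"
  have S: "\<Omega> \<in> sets lebesgue" using assms(1) by auto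
  have meas [measurable]: "\<phi> \<in> borel_measurable borel" "\<psi> \<in> borel_measurable borel"
    "partial_deriv i \<phi> \<in> borel_measurable borel" "partial_deriv i \<psi> \<in> borel_measurable borel"
    using test_functions_continuous[OF assms(2)] test_functions_continuous[OF \<psi>]
    by (auto intro: borel_measurable_continuous_onI)
  have D: "partial_deriv i (\<lambda>x. \<phi> x * \<psi> x) x = \<phi> x * partial_deriv i \<psi> x + partial_deriv i \<phi> x * \<psi> x" for x
    using partial_deriv_eq[OF has_derivative_mult[OF test_functions_derivative[OF assms(2)] test_functions_derivative[OF \<psi>]], of i x]
    by (simp add: inner_axis)
  obtain R where R: "\<And>x. norm x > R \<Longrightarrow> \<phi> x = 0"
    using test_functions_bounded[OF assms(2)] by metis
  obtain R' where R': "\<And>x. norm x > R' \<Longrightarrow> \<psi> x = 0"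
    using test_functions_bounded[OF \<psi>] by metis
  have i1: "integrable lborel (\<lambda>x. \<phi> x * partial_deriv i \<psi> x)"
    using test_functions_continuous[OF assms(2)] test_functions_continuous[OF \<psi>] R
    by (intro continuous_compact_support_integrable[of _ R] continuous_on_mult) auto
  have i2: "integrable lborel (\<lambda>x. partial_deriv i \<phi> x * \<psi> x)"
    using test_functions_continuous[OF assms(2)] test_functions_continuous[OF \<psi>] R'
    by (intro continuous_compact_support_integrable[of _ R'] continuous_on_mult) auto
  have "0 = (LINT x|lborel. \<phi> x * partial_deriv i \<psi> x + partial_deriv i \<phi> x * \<psi> x)"
    using integral_partial_deriv_eq_0[OF test_functions_mult[OF assms(2) \<psi>], of i] by (simp add: D)
  also have "\<dots> = (LINT x|lborel. \<phi> x * partial_deriv i \<psi> x) + (LINT x|lborel. partial_deriv i \<phi> x * \<psi> x)"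
    using i1 i2 by (rule Bochner_Integration.integral_add)
  finally have "(LINT x|lebesgue. \<phi> x * partial_deriv i \<psi> x) = - (LINT x|lebesgue. partial_deriv i \<phi> x * \<psi> x)"
    by (simp add: integral_completion)
  then show "(LINT x|lebesgue_on \<Omega>. \<phi> x * partial_deriv i \<psi> x) = - (LINT x|lebesgue_on \<Omega>. grad \<phi> x $ i * \<psi> x)"
    using test_functions_zero_outside[OF assms(2)] test_functions_zero_outside[OF \<psi>]
    by (simp add: integral_lebesgue_on_eq[OF S] grad_def)
qed

subsection \<open>Uniqueness\<close>

text \<open>A smooth function that is positive exactly on the open box.\<close>

definition box_bump :: "real^'n \<Rightarrow> real^'n \<Rightarrow> real^'n \<Rightarrow> real" where
  "box_bump a b x = (\<Prod>i\<in>UNIV. flat_exp 1 (x $ i - a $ i) * flat_exp 1 (b $ i - x $ i))"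

lemma box_bump_pos: "x \<in> box a b \<Longrightarrow> 0 < box_bump a b x"
proof -
  assume "x \<in> box a b"
  then have "0 < x $ i - a $ i" "0 < b $ i - x $ i" for i by (simp_all add: mem_box_cart)
  then show ?thesis
    unfolding box_bump_def flat_exp_def by (intro prod_pos) (simp add: not_le)
qed

lemma box_bump_zero: "x \<notin> box a b \<Longrightarrow> box_bump a b x = 0"
  unfolding box_bump_def by (intro prod_zero) (auto simp: mem_box_cart flat_exp_def not_less)

lemma box_bump_test_function:
  assumes "cbox a b \<subseteq> \<Omega>"
  shows "box_bump a b \<in> test_functions \<Omega>"
proof -
  have s: "closure {x. box_bump a b x \<noteq> 0} \<subseteq> cbox a b"
    using box_bump_zero box_subset_cbox[of a b] by (intro closure_minimal closed_cbox) blast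
  have "compact (closure {x. box_bump a b x \<noteq> 0})"
    using compact_Int_closed[OF compact_cbox, of "closure {x. box_bump a b x \<noteq> 0}" a b] s
    by (simp add: Int_absorb1)
  moreover have "C_k k (box_bump a b)" for k
  proof -
    have "C_k k (\<lambda>x. flat_exp 1 (1 * x $ i + - a $ i) * flat_exp 1 (- 1 * x $ i + b $ i))" for i
      by (intro C_k_mult C_k_compose[OF smooth_real_flat_exp] C_k_affine)
    then show ?thesis unfolding box_bump_def[abs_def]
      by (intro C_k_prod) (simp_all add: algebra_simps)
  qed
  ultimately show ?thesis using s assms by (auto simp: test_functions_def)
qed

text \<open>The test functions \<open>1 - exp (- j * box_bump a b x)\<close> increase to the indicator of the box.\<close>

lemma fundamental_lemma_box:
  fixes f :: "real^'n \<Rightarrow> real"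
  assumes "open \<Omega>" "locally_integrable \<Omega> f" "cbox a b \<subseteq> \<Omega>"
    and zero: "\<And>\<phi>. \<phi> \<in> test_functions \<Omega> \<Longrightarrow> (LINT x|lebesgue_on \<Omega>. f x * \<phi> x) = 0"
  shows "(LINT x|lebesgue. indicator (box a b) x * f x) = 0"
proof -
  have S: "\<Omega> \<in> sets lebesgue" using assms(1) by auto
  let ?\<psi> = "\<lambda>j x. 1 - exp (- real j * box_bump a b x)"
  have int: "integrable lebesgue (\<lambda>x. indicator (cbox a b) x * f x)"
    using assms(2,3) by (auto simp: locally_integrable_def set_integrable_def)
  have b0: "0 \<le> box_bump a b x" for x
    using box_bump_pos[of x a b] box_bump_zero[of x a b] by (cases "x \<in> box a b") auto
  have "(\<lambda>j. LINT x|lebesgue. (indicator (cbox a b) x * f x) * ?\<psi> j x)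
      \<longlonglongrightarrow> (LINT x|lebesgue. (indicator (cbox a b) x * f x) * indicator (box a b) x)"
  proof (rule integral_dominated_convergence[where w="\<lambda>x. norm (indicator (cbox a b) x * f x)"])
    have "continuous_on UNIV (box_bump a b)"
      by (rule test_functions_continuous(1)[OF box_bump_test_function[of a b UNIV]]) simp
    then have [measurable]: "box_bump a b \<in> borel_measurable lebesgue"
      by (intro measurable_completion) (simp add: borel_measurable_continuous_onI)
    then have "?\<psi> j \<in> borel_measurable lebesgue" for j by measurable
    note meas = borel_measurable_integrable[OF int] this
    show "(\<lambda>x. (indicator (cbox a b) x * f x) * ?\<psi> j x) \<in> borel_measurable lebesgue" for j
      by (intro borel_measurable_times meas)
    show "(\<lambda>x. (indicator (cbox a b) x * f x) * indicator (box a b) x) \<in> borel_measurable lebesgue"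
      by (intro borel_measurable_times meas borel_measurable_indicator) simp
    show "AE x in lebesgue. (\<lambda>j. (indicator (cbox a b) x * f x) * ?\<psi> j x)
        \<longlonglongrightarrow> (indicator (cbox a b) x * f x) * indicator (box a b) x"
    proof (rule AE_I2, rule tendsto_mult[OF tendsto_const])
      fix x
      show "(\<lambda>j. ?\<psi> j x) \<longlonglongrightarrow> indicator (box a b) x"
      proof (cases "x \<in> box a b")
        case True
        have "(\<lambda>j. ?\<psi> j x) = (\<lambda>j. 1 - exp (- box_bump a b x) ^ j)"
          by (simp add: exp_of_nat_mult[symmetric])
        moreover have "(\<lambda>j. 1 - exp (- box_bump a b x) ^ j) \<longlonglongrightarrow> 1 - 0"
          using box_bump_pos[OF True] by (intro tendsto_intros LIMSEQ_power_zero) auto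
        ultimately show ?thesis using True by simp
      qed (simp add: box_bump_zero)
    qed
    show "AE x in lebesgue. norm ((indicator (cbox a b) x * f x) * ?\<psi> j x) \<le> norm (indicator (cbox a b) x * f x)" for j
    proof (rule AE_I2)
      fix x
      have "0 \<le> ?\<psi> j x" "?\<psi> j x \<le> 1" using b0[of x] by auto
      then have "\<bar>?\<psi> j x\<bar> \<le> 1" by simp
      then show "norm ((indicator (cbox a b) x * f x) * ?\<psi> j x) \<le> norm (indicator (cbox a b) x * f x)"
        unfolding norm_mult[of _ "?\<psi> j x"] by (intro mult_left_le) auto
    qed
  qed (use int in auto)
  moreover have "(LINT x|lebesgue. (indicator (cbox a b) x * f x) * ?\<psi> j x) = 0" for j
  proof -
    have t: "?\<psi> j \<in> test_functions \<Omega>"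
      by (rule test_functions_compose[OF box_bump_test_function[OF assms(3)] smooth_real_one_minus_exp]) simp
    have eq: "(indicator (cbox a b) x * f x) * ?\<psi> j x = f x * ?\<psi> j x" for x
      using box_bump_zero[of x a b] box_subset_cbox[of a b] by (auto simp: indicator_def)
    show ?thesis
      unfolding eq using zero[OF t] test_functions_zero_outside[OF t]
      by (subst (asm) integral_lebesgue_on_eq[OF S]) auto
  qed
  moreover have "(indicator (cbox a b) x * f x) * indicator (box a b) x = indicator (box a b) x * f x" for x
    using box_subset_cbox[of a b] by (auto simp: indicator_def)
  ultimately show ?thesis by (simp add: LIMSEQ_const_iff)
qed

text \<open>By Lebesgue's differentiation theorem the function is almost everywhere the limit of its
  averages over small cubes.\<close>

lemma integral_boxes_zero_imp_zero:
  fixes g :: "real^'n \<Rightarrow> real"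
  assumes int: "integrable lebesgue g"
    and zero: "\<And>a b. (LINT x|lebesgue. indicator (box a b) x * g x) = 0"
  shows "AE x in lebesgue. g x = 0"
proof -
  have on: "g integrable_on cbox a b" and z: "integral (cbox a b) g = 0" for a b
  proof -
    have si: "set_integrable lebesgue (cbox a b) g"
      unfolding set_integrable_def using int by (intro integrable_mult_indicator) auto
    then show "g integrable_on cbox a b"
      by (rule set_lebesgue_integral_eq_integral(1))
    have "integral (cbox a b) g = (LINT x:cbox a b|lebesgue. g x)"
      using set_lebesgue_integral_eq_integral(2)[OF si] by simp
    also have "\<dots> = (LINT x|lebesgue. indicator (box a b) x * g x)"
      unfolding set_lebesgue_integral_def
    proof (rule integral_cong_AE)
      have "AE x in lebesgue. x \<notin> cbox a b - box a b"
        by (rule AE_not_in) (use negligible_frontier_interval[of a b] negligible_iff_null_sets in blast)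
      then show "AE x in lebesgue. indicator (cbox a b) x *\<^sub>R g x = indicator (box a b) x * g x"
        by eventually_elim (use box_subset_cbox[of a b] in \<open>auto simp: indicator_def\<close>)
    qed (intro borel_measurable_times borel_measurable_scaleR borel_measurable_integrable[OF int]
        borel_measurable_indicator; simp)+
    finally show "integral (cbox a b) g = 0" using zero by simp
  qed
  obtain N where N: "negligible N" "\<And>x e. \<lbrakk>x \<notin> N; 0 < e\<rbrakk> \<Longrightarrow>
      \<exists>d>0. \<forall>h. 0 < h \<and> h < d \<longrightarrow>
        norm (integral (cbox x (x + h *\<^sub>R One)) g /\<^sub>R h ^ DIM(real^'n) - g x) < e"
    using integrable_ccontinuous_explicit[OF on] by metis
  have "g x = 0" if nx: "x \<notin> N" for x
  proof (rule ccontr)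
    assume "g x \<noteq> 0"
    then obtain d where "d > 0" "\<And>h. 0 < h \<Longrightarrow> h < d \<Longrightarrow>
        norm (integral (cbox x (x + h *\<^sub>R One)) g /\<^sub>R h ^ DIM(real^'n) - g x) < norm (g x)"
      using N(2)[OF nx, of "norm (g x)"] by auto
    from this(2)[of "d / 2"] this(1) show False by (simp add: z)
  qed
  moreover have "AE x in lebesgue. x \<notin> N"
    using N(1) by (intro AE_not_in) (simp add: negligible_iff_null_sets)
  ultimately show ?thesis by (rule eventually_mono[rotated])
qed

text \<open>An open set is a countable union of closed boxes, and their boundaries are null sets.\<close>

lemma AE_open_if_AE_boxes:
  fixes \<Omega> :: "(real^'n) set"
  assumes "open \<Omega>" "\<And>a b. cbox a b \<subseteq> \<Omega> \<Longrightarrow> AE x in lebesgue. x \<in> box a b \<longrightarrow> P x"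
  shows "AE x in lebesgue_on \<Omega>. P x"
proof -
  obtain D where D: "countable D" "D \<subseteq> Pow \<Omega>" "\<And>X. X \<in> D \<Longrightarrow> \<exists>a b. X = cbox a b" "\<Union>D = \<Omega>"
    using open_countable_Union_open_cbox[OF assms(1)] by auto
  have box: "AE x in lebesgue. x \<in> X \<longrightarrow> P x" if "X \<in> D" for X
  proof -
    obtain a b where X: "X = cbox a b" using D(3) \<open>X \<in> D\<close> by blast
    then have "AE x in lebesgue. x \<in> box a b \<longrightarrow> P x"
      using D(2) \<open>X \<in> D\<close> by (intro assms(2)) auto
    moreover have "AE x in lebesgue. x \<notin> cbox a b - box a b"
      by (rule AE_not_in) (use negligible_frontier_interval[of a b] negligible_iff_null_sets in blast)
    ultimately show ?thesis unfolding X by eventually_elim auto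
  qed
  have "AE x in lebesgue. \<forall>X\<in>D. x \<in> X \<longrightarrow> P x"
    using box by (subst AE_ball_countable[OF D(1)]) blast
  then have "AE x in lebesgue. x \<in> \<Omega> \<longrightarrow> P x"
    by eventually_elim (use D(4) in blast)
  then show ?thesis
    using assms(1) by (subst AE_restrict_space_iff) auto
qed

lemma fundamental_lemma:
  fixes f :: "real^'n \<Rightarrow> real"
  assumes "open \<Omega>" "locally_integrable \<Omega> f"
    and "\<And>\<phi>. \<phi> \<in> test_functions \<Omega> \<Longrightarrow> (LINT x|lebesgue_on \<Omega>. f x * \<phi> x) = 0"
  shows "AE x in lebesgue_on \<Omega>. f x = 0"
proof (rule AE_open_if_AE_boxes[OF assms(1)])
  fix a b :: "real^'n" assume ab: "cbox a b \<subseteq> \<Omega>"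
  have "integrable lebesgue (\<lambda>x. indicator (cbox a b) x * f x)"
    using assms(2) ab by (auto simp: locally_integrable_def set_integrable_def)
  from integrable_real_mult_indicator[OF _ this, of "box a b"]
  have "integrable lebesgue (\<lambda>x. indicator (cbox a b) x * f x * indicator (box a b) x)" by simp
  also have "(\<lambda>x. indicator (cbox a b) x * f x * indicator (box a b) x) = (\<lambda>x. indicator (box a b) x * f x)"
    using box_subset_cbox[of a b] by (intro ext) (auto simp: indicator_def)
  finally have int: "integrable lebesgue (\<lambda>x. indicator (box a b) x * f x)" .
  have "AE x in lebesgue. indicator (box a b) x * f x = 0"
  proof (rule integral_boxes_zero_imp_zero[OF int])
    fix c d :: "real^'n"
    define e where "e = (\<Sum>i\<in>Basis. max (a \<bullet> i) (c \<bullet> i) *\<^sub>R i)"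
    define g where "g = (\<Sum>i\<in>Basis. min (b \<bullet> i) (d \<bullet> i) *\<^sub>R i)"
    have int_box: "box a b \<inter> box c d = box e g" unfolding e_def g_def by (rule box_Int_box)
    have "cbox e g \<subseteq> cbox a b" unfolding e_def g_def by (auto simp: mem_box)
    then have "(LINT x|lebesgue. indicator (box e g) x * f x) = 0"
      using ab by (intro fundamental_lemma_box[OF assms(1,2) _ assms(3)]) auto
    then show "(LINT x|lebesgue. indicator (box c d) x * (indicator (box a b) x * f x)) = 0"
      by (simp add: int_box[symmetric] indicator_inter_arith mult_ac)
  qed
  then show "AE x in lebesgue. x \<in> box a b \<longrightarrow> f x = 0"
    by eventually_elim (auto simp: indicator_def)
qed

lemma integrable_lebesgue_on_mult_bounded:
  fixes f g :: "real^'n \<Rightarrow> real"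
  assumes "integrable (lebesgue_on S) f" "g \<in> borel_measurable (lebesgue_on S)" "\<And>x. \<bar>g x\<bar> \<le> C"
  shows "integrable (lebesgue_on S) (\<lambda>x. f x * g x)"
proof (rule Bochner_Integration.integrable_bound)
  show "integrable (lebesgue_on S) (\<lambda>x. C * f x)" using assms by simp
  show "AE x in lebesgue_on S. norm (f x * g x) \<le> norm (C * f x)"
  proof (rule AE_I2)
    fix x
    have "\<bar>f x\<bar> * \<bar>g x\<bar> \<le> \<bar>f x\<bar> * \<bar>C\<bar>" using assms(3)[of x] by (intro mult_left_mono) auto
    then show "norm (f x * g x) \<le> norm (C * f x)" by (simp add: abs_mult mult.commute)
  qed
qed (use assms in \<open>auto intro!: borel_measurable_times\<close>)

lemma locally_integrable_mult_bounded_support: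
  fixes f \<psi> :: "real^'n \<Rightarrow> real"
  assumes "open \<Omega>" "locally_integrable \<Omega> f" "\<psi> \<in> borel_measurable borel"
    and "compact K" "K \<subseteq> \<Omega>" "\<And>x. x \<notin> K \<Longrightarrow> \<psi> x = 0" "\<And>x. \<bar>\<psi> x\<bar> \<le> C"
  shows "integrable (lebesgue_on \<Omega>) (\<lambda>x. f x * \<psi> x)"
proof -
  have "integrable lebesgue (\<lambda>x. indicator K x * f x)"
    using assms by (auto simp: locally_integrable_def set_integrable_def)
  moreover have "\<psi> \<in> borel_measurable lebesgue"
    using assms(3) by (intro measurable_completion) simp
  ultimately have "integrable lebesgue (\<lambda>x. (indicator K x * f x) * \<psi> x)"
    using integrable_lebesgue_on_mult_bounded[of UNIV _ \<psi> C] assms(7) by (simp add: lebesgue_on_UNIV_eq)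
  also have "(\<lambda>x. (indicator K x * f x) * \<psi> x) = (\<lambda>x. f x * \<psi> x)"
    using assms(6) by (intro ext) (auto simp: indicator_def)
  finally show ?thesis
    using assms by (subst integrable_lebesgue_on_iff) auto
qed

lemma locally_integrable_vec_nth:
  fixes U :: "real^'n \<Rightarrow> real^'n"
  shows "locally_integrable \<Omega> U \<Longrightarrow> locally_integrable \<Omega> (\<lambda>x. U x $ i)"
  unfolding locally_integrable_def set_integrable_def
  using integrable_bounded_linear[OF bounded_linear_vec_nth[of i]] by fastforce

lemma locally_integrable_diff:
  fixes f g :: "real^'n \<Rightarrow> 'b::{banach, second_countable_topology}"
  shows "locally_integrable \<Omega> f \<Longrightarrow> locally_integrable \<Omega> g \<Longrightarrow> locally_integrable \<Omega> (\<lambda>x. f x - g x)"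
  unfolding locally_integrable_def set_integrable_def
  by (auto simp: scaleR_right_diff_distrib)

lemma locally_integrable_times_test:
  assumes "open \<Omega>" "locally_integrable \<Omega> f" "\<phi> \<in> test_functions \<Omega>"
  shows "integrable (lebesgue_on \<Omega>) (\<lambda>x. f x * \<phi> x)"
    and "integrable (lebesgue_on \<Omega>) (\<lambda>x. f x * partial_deriv i \<phi> x)"
proof -
  let ?K = "closure {x. \<phi> x \<noteq> 0}"
  obtain C where C: "\<And>x. \<bar>\<phi> x\<bar> \<le> C" "\<And>x. norm (grad \<phi> x) \<le> C"
    using test_functions_bounded[OF assms(3)] by metis
  have K: "compact ?K" "?K \<subseteq> \<Omega>" using assms(3) by (auto simp: test_functions_def)
  have "\<phi> x = 0" if "x \<notin> ?K" for x using that closure_subset[of "{x. \<phi> x \<noteq> 0}"] by auto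
  then show "integrable (lebesgue_on \<Omega>) (\<lambda>x. f x * \<phi> x)"
    by (rule locally_integrable_mult_bounded_support[OF assms(1,2)
          borel_measurable_continuous_onI[OF test_functions_continuous(1)[OF assms(3)]] K _ C(1)])
  have "\<bar>partial_deriv i \<phi> x\<bar> \<le> C" for x
    using component_le_norm_cart[of "grad \<phi> x" i] C(2)[of x] by (simp add: grad_def)
  then show "integrable (lebesgue_on \<Omega>) (\<lambda>x. f x * partial_deriv i \<phi> x)"
    using partial_deriv_zero_outside_support[OF assms(3)]
    by (intro locally_integrable_mult_bounded_support[OF assms(1,2)
          borel_measurable_continuous_onI[OF test_functions_continuous(2)[OF assms(3)]] K])
qed

text \<open>Uniqueness makes the representative chosen by \<open>weak_gradient\<close> agree almost everywhere with
  every weak gradient that is computed by hand.\<close>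

lemma weak_gradient_unique:
  assumes "open \<Omega>" and U: "has_weak_gradient \<Omega> u U" "has_weak_gradient \<Omega> u V"
  shows "AE x in lebesgue_on \<Omega>. U x = V x"
proof -
  have "AE x in lebesgue_on \<Omega>. U x $ i - V x $ i = 0" for i
  proof (rule fundamental_lemma[OF assms(1)])
    have li: "locally_integrable \<Omega> (\<lambda>x. U x $ i)" "locally_integrable \<Omega> (\<lambda>x. V x $ i)"
      using U by (auto simp: has_weak_gradient_def intro: locally_integrable_vec_nth)
    then show "locally_integrable \<Omega> (\<lambda>x. U x $ i - V x $ i)" by (rule locally_integrable_diff)
    fix \<phi> assume \<phi>: "\<phi> \<in> test_functions \<Omega>"
    have "(LINT x|lebesgue_on \<Omega>. U x $ i * \<phi> x) = (LINT x|lebesgue_on \<Omega>. V x $ i * \<phi> x)"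
      using U \<phi> by (auto simp: has_weak_gradient_def)
    then show "(LINT x|lebesgue_on \<Omega>. (U x $ i - V x $ i) * \<phi> x) = 0"
      using locally_integrable_times_test(1)[OF assms(1) _ \<phi>] li
      by (simp add: left_diff_distrib Bochner_Integration.integral_diff)
  qed
  then have "AE x in lebesgue_on \<Omega>. \<forall>i\<in>UNIV. U x $ i - V x $ i = 0"
    by (intro AE_finite_allI) auto
  then show ?thesis by eventually_elim (simp add: vec_eq_iff)
qed

lemma weak_gradient_works:
  "has_weak_gradient \<Omega> u U \<Longrightarrow> has_weak_gradient \<Omega> u (weak_gradient \<Omega> u)"
  unfolding weak_gradient_def by (rule someI[of "has_weak_gradient \<Omega> u"])

lemma weak_gradient_AE_eq:
  assumes "open \<Omega>" "has_weak_gradient \<Omega> u U"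
  shows "AE x in lebesgue_on \<Omega>. weak_gradient \<Omega> u x = U x"
  by (rule weak_gradient_unique[OF assms(1) weak_gradient_works[OF assms(2)] assms(2)])

lemma has_weak_gradient_diff:
  assumes "open \<Omega>" "has_weak_gradient \<Omega> u U" "has_weak_gradient \<Omega> v V"
  shows "has_weak_gradient \<Omega> (\<lambda>x. u x - v x) (\<lambda>x. U x - V x)"
  unfolding has_weak_gradient_def
proof (intro conjI ballI allI)
  show "locally_integrable \<Omega> (\<lambda>x. u x - v x)" "locally_integrable \<Omega> (\<lambda>x. U x - V x)"
    using assms by (auto simp: has_weak_gradient_def intro: locally_integrable_diff)
  fix \<phi> i assume \<phi>: "\<phi> \<in> test_functions \<Omega>"
  have "integrable (lebesgue_on \<Omega>) (\<lambda>x. u x * partial_deriv i \<phi> x)" "integrable (lebesgue_on \<Omega>) (\<lambda>x. v x * partial_deriv i \<phi> x)"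
    "integrable (lebesgue_on \<Omega>) (\<lambda>x. U x $ i * \<phi> x)" "integrable (lebesgue_on \<Omega>) (\<lambda>x. V x $ i * \<phi> x)"
    using assms locally_integrable_times_test[OF assms(1) _ \<phi>]
    by (auto simp: has_weak_gradient_def locally_integrable_vec_nth)
  then show "(LINT x|lebesgue_on \<Omega>. (u x - v x) * partial_deriv i \<phi> x) =
        - (LINT x|lebesgue_on \<Omega>. (U x - V x) $ i * \<phi> x)"
    using assms \<phi> by (simp add: has_weak_gradient_def left_diff_distrib Bochner_Integration.integral_diff)
qed

lemma locally_integrable_borel_measurable:
  fixes f :: "real^'n \<Rightarrow> 'b::{banach, second_countable_topology}"
  assumes "open \<Omega>" "locally_integrable \<Omega> f"
  shows "f \<in> borel_measurable (lebesgue_on \<Omega>)"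
proof -
  obtain D where D: "countable D" "D \<subseteq> Pow \<Omega>" "\<And>X. X \<in> D \<Longrightarrow> \<exists>a b. X = cbox a b" "\<Union>D = \<Omega>"
    using open_countable_Union_open_cbox[OF assms(1)] by auto
  have S: "\<Omega> \<in> sets lebesgue" using assms(1) by auto
  have "f \<in> borel_measurable (restrict_space (lebesgue_on \<Omega>) X)" if "X \<in> D" for X
  proof -
    obtain a b where X: "X = cbox a b" using D(3) \<open>X \<in> D\<close> by blast
    have sub: "X \<subseteq> \<Omega>" using D(2) \<open>X \<in> D\<close> by auto
    have "integrable lebesgue (\<lambda>x. indicator X x *\<^sub>R f x)"
      using assms(2) sub X by (auto simp: locally_integrable_def set_integrable_def)
    then have "(\<lambda>x. indicator X x *\<^sub>R f x) \<in> borel_measurable lebesgue"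
      by (rule borel_measurable_integrable)
    then have "f \<in> borel_measurable (lebesgue_on X)"
      using X by (subst borel_measurable_restrict_space_iff) auto
    moreover have "restrict_space (lebesgue_on \<Omega>) X = lebesgue_on X"
      using sub S X by (subst restrict_restrict_space) (auto simp: Int_absorb1)
    ultimately show ?thesis by simp
  qed
  note f = this
  have X: "X \<inter> space (lebesgue_on \<Omega>) \<in> sets (lebesgue_on \<Omega>)" if "X \<in> D" for X
  proof -
    obtain a b where "X = cbox a b" using D(3) \<open>X \<in> D\<close> by blast
    then show ?thesis using S by (simp add: sets_restrict_space_iff Int_commute sets.Int)
  qed
  have "space (lebesgue_on \<Omega>) \<subseteq> \<Union>D" using D(4) by simp
  from measurable_piecewise_restrict[OF D(1) X this f] show ?thesis .
qed

section \<open>Functions of power growth\<close>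

text \<open>The properties of \<open>G x\<close>, for a single \<open>x\<close>, on which the function space theory rests. The
  two-sided scaling is the integrated form of the bounds on the logarithmic derivative.\<close>

definition power_growth :: "real \<Rightarrow> real \<Rightarrow> real \<Rightarrow> (real \<Rightarrow> real) \<Rightarrow> bool" where
  "power_growth p q F g \<longleftrightarrow>
     g 0 = 0 \<and> (\<forall>t. g (- t) = g t) \<and> continuous_on UNIV g \<and> (\<forall>t. 0 \<le> g t) \<and>
     (\<forall>s t. 0 \<le> s \<longrightarrow> s \<le> t \<longrightarrow> g s \<le> g t) \<and>
     (\<forall>t\<ge>0. \<forall>l\<ge>1. l powr p * g t \<le> g (l * t) \<and> g (l * t) \<le> l powr q * g t) \<and>
     1 / F \<le> g 1 \<and> g 1 \<le> F"

text \<open>The right derivative of a convex function is the infimum of its slopes to the right,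
  hence a subgradient.\<close>

lemma convex_right_derivative:
  fixes g :: "real \<Rightarrow> real"
  assumes g: "convex_on UNIV g"
  shows "g y \<ge> g t + vector_derivative g (at t within {t..}) * (y - t)"
proof -
  define D where "D = Inf ((\<lambda>s. (g t - g s) / (t - s)) ` ({t<..} \<inter> UNIV))"
  have "((\<lambda>s. (g t - g s) / (t - s)) \<longlongrightarrow> D) (at t within ({t<..} \<inter> UNIV))"
    unfolding D_def
  proof (rule Lim_right_bound)
    fix a b :: real assume ab: "t < a" "a \<le> b"
    show "(g t - g a) / (t - a) \<le> (g t - g b) / (t - b)"
      using convex_on_slope_le(1)[OF g, of t b a] ab by (cases "a = b") auto
  next
    fix a :: real assume a: "t < a"
    show "(g (t - 1) - g t) / (t - 1 - t) \<le> (g t - g a) / (t - a)"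
      using a by (intro order.trans[OF convex_on_slope_le(1)[OF g UNIV_I UNIV_I _ a]
            convex_on_slope_le(2)[OF g UNIV_I UNIV_I _ a]]) auto
  qed
  then have "((\<lambda>s. (g s - g t) / (s - t)) \<longlongrightarrow> D) (at t within {t..})"
    by (simp add: at_within_Ici_at_right minus_divide_divide[symmetric, of "g t - g _"] minus_diff_eq)
  then have "(g has_real_derivative D) (at t within {t..})"
    by (simp add: has_field_derivative_iff)
  then have "vector_derivative g (at t within {t..}) = D"
    by (intro vector_derivative_within) (auto simp: has_real_derivative_iff_has_vector_derivative at_within_Ici_at_right)
  then show ?thesis
    using convex_le_Inf_differential[OF g, of t y] by (simp add: D_def)
qed

text \<open>The subgradient inequality gives \<open>g (r * t) \<ge> (1 + p * (r - 1)) * g t\<close>, which has the right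
  factor \<open>r powr p\<close> only to first order at \<open>r = 1\<close>. Taking \<open>m\<close> steps of ratio \<open>l powr (1 / m)\<close> and
  letting \<open>m\<close> tend to infinity recovers the sharp power.\<close>

lemma power_growth_lower:
  fixes g :: "real \<Rightarrow> real"
  assumes "1 < p" "0 < t" "1 \<le> l" and pos: "\<And>t. 0 < t \<Longrightarrow> 0 < g t"
    and step: "\<And>t r. 0 < t \<Longrightarrow> 1 \<le> r \<Longrightarrow> g t * (1 + p * (r - 1)) \<le> g (r * t)"
  shows "l powr p * g t \<le> g (l * t)"
proof (cases "l = 1")
  case False
  then have l: "1 < l" using assms by simp
  have "(\<lambda>m. (1 + p * (l powr (1 / real m) - 1)) powr real m) \<longlonglongrightarrow> exp (p * ln l)"
    using l \<open>1 < p\<close> by real_asymp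
  then have "(\<lambda>m. g t * (1 + p * (l powr (1 / real m) - 1)) powr real m) \<longlonglongrightarrow> g t * l powr p"
    using l by (intro tendsto_mult_left) (simp add: powr_def[of l p])
  moreover have "g t * (1 + p * (l powr (1 / real m) - 1)) powr real m \<le> g (l * t)" if m: "m \<ge> 1" for m
  proof -
    let ?r = "l powr (1 / real m)"
    have r: "1 \<le> ?r" using l by (simp add: ge_one_powr_ge_zero)
    have "g t * (1 + p * (?r - 1)) ^ j \<le> g (?r ^ j * t)" for j
    proof (induction j)
      case (Suc j)
      have "g t * (1 + p * (?r - 1)) ^ Suc j = g t * (1 + p * (?r - 1)) ^ j * (1 + p * (?r - 1))" by simp
      also have "\<dots> \<le> g (?r ^ j * t) * (1 + p * (?r - 1))"
        using Suc r \<open>1 < p\<close> by (intro mult_right_mono) auto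
      also have "\<dots> \<le> g (?r * (?r ^ j * t))"
        using r l \<open>0 < t\<close> by (intro step) auto
      finally show ?case by (simp add: mult_ac)
    qed simp
    from this[of m] have "g t * (1 + p * (?r - 1)) ^ m \<le> g (?r ^ m * t)" .
    moreover have "?r ^ m = l" using l m by (simp add: powr_realpow[symmetric] powr_powr)
    moreover have "0 < 1 + p * (?r - 1)" using r \<open>1 < p\<close> by (simp add: add_pos_nonneg)
    ultimately show ?thesis by (simp add: powr_realpow)
  qed
  ultimately have "g t * l powr p \<le> g (l * t)"
    by (intro LIMSEQ_le_const2) (auto intro!: exI[of _ 1])
  then show ?thesis by (simp add: mult.commute)
qed (use assms in simp)

lemma power_growth_upper:
  fixes g :: "real \<Rightarrow> real"
  assumes "1 < q" "0 < t" "1 \<le> l" and pos: "\<And>t. 0 < t \<Longrightarrow> 0 < g t"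
    and step: "\<And>t r. 0 < t \<Longrightarrow> 1 \<le> r \<Longrightarrow> g (r * t) * (1 - q * (1 - 1 / r)) \<le> g t"
  shows "g (l * t) \<le> l powr q * g t"
proof (cases "l = 1")
  case False
  then have l: "1 < l" using assms by simp
  have "(\<lambda>m. (1 - q * (1 - 1 / l powr (1 / real m))) powr real m) \<longlonglongrightarrow> exp (- (q * ln l))"
    using l \<open>1 < q\<close> by real_asymp
  then have "(\<lambda>m. g (l * t) * (1 - q * (1 - 1 / l powr (1 / real m))) powr real m) \<longlonglongrightarrow> g (l * t) * l powr (- q)"
    using l by (intro tendsto_mult_left) (simp add: powr_def[of l "- q"])
  moreover have "eventually (\<lambda>m. 0 < 1 - q * (1 - 1 / l powr (1 / real m))) sequentially"
    using l \<open>1 < q\<close> by real_asymp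
  then have "eventually (\<lambda>m. g (l * t) * (1 - q * (1 - 1 / l powr (1 / real m))) powr real m \<le> g t) sequentially"
    using eventually_ge_at_top[of 1]
  proof eventually_elim
    case (elim m)
    let ?r = "l powr (1 / real m)"
    have r: "1 \<le> ?r" using l by (simp add: ge_one_powr_ge_zero)
    have "g (?r ^ j * t) * (1 - q * (1 - 1 / ?r)) ^ j \<le> g t" for j
    proof (induction j)
      case (Suc j)
      have "g (?r ^ Suc j * t) * (1 - q * (1 - 1 / ?r)) ^ Suc j
          = (g (?r * (?r ^ j * t)) * (1 - q * (1 - 1 / ?r))) * (1 - q * (1 - 1 / ?r)) ^ j"
        by (simp add: mult_ac)
      also have "\<dots> \<le> g (?r ^ j * t) * (1 - q * (1 - 1 / ?r)) ^ j"
        using elim(1) r l \<open>0 < t\<close> by (intro mult_right_mono step) auto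
      finally show ?case using Suc by linarith
    qed simp
    from this[of m] have "g (?r ^ m * t) * (1 - q * (1 - 1 / ?r)) ^ m \<le> g t" .
    moreover have "?r ^ m = l" using l elim(2) by (simp add: powr_realpow[symmetric] powr_powr)
    ultimately show ?case using elim(1) by (simp add: powr_realpow)
  qed
  ultimately have "g (l * t) * l powr (- q) \<le> g t"
    by (intro tendsto_upperbound[of _ _ sequentially]) auto
  then show ?thesis using l by (simp add: powr_minus divide_simps mult.commute)
qed (use assms in simp)

lemma power_growth_if_derivative_bounds:
  fixes g :: "real \<Rightarrow> real"
  assumes ev: "\<And>t. g (- t) = g t" and "continuous_on UNIV g" and conv: "convex_on UNIV g"
    and sm: "strict_mono_on {0..} g" and "g 0 = 0" and pos: "\<And>t. 0 < t \<Longrightarrow> 0 < g t"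
    and "1 / F \<le> g 1" "g 1 \<le> F" "1 < p" "p \<le> q"
    and D: "\<And>t. 0 < t \<Longrightarrow> p \<le> vector_derivative g (at t within {t..}) * t / g t"
      "\<And>t. 0 < t \<Longrightarrow> vector_derivative g (at t within {t..}) * t / g t \<le> q"
  shows "power_growth p q F g"
proof -
  have nonneg: "0 \<le> g t" for t
    using pos[of t] pos[of "- t"] ev[of t] \<open>g 0 = 0\<close> by (cases t "0::real" rule: linorder_cases) auto
  have mono: "g s \<le> g t" if "0 \<le> s" "s \<le> t" for s t
    using strict_mono_on_imp_mono_on[OF sm] that by (auto simp: mono_on_def)
  have lower: "g t * (1 + p * (r - 1)) \<le> g (r * t)" if t: "0 < t" "1 \<le> r" for t r
  proof -
    let ?D = "vector_derivative g (at t within {t..})"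
    have "p * g t \<le> ?D * t" using D(1)[OF t(1)] pos[OF t(1)] by (simp add: field_simps)
    then have "p * g t * (r - 1) \<le> ?D * t * (r - 1)" using t by (intro mult_right_mono) auto
    with convex_right_derivative[OF conv, of t "r * t"] show ?thesis by (simp add: algebra_simps)
  qed
  have upper: "g (r * t) * (1 - q * (1 - 1 / r)) \<le> g t" if t: "0 < t" "1 \<le> r" for t r
  proof -
    let ?D = "vector_derivative g (at (r * t) within {r * t..})"
    have rt: "0 < r * t" using t by simp
    have "?D * (r * t) \<le> q * g (r * t)" using D(2)[OF rt] pos[OF rt] by (simp add: field_simps)
    then have "?D * (r * t) * (1 - 1 / r) \<le> q * g (r * t) * (1 - 1 / r)"
      using t by (intro mult_right_mono) auto
    moreover have "?D * (r * t) * (1 - 1 / r) = - (?D * (t - r * t))" using t by (simp add: field_simps)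
    ultimately show ?thesis
      using convex_right_derivative[OF conv, of "r * t" t] by (simp add: algebra_simps)
  qed
  have "l powr p * g t \<le> g (l * t) \<and> g (l * t) \<le> l powr q * g t" if "0 \<le> t" "1 \<le> l" for t l
    using power_growth_lower[of p t l g] power_growth_upper[of q t l g] pos lower upper that assms
    by (cases "t = 0") auto
  then show ?thesis unfolding power_growth_def using assms nonneg mono by auto
qed

context
  fixes p q F :: real and g :: "real \<Rightarrow> real"
  assumes pg: "power_growth p q F g" and p: "1 < p" "p \<le> q" and F: "1 \<le> F"
begin

lemma pg_zero: "g 0 = 0" and pg_nonneg: "0 \<le> g t" and pg_abs: "g \<bar>t\<bar> = g t"
  and pg_cont: "continuous_on UNIV g"
  and pg_mono: "\<bar>s\<bar> \<le> \<bar>t\<bar> \<Longrightarrow> g s \<le> g t"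
proof -
  show abs: "g \<bar>t\<bar> = g t" for t using pg by (auto simp: power_growth_def abs_if)
  show "g 0 = 0" "0 \<le> g t" "continuous_on UNIV g" using pg by (auto simp: power_growth_def)
  assume "\<bar>s\<bar> \<le> \<bar>t\<bar>"
  then have "g \<bar>s\<bar> \<le> g \<bar>t\<bar>" using pg by (auto simp: power_growth_def)
  then show "g s \<le> g t" by (simp add: abs)
qed

lemma pg_scale:
  assumes "1 \<le> l"
  shows "l powr p * g t \<le> g (l * t)" "g (l * t) \<le> l powr q * g t"
proof -
  have "l powr p * g \<bar>t\<bar> \<le> g (l * \<bar>t\<bar>)" "g (l * \<bar>t\<bar>) \<le> l powr q * g \<bar>t\<bar>"
    using pg assms by (auto simp: power_growth_def)
  moreover have "g (l * \<bar>t\<bar>) = g (l * t)" using pg_abs[of "l * t"] assms by (simp add: abs_mult)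
  ultimately show "l powr p * g t \<le> g (l * t)" "g (l * t) \<le> l powr q * g t" by (simp_all add: pg_abs)
qed

lemma pg_shrink:
  assumes "0 \<le> l" "l \<le> 1"
  shows "g (l * t) \<le> l * g t"
proof (cases "l = 0")
  case False
  then have l: "0 < l" "1 \<le> 1 / l" using assms by auto
  have "(1 / l) powr 1 * g (l * t) \<le> (1 / l) powr p * g (l * t)"
    using l p by (intro mult_right_mono powr_mono pg_nonneg) auto
  also have "\<dots> \<le> g (1 / l * (l * t))" by (rule pg_scale[OF l(2)])
  finally show ?thesis using l by (simp add: field_simps)
qed (simp add: pg_zero)

lemma pg_add: "g (a + b) \<le> 2 powr q * (g a + g b)"
proof -
  have "g (a + b) \<le> g (2 * max \<bar>a\<bar> \<bar>b\<bar>)" by (rule pg_mono) linarith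
  also have "\<dots> \<le> 2 powr q * g (max \<bar>a\<bar> \<bar>b\<bar>)" by (rule pg_scale) simp
  also have "\<dots> \<le> 2 powr q * (g a + g b)"
    using pg_nonneg[of a] pg_nonneg[of b] by (intro mult_left_mono) (auto simp: max_def pg_abs)
  finally show ?thesis .
qed

lemma pg_ge_powr: "\<bar>t\<bar> powr p \<le> 1 + F * g t"
proof (cases "\<bar>t\<bar> \<le> 1")
  case True
  then have "\<bar>t\<bar> powr p \<le> 1" using p by (simp add: powr_le1)
  moreover have "0 \<le> F * g t" using F pg_nonneg by simp
  ultimately show ?thesis by linarith
next
  case False
  have "1 \<le> F * g 1" using pg F by (simp add: power_growth_def field_simps)
  then have "\<bar>t\<bar> powr p * 1 \<le> \<bar>t\<bar> powr p * (F * g 1)" by (intro mult_left_mono) auto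
  also have "\<dots> = F * (\<bar>t\<bar> powr p * g 1)" by simp
  also have "\<dots> \<le> F * g (\<bar>t\<bar> * 1)"
    using F False by (intro mult_left_mono pg_scale) auto
  finally show ?thesis by (simp add: pg_abs)
qed

lemma pg_ge_abs: "\<bar>t\<bar> \<le> 1 + F * g t"
proof (cases "\<bar>t\<bar> \<le> 1")
  case True
  then show ?thesis using F pg_nonneg[of t] by (simp add: add_increasing2)
next
  case False
  then have "\<bar>t\<bar> powr 1 \<le> \<bar>t\<bar> powr p" using p by (intro powr_mono) auto
  then show ?thesis using pg_ge_powr[of t] False by simp
qed

text \<open>Integrated with \<open>t = v x\<close> and \<open>l\<close> small, this bounds the mean of \<open>\<bar>v\<bar>\<close> by a small constant plus a
  multiple of the modular; hence modular convergence implies convergence in the mean.\<close>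

lemma pg_small_abs:
  assumes "0 < l" "l \<le> 1"
  shows "\<bar>t\<bar> \<le> l + F * l powr (1 - q) * g t"
proof -
  have l: "1 \<le> 1 / l" using assms by simp
  have "\<bar>t\<bar> = l * \<bar>1 / l * t\<bar>" using assms by (simp add: abs_mult)
  also have "\<dots> \<le> l * (1 + F * g (1 / l * t))"
    using assms by (intro mult_left_mono pg_ge_abs) auto
  also have "\<dots> \<le> l * (1 + F * ((1 / l) powr q * g t))"
    using assms F by (intro mult_left_mono add_left_mono pg_scale l) auto
  also have "\<dots> = l + F * l powr (1 - q) * g t"
    using assms by (simp add: powr_divide powr_diff algebra_simps)
  finally show ?thesis .
qed

lemma pg_le: 
  assumes "\<bar>t\<bar> \<le> C" "1 \<le> C"
  shows "g t \<le> F * C powr q"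
proof -
  have "g t \<le> g (C * 1)" using assms by (intro pg_mono) auto
  also have "\<dots> \<le> C powr q * g 1" by (rule pg_scale[OF assms(2)])
  also have "\<dots> \<le> C powr q * F" using pg by (intro mult_left_mono) (auto simp: power_growth_def)
  finally show ?thesis by (simp add: mult.commute)
qed

end

section \<open>Musielak--Orlicz spaces\<close>

text \<open>The limit may be arbitrary on a null set because Lebesgue measure is complete.\<close>

lemma AE_limit_measurable_lebesgue_on:
  fixes f :: "nat \<Rightarrow> real^'n \<Rightarrow> real"
  assumes S: "S \<in> sets lebesgue" and f: "\<And>k. f k \<in> borel_measurable (lebesgue_on S)"
    and lim: "AE x in lebesgue_on S. (\<lambda>k. f k x) \<longlonglongrightarrow> g x"
  shows "g \<in> borel_measurable (lebesgue_on S)"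
proof -
  have "AE x in lebesgue. x \<in> S \<longrightarrow> (\<lambda>k. f k x) \<longlonglongrightarrow> g x"
    using lim S by (subst (asm) AE_restrict_space_iff) auto
  then obtain N where N: "N \<in> null_sets lebesgue" "\<And>x. x \<notin> N \<Longrightarrow> x \<in> S \<Longrightarrow> (\<lambda>k. f k x) \<longlonglongrightarrow> g x"
    by (auto elim!: AE_E3)
  have N': "- N \<in> sets lebesgue"
    using sets.compl_sets[OF null_setsD2[OF N(1)]] by (simp add: Compl_eq_Diff_UNIV)
  have "(\<lambda>x. indicator (- N) x * (indicator S x *\<^sub>R f k x)) \<in> borel_measurable lebesgue" for k
    using f[of k] S N' by (intro borel_measurable_times borel_measurable_indicator)
      (auto simp: borel_measurable_restrict_space_iff)
  then have "(\<lambda>x. indicator (- N) x * (indicator S x *\<^sub>R g x)) \<in> borel_measurable lebesgue"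
  proof (rule borel_measurable_LIMSEQ_real[rotated])
    fix x show "(\<lambda>k. indicator (- N) x * (indicator S x *\<^sub>R f k x)) \<longlonglongrightarrow> indicator (- N) x * (indicator S x *\<^sub>R g x)"
      using N(2)[of x] by (auto simp: indicator_def)
  qed
  moreover have "AE x in lebesgue. indicator (- N) x * (indicator S x *\<^sub>R g x) = indicator S x *\<^sub>R g x"
    using AE_not_in[OF N(1)] by eventually_elim simp
  ultimately have "(\<lambda>x. indicator S x *\<^sub>R g x) \<in> borel_measurable lebesgue"
    by (rule borel_measurable_AE)
  then show ?thesis using S by (subst borel_measurable_restrict_space_iff) auto
qed

locale musielak =
  fixes \<Omega> :: "(real^'n) set" and G :: "real^'n \<Rightarrow> real \<Rightarrow> real" and p q F :: real
  assumes open_\<Omega>: "open \<Omega>" and bounded_\<Omega>: "bounded \<Omega>"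
    and p: "1 < p" "p \<le> q" and F: "1 \<le> F"
    and G_meas: "\<And>t. (\<lambda>x. G x t) \<in> borel_measurable (lebesgue_on \<Omega>)"
    and G_growth: "AE x in lebesgue_on \<Omega>. power_growth p q F (G x)"
begin

abbreviation M where "M \<equiv> lebesgue_on \<Omega>"

lemma sets_\<Omega>: "\<Omega> \<in> sets lebesgue" using open_\<Omega> by auto

lemma finite_measure_M: "finite_measure M"
proof
  show "emeasure M (space M) \<noteq> \<infinity>"
    using fmeasurableD2[OF bounded_set_imp_lmeasurable[OF bounded_\<Omega> sets_\<Omega>]] sets_\<Omega>
    by (simp add: emeasure_restrict_space)
qed

sublocale finite_measure M by (rule finite_measure_M)

definition modular :: "(real^'n \<Rightarrow> real) \<Rightarrow> ennreal" where
  "modular v = (\<integral>\<^sup>+x. ennreal (G x (v x)) \<partial>M)"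

text \<open>Rounding \<open>v\<close> to multiples of \<open>2 powr - k\<close> reduces the claim to measurability of \<open>G\<close> in \<open>x\<close>
  for countably many \<open>t\<close>; continuity in \<open>t\<close> then gives the limit.\<close>

lemma G_comp_measurable [measurable]:
  assumes [measurable]: "v \<in> borel_measurable M"
  shows "(\<lambda>x. G x (v x)) \<in> borel_measurable M"
proof (rule AE_limit_measurable_lebesgue_on[OF sets_\<Omega>])
  let ?s = "\<lambda>k x. of_int \<lfloor>2 ^ k * v x\<rfloor> / 2 ^ k :: real"
  show "(\<lambda>x. G x (?s k x)) \<in> borel_measurable M" for k :: nat
    by (rule measurable_compose_countable[where f="\<lambda>i x. G x (of_int i / 2 ^ k)" and g="\<lambda>x. \<lfloor>2 ^ k * v x\<rfloor>"])
      (use G_meas in measurable)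
  have s_lim: "(\<lambda>k. ?s k x) \<longlonglongrightarrow> v x" for x
  proof (rule LIMSEQ_I)
    fix e :: real assume "0 < e"
    obtain K where K: "(1/2) ^ K < e" using real_arch_pow_inv[OF \<open>0 < e\<close>, of "1/2"] by auto
    have "norm (?s k x - v x) < e" if "k \<ge> K" for k
    proof -
      have "\<bar>of_int \<lfloor>2 ^ k * v x\<rfloor> - 2 ^ k * v x\<bar> \<le> 1" by linarith
      then have "\<bar>of_int \<lfloor>2 ^ k * v x\<rfloor> - 2 ^ k * v x\<bar> / 2 ^ k \<le> 1 / 2 ^ k" by (intro divide_right_mono) auto
      moreover have "?s k x - v x = (of_int \<lfloor>2 ^ k * v x\<rfloor> - 2 ^ k * v x) / 2 ^ k" by (simp add: field_simps)
      moreover have "(1/2 :: real) ^ k \<le> (1/2) ^ K" using that by (intro power_decreasing) auto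
      ultimately show ?thesis using K by (simp add: power_divide)
    qed
    then show "\<exists>K. \<forall>k\<ge>K. norm (?s k x - v x) < e" by blast
  qed
  show "AE x in M. (\<lambda>k. G x (?s k x)) \<longlonglongrightarrow> G x (v x)"
    using G_growth
  proof eventually_elim
    case (elim x)
    from pg_cont[OF elim p F] show ?case
      using s_lim[of x] by (auto intro: continuous_on_tendsto_compose[of UNIV "G x"])
  qed
qed

lemma ennreal_G_comp_measurable [measurable]:
  "v \<in> borel_measurable M \<Longrightarrow> (\<lambda>x. ennreal (G x (v x))) \<in> borel_measurable M"
  by (rule measurable_compose[OF G_comp_measurable measurable_ennreal])

lemma modular_cong: "AE x in M. G x (u x) = G x (v x) \<Longrightarrow> modular u = modular v"
  unfolding modular_def by (intro nn_integral_cong_AE) auto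

lemma modular_cong_eq: "AE x in M. u x = v x \<Longrightarrow> modular u = modular v"
  by (intro modular_cong) auto

lemma modular_mono: "AE x in M. \<bar>u x\<bar> \<le> \<bar>v x\<bar> \<Longrightarrow> modular u \<le> modular v"
  unfolding modular_def using G_growth
  by (intro nn_integral_mono_AE) (auto elim!: eventually_elim2 intro!: ennreal_leI pg_mono[OF _ p F])

lemma modular_scale:
  assumes [measurable]: "v \<in> borel_measurable M" and l: "1 \<le> l"
  shows "modular (\<lambda>x. l * v x) \<le> ennreal (l powr q) * modular v"
proof -
  have "modular (\<lambda>x. l * v x) \<le> (\<integral>\<^sup>+x. ennreal (l powr q) * ennreal (G x (v x)) \<partial>M)"
    unfolding modular_def using G_growth
    by (intro nn_integral_mono_AE) (auto elim!: eventually_mono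
        intro!: ennreal_leI pg_scale(2)[OF _ p F l] simp: ennreal_mult'[symmetric])
  also have "\<dots> = ennreal (l powr q) * modular v"
    unfolding modular_def by (rule nn_integral_cmult[OF ennreal_G_comp_measurable[OF assms(1)]])
  finally show ?thesis .
qed

lemma modular_shrink:
  assumes [measurable]: "v \<in> borel_measurable M" and l: "0 \<le> l" "l \<le> 1"
  shows "modular (\<lambda>x. l * v x) \<le> ennreal l * modular v"
proof -
  have "modular (\<lambda>x. l * v x) \<le> (\<integral>\<^sup>+x. ennreal l * ennreal (G x (v x)) \<partial>M)"
    unfolding modular_def using G_growth
    by (intro nn_integral_mono_AE) (auto elim!: eventually_mono
        intro!: ennreal_leI pg_shrink[OF _ p F l] simp: l ennreal_mult'[symmetric])
  also have "\<dots> = ennreal l * modular v"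
    unfolding modular_def by (rule nn_integral_cmult[OF ennreal_G_comp_measurable[OF assms(1)]])
  finally show ?thesis .
qed

lemma modular_add:
  assumes [measurable]: "u \<in> borel_measurable M" "v \<in> borel_measurable M"
  shows "modular (\<lambda>x. u x + v x) \<le> ennreal (2 powr q) * (modular u + modular v)"
proof -
  have "AE x in M. ennreal (G x (u x + v x)) \<le> ennreal (2 powr q) * (ennreal (G x (u x)) + ennreal (G x (v x)))"
    using G_growth
  proof eventually_elim
    case (elim x)
    have "ennreal (G x (u x + v x)) \<le> ennreal (2 powr q * (G x (u x) + G x (v x)))"
      by (intro ennreal_leI pg_add[OF elim p F])
    then show ?case
      using pg_nonneg[OF elim p F] by (simp add: ennreal_mult' ennreal_plus)
  qed
  then have "modular (\<lambda>x. u x + v x) \<le> (\<integral>\<^sup>+x. ennreal (2 powr q) * (ennreal (G x (u x)) + ennreal (G x (v x))) \<partial>M)"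
    unfolding modular_def by (rule nn_integral_mono_AE)
  also have "\<dots> = ennreal (2 powr q) * (modular u + modular v)"
    unfolding modular_def
    using ennreal_G_comp_measurable[OF assms(1)] ennreal_G_comp_measurable[OF assms(2)]
    by (subst nn_integral_cmult) (auto simp: nn_integral_add)
  finally show ?thesis .
qed

lemma modular_bounded_finite:
  assumes "\<And>x. \<bar>v x\<bar> \<le> C"
  shows "modular v < \<infinity>"
proof -
  have C: "\<bar>v x\<bar> \<le> max 1 C" "1 \<le> max 1 C" for x using assms[of x] by auto
  have "AE x in M. ennreal (G x (v x)) \<le> ennreal (F * (max 1 C) powr q)"
    using G_growth by eventually_elim (rule ennreal_leI, rule pg_le[OF _ p F C])
  then have "modular v \<le> (\<integral>\<^sup>+x. ennreal (F * (max 1 C) powr q) \<partial>M)"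
    unfolding modular_def by (rule nn_integral_mono_AE)
  also have "\<dots> < \<infinity>"
    using emeasure_finite[of \<Omega>] by (simp add: ennreal_mult_eq_top_iff less_top[symmetric])
  finally show ?thesis .
qed

text \<open>The scaling \<open>G x (l * t) \<le> l powr q * G x t\<close> makes finiteness of the modular independent of
  the factor inside it.\<close>

lemma L_space_iff: "v \<in> L_space \<Omega> G \<longleftrightarrow> v \<in> borel_measurable M \<and> modular v < \<infinity>"
proof
  assume "v \<in> L_space \<Omega> G"
  then obtain l where v [measurable]: "v \<in> borel_measurable M" and l: "l > 0" "modular (\<lambda>x. l * v x) < \<infinity>"
    by (auto simp: L_space_def modular_def)
  have "modular v \<le> modular (\<lambda>x. max 1 (1 / l) * (l * v x))"
  proof (intro modular_mono AE_I2)
    fix x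
    have "1 * \<bar>v x\<bar> \<le> (max 1 (1 / l) * l) * \<bar>v x\<bar>"
      using l by (intro mult_right_mono) (auto simp: max_def field_simps)
    then show "\<bar>v x\<bar> \<le> \<bar>max 1 (1 / l) * (l * v x)\<bar>" using l by (simp add: abs_mult mult_ac)
  qed
  also have "\<dots> \<le> ennreal (max 1 (1 / l) powr q) * modular (\<lambda>x. l * v x)"
    by (rule modular_scale) auto
  also have "\<dots> < \<infinity>" using l by (simp add: ennreal_mult_less_top)
  finally show "v \<in> borel_measurable M \<and> modular v < \<infinity>" using v by simp
next
  assume "v \<in> borel_measurable M \<and> modular v < \<infinity>"
  then show "v \<in> L_space \<Omega> G"
    by (auto simp: L_space_def modular_def intro!: exI[of _ 1])
qed

lemma L_norm_set_nonempty:
  assumes "v \<in> L_space \<Omega> G"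
  shows "\<exists>l>0. modular (\<lambda>x. v x / l) \<le> 1"
proof -
  from assms have v [measurable]: "v \<in> borel_measurable M" and fin: "modular v < \<infinity>"
    by (auto simp: L_space_iff)
  obtain c where c: "modular v = ennreal c" "0 \<le> c" using fin by (cases "modular v") auto
  let ?l = "1 / (1 + c)"
  have "modular (\<lambda>x. ?l * v x) \<le> ennreal ?l * modular v"
    using c by (intro modular_shrink) auto
  also have "\<dots> \<le> 1" using c by (simp add: ennreal_mult'[symmetric] ennreal_le_1)
  finally show ?thesis using c by (intro exI[of _ "1 + c"]) (auto simp: add_pos_nonneg mult.commute divide_inverse)
qed

lemma L_norm_nonneg:
  assumes "v \<in> L_space \<Omega> G"
  shows "0 \<le> L_norm \<Omega> G v"
  unfolding L_norm_def using L_norm_set_nonempty[OF assms]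
  by (intro cInf_greatest) (auto simp: modular_def)

lemma modular_le_if_L_norm_less:
  assumes v: "v \<in> L_space \<Omega> G" and less: "L_norm \<Omega> G v < e" "e \<le> 1"
  shows "modular v \<le> ennreal e"
proof -
  from v have [measurable]: "v \<in> borel_measurable M" by (simp add: L_space_iff)
  obtain l where l: "0 < l" "modular (\<lambda>x. v x / l) \<le> 1" "l < e"
    using cInf_lessD[OF _ less(1)[unfolded L_norm_def]] L_norm_set_nonempty[OF v] by (auto simp: modular_def)
  have "modular v = modular (\<lambda>x. l * (v x / l))" using l by simp
  also have "\<dots> \<le> ennreal l * modular (\<lambda>x. v x / l)" using l less by (intro modular_shrink) auto
  also have "\<dots> \<le> ennreal l * 1" by (intro mult_left_mono l) auto
  also have "\<dots> \<le> ennreal e" using l by (simp add: ennreal_leI)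
  finally show ?thesis .
qed

lemma L_norm_le_if_modular_le:
  assumes v: "v \<in> borel_measurable M" and le: "modular v \<le> ennreal (e powr q)" and e: "0 < e" "e \<le> 1"
  shows "L_norm \<Omega> G v \<le> e"
  unfolding L_norm_def
proof (rule cInf_lower)
  have "modular (\<lambda>x. 1 / e * v x) \<le> ennreal ((1 / e) powr q) * modular v"
    using e by (intro modular_scale v) auto
  also have "\<dots> \<le> ennreal ((1 / e) powr q) * ennreal (e powr q)" by (intro mult_left_mono le) auto
  also have "\<dots> = 1" using e by (simp add: ennreal_mult'[symmetric] powr_mult[symmetric])
  finally show "e \<in> {l. l > 0 \<and> (\<integral>\<^sup>+x. ennreal (G x (v x / l)) \<partial>lebesgue_on \<Omega>) \<le> 1}"
    using e by (simp add: modular_def)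
  show "bdd_below {l. l > 0 \<and> (\<integral>\<^sup>+x. ennreal (G x (v x / l)) \<partial>lebesgue_on \<Omega>) \<le> 1}"
    by (rule bdd_belowI[of _ 0]) auto
qed

text \<open>Norm and modular control powers of each other near \<open>0\<close>, so the rest of the argument can use the
  modular, an honest integral, in place of the Luxemburg norm.\<close>

lemma L_norm_tendsto_0_iff:
  assumes v: "\<And>k. v k \<in> L_space \<Omega> G"
  shows "(\<lambda>k. L_norm \<Omega> G (v k)) \<longlonglongrightarrow> 0 \<longleftrightarrow> (\<lambda>k. modular (v k)) \<longlonglongrightarrow> 0"
proof
  assume lim: "(\<lambda>k. L_norm \<Omega> G (v k)) \<longlonglongrightarrow> 0"
  have "eventually (\<lambda>k. modular (v k) < a) sequentially" if "0 < a" for a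
  proof -
    obtain e where e: "0 < e" "e \<le> 1" "ennreal e < a"
    proof -
      obtain b where b: "0 < b" "b < a" using dense[OF \<open>0 < a\<close>] by auto
      then have "b < \<infinity>" by (metis infinity_ennreal_def less_top order_less_imp_not_eq2 top_greatest less_le_trans)
      with b obtain r where "b = ennreal r" "0 < r" by (cases b) auto
      with b show ?thesis by (intro that[of "min 1 r"]) (auto intro: le_less_trans[of _ "ennreal r"] ennreal_leI)
    qed
    from order_tendstoD(2)[OF lim e(1)] show ?thesis
      by eventually_elim (use modular_le_if_L_norm_less[OF v _ e(2)] e(3) in \<open>blast intro: le_less_trans\<close>)
  qed
  then show "(\<lambda>k. modular (v k)) \<longlonglongrightarrow> 0" by (intro order_tendstoI) auto
next
  assume lim: "(\<lambda>k. modular (v k)) \<longlonglongrightarrow> 0"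
  have "eventually (\<lambda>k. L_norm \<Omega> G (v k) < e) sequentially" if "0 < e" for e
  proof -
    let ?d = "min 1 (e / 2)"
    have d: "0 < ?d" "?d \<le> 1" "?d < e" using that by auto
    have "0 < ennreal (?d powr q)" using d by simp
    from order_tendstoD(2)[OF lim this] show ?thesis
    proof eventually_elim
      case (elim k)
      then have "L_norm \<Omega> G (v k) \<le> ?d"
        using v[of k] d by (intro L_norm_le_if_modular_le) (auto simp: L_space_iff)
      then show ?case using d by linarith
    qed
  qed
  moreover have "0 \<le> L_norm \<Omega> G (v k)" for k by (rule L_norm_nonneg[OF v])
  ultimately show "(\<lambda>k. L_norm \<Omega> G (v k)) \<longlonglongrightarrow> 0"
    by (intro order_tendstoI) (auto intro: less_le_trans always_eventually)
qed

lemma L_norm_cong: "AE x in M. u x = v x \<Longrightarrow> L_norm \<Omega> G u = L_norm \<Omega> G v"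
proof -
  assume eq: "AE x in M. u x = v x"
  have "(\<integral>\<^sup>+x. ennreal (G x (u x / l)) \<partial>M) = (\<integral>\<^sup>+x. ennreal (G x (v x / l)) \<partial>M)" for l
    using eq by (intro nn_integral_cong_AE) auto
  then show ?thesis by (simp add: L_norm_def)
qed

lemma integrable_if_modular_finite:
  assumes [measurable]: "v \<in> borel_measurable M" and fin: "modular v < \<infinity>"
  shows "integrable M (\<lambda>x. G x (v x))" "integrable M v" "integrable M (\<lambda>x. \<bar>v x\<bar> powr p)"
proof -
  show G: "integrable M (\<lambda>x. G x (v x))"
  proof (rule integrableI_nonneg)
    show "AE x in M. 0 \<le> G x (v x)" using G_growth by eventually_elim (rule pg_nonneg[OF _ p F])
  qed (use fin in \<open>auto simp: modular_def\<close>)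
  then have B: "integrable M (\<lambda>x. 1 + F * G x (v x))" by simp
  show "integrable M v"
  proof (rule Bochner_Integration.integrable_bound[OF B])
    show "AE x in M. norm (v x) \<le> norm (1 + F * G x (v x))"
      using G_growth
    proof eventually_elim
      case (elim x)
      from pg_ge_abs[OF elim p F, of "v x"] show ?case by auto
    qed
  qed measurable
  show "integrable M (\<lambda>x. \<bar>v x\<bar> powr p)"
  proof (rule Bochner_Integration.integrable_bound[OF B])
    show "AE x in M. norm (\<bar>v x\<bar> powr p) \<le> norm (1 + F * G x (v x))"
      using G_growth
    proof eventually_elim
      case (elim x)
      from pg_ge_powr[OF elim p F, of "v x"] show ?case by auto
    qed
  qed measurable
qed

lemma L1_tendsto_0_if_modular_tendsto_0:
  assumes v [measurable]: "\<And>k. v k \<in> borel_measurable M" and fin: "\<And>k. modular (v k) < \<infinity>"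
    and lim: "(\<lambda>k. modular (v k)) \<longlonglongrightarrow> 0"
  shows "(\<lambda>k. LINT x|M. norm (v k x)) \<longlonglongrightarrow> 0"
proof -
  have ev: "eventually (\<lambda>k. (LINT x|M. norm (v k x)) < e) sequentially" if e: "0 < e" for e
  proof -
    define l where "l = min 1 (e / (2 * (measure M (space M) + 1)))"
    have l: "0 < l" "l \<le> 1" using e by (auto simp: l_def add_nonneg_pos)
    have "l * measure M (space M) \<le> e / (2 * (measure M (space M) + 1)) * measure M (space M)"
      by (intro mult_right_mono) (auto simp: l_def)
    also have "\<dots> = e / 2 * (measure M (space M) / (measure M (space M) + 1))" by simp
    also have "\<dots> \<le> e / 2 * 1"
    proof (rule mult_left_mono)
      have "0 < measure M (space M) + 1" by (rule add_nonneg_pos) auto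
      then show "measure M (space M) / (measure M (space M) + 1) \<le> 1" by (simp add: divide_le_eq_1)
    qed (use e in simp)
    also have "\<dots> = e / 2" by simp
    finally have le: "l * measure M (space M) \<le> e / 2" .
    let ?c = "F * l powr (1 - q)"
    have c: "0 < ?c" using F l by simp
    have "0 < ennreal (e / (2 * ?c))" using e c by simp
    from order_tendstoD(2)[OF lim this] show ?thesis
    proof eventually_elim
      case (elim k)
      have int: "integrable M (\<lambda>x. G x (v k x))" "integrable M (v k)"
        using integrable_if_modular_finite[OF v fin] by auto
      have "AE x in M. 0 \<le> G x (v k x)" using G_growth by eventually_elim (rule pg_nonneg[OF _ p F])
      then have "modular (v k) = ennreal (LINT x|M. G x (v k x))"
        unfolding modular_def by (rule nn_integral_eq_integral[OF int(1)])
      with elim have "(LINT x|M. G x (v k x)) < e / (2 * ?c)"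
        using e c by (simp add: ennreal_less_iff ennreal_lessI) (meson ennreal_leI leD le_less_linear)
      then have less: "?c * (LINT x|M. G x (v k x)) < e / 2" using c by (simp add: field_simps)
      have "(LINT x|M. norm (v k x)) \<le> (LINT x|M. l + ?c * G x (v k x))"
      proof (rule integral_mono_AE)
        show "AE x in M. norm (v k x) \<le> l + ?c * G x (v k x)"
          using G_growth by eventually_elim (use pg_small_abs[OF _ p F l] in auto)
      qed (use int in auto)
      also have "\<dots> = l * measure M (space M) + ?c * (LINT x|M. G x (v k x))"
        using int by (simp add: mult.commute)
      finally show ?case using le less by linarith
    qed
  qed
  show ?thesis
  proof (rule order_tendstoI)
    fix a :: real assume "a < 0"
    then have "a < (LINT x|M. norm (v k x))" for k by (rule less_le_trans) simp
    then show "eventually (\<lambda>k. a < (LINT x|M. norm (v k x))) sequentially" by simp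
  qed (rule ev)
qed

end

section \<open>Smooth functions of Sobolev functions\<close>

lemma integrable_imp_locally_integrable:
  fixes f :: "real^'n \<Rightarrow> 'b::{banach, second_countable_topology}"
  assumes "\<Omega> \<in> sets lebesgue" "integrable (lebesgue_on \<Omega>) f"
  shows "locally_integrable \<Omega> f"
  unfolding locally_integrable_def set_integrable_def
proof (intro allI impI)
  fix K assume K: "compact K \<and> K \<subseteq> \<Omega>"
  have "integrable lebesgue (\<lambda>x. indicator \<Omega> x *\<^sub>R f x)"
    using assms by (simp add: integrable_restrict_space)
  moreover have "K \<in> sets lebesgue" using K by (simp add: compact_imp_closed)
  ultimately have "integrable lebesgue (\<lambda>x. indicator K x *\<^sub>R (indicator \<Omega> x *\<^sub>R f x))"
    by (rule integrable_mult_indicator[rotated])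
  also have "(\<lambda>x. indicator K x *\<^sub>R (indicator \<Omega> x *\<^sub>R f x)) = (\<lambda>x. indicator K x *\<^sub>R f x)"
    using K by (intro ext) (auto simp: indicator_def)
  finally show "integrable lebesgue (\<lambda>x. indicator K x *\<^sub>R f x)" .
qed

context musielak
begin

lemma test_function_measurable:
  assumes "\<phi> \<in> test_functions \<Omega>"
  shows "\<phi> \<in> borel_measurable M" "grad \<phi> \<in> borel_measurable M" "partial_deriv i \<phi> \<in> borel_measurable M"
  using test_functions_continuous[OF assms]
  by (auto intro!: measurable_restrict_space1 measurable_completion borel_measurable_continuous_onI
      simp: measurable_lborel1)

lemma test_function_modular:
  assumes "\<phi> \<in> test_functions \<Omega>"
  shows "modular \<phi> < \<infinity>" "modular (\<lambda>x. norm (grad \<phi> x)) < \<infinity>"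
  using test_functions_bounded[OF assms]
  by (metis modular_bounded_finite, metis abs_norm_cancel modular_bounded_finite)

lemma L_space_diff:
  assumes u: "u \<in> L_space \<Omega> G" and v: "v \<in> L_space \<Omega> G"
  shows "(\<lambda>x. u x - v x) \<in> L_space \<Omega> G"
proof -
  have [measurable]: "u \<in> borel_measurable M" "v \<in> borel_measurable M"
    and fin: "modular u < \<infinity>" "modular v < \<infinity>" using u v by (auto simp: L_space_iff)
  have "modular (\<lambda>x. u x + - v x) \<le> ennreal (2 powr q) * (modular u + modular (\<lambda>x. - v x))"
    by (rule modular_add) measurable
  also have "modular (\<lambda>x. - v x) \<le> modular v" by (rule modular_mono) simp
  then have "ennreal (2 powr q) * (modular u + modular (\<lambda>x. - v x)) < \<infinity>"
    using fin by (auto simp: ennreal_mult_less_top intro: le_less_trans)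
  finally show ?thesis by (simp add: L_space_iff)
qed

lemma L_space_norm_diff:
  fixes U V :: "real^'n \<Rightarrow> real^'n"
  assumes [measurable]: "U \<in> borel_measurable M" "V \<in> borel_measurable M"
    and "modular (\<lambda>x. norm (U x)) < \<infinity>" "modular (\<lambda>x. norm (V x)) < \<infinity>"
  shows "modular (\<lambda>x. norm (U x - V x)) < \<infinity>"
proof -
  have "modular (\<lambda>x. norm (U x - V x)) \<le> modular (\<lambda>x. norm (U x) + norm (V x))"
    by (intro modular_mono AE_I2) (simp add: norm_triangle_ineq4)
  also have "\<dots> \<le> ennreal (2 powr q) * (modular (\<lambda>x. norm (U x)) + modular (\<lambda>x. norm (V x)))"
    by (rule modular_add) measurable
  also have "\<dots> < \<infinity>" using assms by (simp add: ennreal_mult_less_top)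
  finally show ?thesis .
qed

lemma W1_space_D:
  assumes "u \<in> W1_space \<Omega> G"
  shows "u \<in> borel_measurable M" "modular u < \<infinity>" "has_weak_gradient \<Omega> u (weak_gradient \<Omega> u)"
    "weak_gradient \<Omega> u \<in> borel_measurable M" "modular (\<lambda>x. norm (weak_gradient \<Omega> u x)) < \<infinity>"
proof -
  show 1: "has_weak_gradient \<Omega> u (weak_gradient \<Omega> u)"
    using assms weak_gradient_works by (auto simp: W1_space_def)
  then show "weak_gradient \<Omega> u \<in> borel_measurable M"
    by (intro locally_integrable_borel_measurable[OF open_\<Omega>]) (simp add: has_weak_gradient_def)
qed (use assms in \<open>auto simp: W1_space_def L_space_iff\<close>)

lemma W1_norm_diff_test_tendsto_0_iff:
  assumes u: "u \<in> borel_measurable M" "modular u < \<infinity>"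
    and U: "has_weak_gradient \<Omega> u U" "U \<in> borel_measurable M" "modular (\<lambda>x. norm (U x)) < \<infinity>"
    and \<phi>: "\<And>k. \<phi> k \<in> test_functions \<Omega>"
  shows "(\<lambda>k. W1_norm \<Omega> G (\<lambda>x. u x - \<phi> k x)) \<longlonglongrightarrow> 0 \<longleftrightarrow>
    (\<lambda>k. modular (\<lambda>x. u x - \<phi> k x)) \<longlonglongrightarrow> 0 \<and> (\<lambda>k. modular (\<lambda>x. norm (U x - grad (\<phi> k) x))) \<longlonglongrightarrow> 0"
proof -
  let ?v = "\<lambda>k x. u x - \<phi> k x" and ?V = "\<lambda>k x. norm (U x - grad (\<phi> k) x)"
  let ?N = "L_norm \<Omega> G"
  note mf = test_function_measurable(1,2)[OF \<phi>] test_function_modular[OF \<phi>]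
  have v: "?v k \<in> L_space \<Omega> G" for k
    using u mf by (intro L_space_diff) (auto simp: L_space_iff)
  have V: "?V k \<in> L_space \<Omega> G" for k
    using U(2) mf(2) L_space_norm_diff[OF U(2) mf(2) U(3) mf(4)] by (auto simp: L_space_iff)
  have AE: "AE x in M. weak_gradient \<Omega> (?v k) x = U x - grad (\<phi> k) x" for k
    by (intro weak_gradient_AE_eq has_weak_gradient_diff open_\<Omega> U test_function_has_weak_gradient \<phi>)
  have "?N (\<lambda>x. norm (weak_gradient \<Omega> (?v k) x)) = ?N (?V k)" for k
    by (rule L_norm_cong, use AE[of k] in eventually_elim) simp
  then have W1: "W1_norm \<Omega> G (?v k) = ?N (?v k) + ?N (?V k)" for k
    by (simp add: W1_norm_def)
  have nn: "0 \<le> ?N (?v k)" "0 \<le> ?N (?V k)" for k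
    using v V by (auto intro: L_norm_nonneg)
  have "(\<lambda>k. W1_norm \<Omega> G (?v k)) \<longlonglongrightarrow> 0 \<longleftrightarrow> (\<lambda>k. ?N (?v k)) \<longlonglongrightarrow> 0 \<and> (\<lambda>k. ?N (?V k)) \<longlonglongrightarrow> 0"
  proof
    assume lim: "(\<lambda>k. W1_norm \<Omega> G (?v k)) \<longlonglongrightarrow> 0"
    have "(\<lambda>k. ?N (?v k)) \<longlonglongrightarrow> 0" "(\<lambda>k. ?N (?V k)) \<longlonglongrightarrow> 0"
      by (rule tendsto_sandwich[OF _ _ tendsto_const lim]; use nn W1 in auto)+
    then show "(\<lambda>k. ?N (?v k)) \<longlonglongrightarrow> 0 \<and> (\<lambda>k. ?N (?V k)) \<longlonglongrightarrow> 0" ..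
  next
    assume "(\<lambda>k. ?N (?v k)) \<longlonglongrightarrow> 0 \<and> (\<lambda>k. ?N (?V k)) \<longlonglongrightarrow> 0"
    then show "(\<lambda>k. W1_norm \<Omega> G (?v k)) \<longlonglongrightarrow> 0"
      unfolding W1 using tendsto_add[of "\<lambda>k. ?N (?v k)" 0 sequentially "\<lambda>k. ?N (?V k)" 0] by simp
  qed
  then show ?thesis
    unfolding L_norm_tendsto_0_iff[of ?v, OF v] L_norm_tendsto_0_iff[of ?V, OF V] .
qed

text \<open>The limit \<open>U\<close> of the gradients is a separate argument: for a new function such as \<open>T \<circ> u\<close> this
  limit is known first, and that it is the weak gradient is a consequence.\<close>

definition approximates :: "(nat \<Rightarrow> real^'n \<Rightarrow> real) \<Rightarrow> (real^'n \<Rightarrow> real) \<Rightarrow> (real^'n \<Rightarrow> real^'n) \<Rightarrow> bool" where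
  "approximates \<phi> u U \<longleftrightarrow> (\<forall>k. \<phi> k \<in> test_functions \<Omega>) \<and>
     (\<lambda>k. modular (\<lambda>x. u x - \<phi> k x)) \<longlonglongrightarrow> 0 \<and> (\<lambda>k. modular (\<lambda>x. norm (U x - grad (\<phi> k) x))) \<longlonglongrightarrow> 0"

lemma W10_space_approximates:
  assumes "u \<in> W10_space \<Omega> G"
  shows "\<exists>\<phi>. approximates \<phi> u (weak_gradient \<Omega> u)"
proof -
  obtain \<phi> where W1: "u \<in> W1_space \<Omega> G" and \<phi>: "\<And>k::nat. \<phi> k \<in> test_functions \<Omega>"
    and lim: "(\<lambda>k. W1_norm \<Omega> G (\<lambda>x. u x - \<phi> k x)) \<longlonglongrightarrow> 0"
    using assms by (auto simp: W10_space_def)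
  from lim W1_norm_diff_test_tendsto_0_iff[OF W1_space_D[OF W1] \<phi>] \<phi> show ?thesis
    by (auto simp: approximates_def)
qed

context
  fixes u U \<phi>
  assumes u: "u \<in> borel_measurable M" "modular u < \<infinity>"
    and U: "U \<in> borel_measurable M" "modular (\<lambda>x. norm (U x)) < \<infinity>"
    and approx: "approximates \<phi> u U"
begin

lemma approximants: "\<phi> k \<in> test_functions \<Omega>"
  using approx by (simp add: approximates_def)

lemma approximates_L1:
  "(\<lambda>k. LINT x|M. \<bar>u x - \<phi> k x\<bar>) \<longlonglongrightarrow> 0"
  "(\<lambda>k. LINT x|M. norm (U x - grad (\<phi> k) x)) \<longlonglongrightarrow> 0"
  "integrable M (\<lambda>x. u x - \<phi> k x)" "integrable M (\<lambda>x. norm (U x - grad (\<phi> k) x))"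
proof -
  have m: "(\<lambda>x. u x - \<phi> k x) \<in> borel_measurable M" "(\<lambda>x. norm (U x - grad (\<phi> k) x)) \<in> borel_measurable M" for k
    using u U test_function_measurable(1,2)[OF approximants] by auto
  have f: "modular (\<lambda>x. u x - \<phi> k x) < \<infinity>" for k
    using L_space_diff[of u "\<phi> k"] u test_function_measurable(1)[OF approximants]
      test_function_modular(1)[OF approximants] by (simp add: L_space_iff)
  have g: "modular (\<lambda>x. norm (U x - grad (\<phi> k) x)) < \<infinity>" for k
    by (rule L_space_norm_diff[OF U(1) test_function_measurable(2)[OF approximants] U(2)
          test_function_modular(2)[OF approximants]])
  show "(\<lambda>k. LINT x|M. \<bar>u x - \<phi> k x\<bar>) \<longlonglongrightarrow> 0"
    using L1_tendsto_0_if_modular_tendsto_0[OF m(1) f] approx by (simp add: approximates_def)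
  show "(\<lambda>k. LINT x|M. norm (U x - grad (\<phi> k) x)) \<longlonglongrightarrow> 0"
    using L1_tendsto_0_if_modular_tendsto_0[OF m(2) g] approx by (simp add: approximates_def)
  show "integrable M (\<lambda>x. u x - \<phi> k x)" "integrable M (\<lambda>x. norm (U x - grad (\<phi> k) x))"
    using integrable_if_modular_finite(2) m f g by blast+
qed

lemma approximates_integrable: "integrable M u" "integrable M U"
  using integrable_if_modular_finite(2)[OF u]
    integrable_norm_cancel[OF integrable_if_modular_finite(2)[OF measurable_compose[OF U(1) borel_measurable_norm] U(2)] U(1)]
  by auto

text \<open>Convergence in the mean passes to the limit in the integration by parts formula, whose test
  functions and their derivatives are bounded.\<close>

lemma approximates_has_weak_gradient: "has_weak_gradient \<Omega> u U"
  unfolding has_weak_gradient_def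
proof (intro conjI ballI allI)
  show li: "locally_integrable \<Omega> u" "locally_integrable \<Omega> U"
    using approximates_integrable sets_\<Omega> by (auto intro: integrable_imp_locally_integrable)
  fix \<psi> i assume \<psi>: "\<psi> \<in> test_functions \<Omega>"
  obtain C where C: "\<And>x. \<bar>\<psi> x\<bar> \<le> C" "\<And>x. norm (grad \<psi> x) \<le> C"
    using test_functions_bounded[OF \<psi>] by metis
  have C': "\<bar>partial_deriv i \<psi> x\<bar> \<le> C" for x
    using component_le_norm_cart[of "grad \<psi> x" i] C(2)[of x] by (simp add: grad_def)
  have lim: "(\<lambda>k. LINT x|M. f k x * h x) \<longlonglongrightarrow> (LINT x|M. g x * h x)"
    if "(\<lambda>k. LINT x|M. \<bar>g x - f k x\<bar>) \<longlonglongrightarrow> 0" "integrable M g" "\<And>k. integrable M (f k)"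
      "h \<in> borel_measurable M" "\<And>x. \<bar>h x\<bar> \<le> C"
    for f :: "nat \<Rightarrow> real^'n \<Rightarrow> real" and g h
  proof -
    have i: "integrable M (\<lambda>x. g x * h x)" "integrable M (\<lambda>x. f k x * h x)" for k
      using that by (auto intro: integrable_lebesgue_on_mult_bounded)
    have bound: "norm ((LINT x|M. f k x * h x) - (LINT x|M. g x * h x)) \<le> C * (LINT x|M. \<bar>g x - f k x\<bar>)" for k
    proof -
      have "\<bar>(LINT x|M. f k x * h x) - (LINT x|M. g x * h x)\<bar> = \<bar>LINT x|M. (g x - f k x) * h x\<bar>"
        using i by (simp add: left_diff_distrib abs_minus_commute)
      also have "\<dots> \<le> (LINT x|M. \<bar>(g x - f k x) * h x\<bar>)" by (rule integral_abs_bound)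
      also have "\<dots> \<le> (LINT x|M. C * \<bar>g x - f k x\<bar>)"
      proof (rule integral_mono)
        show "integrable M (\<lambda>x. \<bar>(g x - f k x) * h x\<bar>)" using i by (simp add: left_diff_distrib)
        show "integrable M (\<lambda>x. C * \<bar>g x - f k x\<bar>)" using that by simp
        show "\<bar>(g x - f k x) * h x\<bar> \<le> C * \<bar>g x - f k x\<bar>" for x
          using that(5)[of x] mult_right_mono[of "\<bar>h x\<bar>" C "\<bar>g x - f k x\<bar>"] by (simp add: abs_mult mult.commute)
      qed
      finally show ?thesis by simp
    qed
    have "(\<lambda>k. C * (LINT x|M. \<bar>g x - f k x\<bar>)) \<longlonglongrightarrow> 0"
      using tendsto_mult_left[OF that(1), of C] by simp
    then have "(\<lambda>k. (LINT x|M. f k x * h x) - (LINT x|M. g x * h x)) \<longlonglongrightarrow> 0"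
      by (rule Lim_null_comparison[rotated]) (intro always_eventually allI bound)
    then show ?thesis by (rule LIM_zero_cancel)
  qed
  have int: "integrable M (\<phi> k)" "integrable M (\<lambda>x. grad (\<phi> k) x $ i)" for k
  proof -
    show "integrable M (\<phi> k)"
      using integrable_if_modular_finite(2)[OF test_function_measurable(1)[OF approximants] test_function_modular(1)[OF approximants]] .
    have m: "grad (\<phi> k) \<in> borel_measurable M" by (rule test_function_measurable(2)[OF approximants])
    have "integrable M (\<lambda>x. norm (grad (\<phi> k) x))"
      by (rule integrable_if_modular_finite(2)[OF measurable_compose[OF m borel_measurable_norm] test_function_modular(2)[OF approximants]])
    then have "integrable M (grad (\<phi> k))" using m by (rule integrable_norm_cancel)
    then show "integrable M (\<lambda>x. grad (\<phi> k) x $ i)"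
      by (rule integrable_bounded_linear[OF bounded_linear_vec_nth])
  qed
  have Ui: "integrable M (\<lambda>x. U x $ i)"
    by (rule integrable_bounded_linear[OF bounded_linear_vec_nth approximates_integrable(2)])
  have limU: "(\<lambda>k. LINT x|M. \<bar>U x $ i - grad (\<phi> k) x $ i\<bar>) \<longlonglongrightarrow> 0"
  proof (rule Lim_null_comparison[OF always_eventually approximates_L1(2)], intro allI)
    fix k
    have "(LINT x|M. \<bar>U x $ i - grad (\<phi> k) x $ i\<bar>) \<le> (LINT x|M. norm (U x - grad (\<phi> k) x))"
      using Ui int(2)[of k] component_le_norm_cart[of "U _ - grad (\<phi> k) _" i]
      by (intro integral_mono approximates_L1(4)) auto
    then show "norm (LINT x|M. \<bar>U x $ i - grad (\<phi> k) x $ i\<bar>) \<le> (LINT x|M. norm (U x - grad (\<phi> k) x))" by simp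
  qed
  have lim1: "(\<lambda>k. LINT x|M. \<phi> k x * partial_deriv i \<psi> x) \<longlonglongrightarrow> (LINT x|M. u x * partial_deriv i \<psi> x)"
    by (rule lim[OF approximates_L1(1) approximates_integrable(1) int(1) test_function_measurable(3)[OF \<psi>] C'])
  have lim2: "(\<lambda>k. LINT x|M. grad (\<phi> k) x $ i * \<psi> x) \<longlonglongrightarrow> (LINT x|M. U x $ i * \<psi> x)"
    by (rule lim[OF limU Ui int(2) test_function_measurable(1)[OF \<psi>] C(1)])
  have "(LINT x|M. \<phi> k x * partial_deriv i \<psi> x) = - (LINT x|M. grad (\<phi> k) x $ i * \<psi> x)" for k
    using test_function_has_weak_gradient[OF open_\<Omega> approximants] \<psi> by (auto simp: has_weak_gradient_def)
  then have "(\<lambda>k. LINT x|M. \<phi> k x * partial_deriv i \<psi> x) \<longlonglongrightarrow> - (LINT x|M. U x $ i * \<psi> x)"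
    using tendsto_minus[OF lim2] by simp
  with lim1 show "(LINT x|M. u x * partial_deriv i \<psi> x) = - (LINT x|M. U x $ i * \<psi> x)"
    by (rule LIMSEQ_unique)
qed

lemma approximates_W10_space:
  "u \<in> W10_space \<Omega> G" "AE x in M. weak_gradient \<Omega> u x = U x"
proof -
  note hwg = approximates_has_weak_gradient
  show AE: "AE x in M. weak_gradient \<Omega> u x = U x"
    by (rule weak_gradient_AE_eq[OF open_\<Omega> hwg])
  have wm: "weak_gradient \<Omega> u \<in> borel_measurable M"
    using weak_gradient_works[OF hwg]
    by (intro locally_integrable_borel_measurable[OF open_\<Omega>]) (simp add: has_weak_gradient_def)
  have "modular (\<lambda>x. norm (weak_gradient \<Omega> u x)) = modular (\<lambda>x. norm (U x))"
    by (intro modular_cong_eq) (use AE in \<open>auto elim: eventually_mono\<close>)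
  then have W1: "u \<in> W1_space \<Omega> G"
    using u U wm hwg by (auto simp: W1_space_def L_space_iff)
  have "(\<lambda>k. W1_norm \<Omega> G (\<lambda>x. u x - \<phi> k x)) \<longlonglongrightarrow> 0"
    using approx W1_norm_diff_test_tendsto_0_iff[OF u hwg U approximants] by (simp add: approximates_def)
  then show "u \<in> W10_space \<Omega> G"
    using W1 approximants by (auto simp: W10_space_def)
qed

lemma approximates_AE_subseq:
  obtains r where "strict_mono r" "AE x in M. (\<lambda>k. \<phi> (r k) x) \<longlonglongrightarrow> u x"
proof -
  obtain r where r: "strict_mono r" "AE x in M. (\<lambda>k. u x - \<phi> (r k) x) \<longlonglongrightarrow> 0"
    using tendsto_L1_AE_subseq[of M "\<lambda>k x. u x - \<phi> k x", OF approximates_L1(3)] approximates_L1(1) by auto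
  from r(2) have "AE x in M. (\<lambda>k. \<phi> (r k) x) \<longlonglongrightarrow> u x"
  proof eventually_elim
    case (elim x)
    from tendsto_diff[OF tendsto_const[of "u x"] elim] show ?case by simp
  qed
  with r(1) show ?thesis by (rule that)
qed

end

lemma W10_space_D:
  assumes "u \<in> W10_space \<Omega> G"
  shows "u \<in> W1_space \<Omega> G"
  using assms by (simp add: W10_space_def)

text \<open>If test functions \<open>\<phi> k\<close> approximate \<open>u\<close>, then the test functions \<open>T \<circ> \<phi> k\<close> approximate
  \<open>T \<circ> u\<close>. The delicate term is \<open>(T' (u x) - T' (\<phi> k x)) * Du\<close>: along a subsequence it tends to \<open>0\<close>
  almost everywhere and is dominated by a multiple of \<open>Du\<close>.\<close>

lemma W10_space_compose:
  assumes u: "u \<in> W10_space \<Omega> G" and T: "smooth_real T" "T 0 = 0"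
    and T': "\<And>t. (T has_real_derivative T' t) (at t)" "\<And>t. \<bar>T' t\<bar> \<le> L"
  shows "(\<lambda>x. T (u x)) \<in> W10_space \<Omega> G"
    and "AE x in M. weak_gradient \<Omega> (\<lambda>x. T (u x)) x = T' (u x) *\<^sub>R weak_gradient \<Omega> u x"
proof -
  let ?U = "weak_gradient \<Omega> u"
  let ?L = "max 1 L"
  note uD = W1_space_D[OF W10_space_D[OF u]]
  note [measurable] = uD(1,4)
  have contT': "continuous_on UNIV T'" by (rule smooth_real_imp_deriv[OF T(1) T'(1)])
  then have [measurable]: "T' \<in> borel_measurable borel" by (rule borel_measurable_continuous_onI)
  have "continuous_on UNIV T" using T'(1) by (meson DERIV_isCont continuous_at_imp_continuous_on)
  then have [measurable]: "T \<in> borel_measurable borel" by (rule borel_measurable_continuous_onI)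
  have L: "1 \<le> ?L" "\<bar>T' t\<bar> \<le> ?L" for t using T'(2)[of t] by auto
  have lip: "\<bar>T s - T t\<bar> \<le> ?L * \<bar>s - t\<bar>" for s t
  proof -
    have "norm (T s - T t) \<le> ?L * norm (s - t)"
      by (rule field_differentiable_bound[where S=UNIV and f'=T']) (use T'(1) L in auto)
    then show ?thesis by simp
  qed
  obtain \<phi>0 where \<phi>0: "approximates \<phi>0 u ?U" using W10_space_approximates[OF u] by blast
  obtain r where r: "strict_mono r" "AE x in M. (\<lambda>k. \<phi>0 (r k) x) \<longlonglongrightarrow> u x"
    using approximates_AE_subseq[OF uD(1,2,4,5) \<phi>0] by blast
  define \<phi> where "\<phi> k = \<phi>0 (r k)" for k
  have \<phi>: "\<phi> k \<in> test_functions \<Omega>" for k using \<phi>0 by (simp add: approximates_def \<phi>_def)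
  have lim: "(\<lambda>k. modular (\<lambda>x. u x - \<phi> k x)) \<longlonglongrightarrow> 0" "(\<lambda>k. modular (\<lambda>x. norm (?U x - grad (\<phi> k) x))) \<longlonglongrightarrow> 0"
    using \<phi>0 r(1) LIMSEQ_subseq_LIMSEQ[of _ 0 r] unfolding approximates_def \<phi>_def by (auto simp: o_def)
  have AE: "AE x in M. (\<lambda>k. \<phi> k x) \<longlonglongrightarrow> u x" using r(2) by (simp add: \<phi>_def)
  note [measurable] = test_function_measurable(1,2)[OF \<phi>]
  have scale: "modular (\<lambda>x. ?L * v x) \<le> ennreal (?L powr q) * modular v" if "v \<in> borel_measurable M" for v
    by (rule modular_scale[OF that L(1)])
  have lim_scaled: "(\<lambda>k. modular (\<lambda>x. ?L * v k x)) \<longlonglongrightarrow> 0"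
    if "(\<lambda>k. modular (v k)) \<longlonglongrightarrow> 0" "\<And>k. v k \<in> borel_measurable M" for v
  proof (rule tendsto_sandwich[OF _ _ tendsto_const])
    have "(\<lambda>k. ennreal (?L powr q) * modular (v k)) \<longlonglongrightarrow> ennreal (?L powr q) * 0"
      by (rule ennreal_tendsto_cmult[OF _ that(1)]) simp
    then show "(\<lambda>k. ennreal (?L powr q) * modular (v k)) \<longlonglongrightarrow> 0" by simp
  qed (use scale that(2) in auto)
  have "modular (\<lambda>x. T (u x)) \<le> modular (\<lambda>x. ?L * u x)"
    by (intro modular_mono AE_I2) (use lip[of _ 0] T(2) in \<open>simp add: abs_mult\<close>)
  also have "\<dots> \<le> ennreal (?L powr q) * modular u" by (rule scale) measurable
  also have "\<dots> < \<infinity>" using uD by (simp add: ennreal_mult_less_top)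
  finally have Tu: "modular (\<lambda>x. T (u x)) < \<infinity>" .
  have "modular (\<lambda>x. norm (T' (u x) *\<^sub>R ?U x)) \<le> modular (\<lambda>x. ?L * norm (?U x))"
    by (intro modular_mono AE_I2) (use L in \<open>auto simp: abs_mult intro!: mult_right_mono\<close>)
  also have "\<dots> \<le> ennreal (?L powr q) * modular (\<lambda>x. norm (?U x))" by (rule scale) measurable
  also have "\<dots> < \<infinity>" using uD by (simp add: ennreal_mult_less_top)
  finally have TU: "modular (\<lambda>x. norm (T' (u x) *\<^sub>R ?U x)) < \<infinity>" .
  have approx: "approximates (\<lambda>k x. T (\<phi> k x)) (\<lambda>x. T (u x)) (\<lambda>x. T' (u x) *\<^sub>R ?U x)"
    unfolding approximates_def
  proof (intro conjI allI)
    show "(\<lambda>x. T (\<phi> k x)) \<in> test_functions \<Omega>" for k by (rule test_functions_compose[OF \<phi> T])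
    show "(\<lambda>k. modular (\<lambda>x. T (u x) - T (\<phi> k x))) \<longlonglongrightarrow> 0"
    proof (rule tendsto_sandwich[OF _ _ tendsto_const])
      show "(\<lambda>k. modular (\<lambda>x. ?L * (u x - \<phi> k x))) \<longlonglongrightarrow> 0"
        by (rule lim_scaled[OF lim(1)]) measurable
      have "modular (\<lambda>x. T (u x) - T (\<phi> k x)) \<le> modular (\<lambda>x. ?L * (u x - \<phi> k x))" for k
        by (intro modular_mono AE_I2) (use lip in \<open>simp add: abs_mult\<close>)
      then show "eventually (\<lambda>k. modular (\<lambda>x. T (u x) - T (\<phi> k x)) \<le> modular (\<lambda>x. ?L * (u x - \<phi> k x))) sequentially"
        by simp
    qed simp
    \<comment> \<open>the part of the gradient error that comes from the change of \<open>T'\<close>; dominated convergence\<close>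
    define a where "a k x = \<bar>T' (u x) - T' (\<phi> k x)\<bar> * norm (?U x)" for k x
    have [measurable]: "a k \<in> borel_measurable M" for k unfolding a_def by measurable
    have "(\<lambda>k. modular (a k)) \<longlonglongrightarrow> (\<integral>\<^sup>+x. 0 \<partial>M)"
      unfolding modular_def
    proof (rule nn_integral_dominated_convergence[where w="\<lambda>x. ennreal (G x (2 * ?L * norm (?U x)))"])
      show "AE x in M. ennreal (G x (a j x)) \<le> ennreal (G x (2 * ?L * norm (?U x)))" for j
        using G_growth
      proof eventually_elim
        case (elim x)
        have "\<bar>T' (u x) - T' (\<phi> j x)\<bar> * norm (?U x) \<le> 2 * ?L * norm (?U x)"
          using L(2)[of "u x"] L(2)[of "\<phi> j x"] by (intro mult_right_mono) (linarith, simp)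
        then show ?case using L(1)
          by (intro ennreal_leI pg_mono[OF elim p F]) (auto simp: a_def abs_mult)
      qed
      have "modular (\<lambda>x. 2 * ?L * norm (?U x)) \<le> ennreal ((2 * ?L) powr q) * modular (\<lambda>x. norm (?U x))"
        using L(1) by (intro modular_scale) auto
      also have "\<dots> < \<infinity>" using uD by (simp add: ennreal_mult_less_top)
      finally show "(\<integral>\<^sup>+x. ennreal (G x (2 * ?L * norm (?U x))) \<partial>M) < \<infinity>" by (simp add: modular_def)
      show "AE x in M. (\<lambda>i. ennreal (G x (a i x))) \<longlonglongrightarrow> 0"
        using G_growth AE
      proof eventually_elim
        case (elim x)
        have "(\<lambda>k. T' (\<phi> k x)) \<longlonglongrightarrow> T' (u x)"
          using contT' elim(2) by (auto intro: continuous_on_tendsto_compose[of UNIV T'])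
        then have "(\<lambda>k. a k x) \<longlonglongrightarrow> \<bar>T' (u x) - T' (u x)\<bar> * norm (?U x)"
          unfolding a_def by (intro tendsto_intros)
        then have "(\<lambda>k. G x (a k x)) \<longlonglongrightarrow> G x 0"
          using pg_cont[OF elim(1) p F] by (auto intro: continuous_on_tendsto_compose[of UNIV "G x"])
        then show ?case using pg_zero[OF elim(1) p F] by (auto intro: tendsto_ennrealI[of _ 0, simplified])
      qed
    qed measurable
    then have lim_a: "(\<lambda>k. modular (a k)) \<longlonglongrightarrow> 0" by simp
    let ?b = "\<lambda>k x. ?L * norm (?U x - grad (\<phi> k) x)"
    have lim_b: "(\<lambda>k. modular (?b k)) \<longlonglongrightarrow> 0" by (rule lim_scaled[OF lim(2)]) measurable
    have le: "modular (\<lambda>x. norm (T' (u x) *\<^sub>R ?U x - grad (\<lambda>x. T (\<phi> k x)) x)) \<le> ennreal (2 powr q) * (modular (a k) + modular (?b k))" for k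
    proof -
      have "modular (\<lambda>x. norm (T' (u x) *\<^sub>R ?U x - grad (\<lambda>x. T (\<phi> k x)) x)) \<le> modular (\<lambda>x. a k x + ?b k x)"
      proof (intro modular_mono AE_I2)
        fix x
        have "T' (u x) *\<^sub>R ?U x - grad (\<lambda>x. T (\<phi> k x)) x
          = (T' (u x) - T' (\<phi> k x)) *\<^sub>R ?U x + T' (\<phi> k x) *\<^sub>R (?U x - grad (\<phi> k) x)"
          by (simp add: grad_compose[OF \<phi> T'(1)] algebra_simps)
        then have "norm (T' (u x) *\<^sub>R ?U x - grad (\<lambda>x. T (\<phi> k x)) x)
          \<le> a k x + \<bar>T' (\<phi> k x)\<bar> * norm (?U x - grad (\<phi> k) x)"
          using norm_triangle_ineq[of "(T' (u x) - T' (\<phi> k x)) *\<^sub>R ?U x" "T' (\<phi> k x) *\<^sub>R (?U x - grad (\<phi> k) x)"] by (simp add: a_def)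
        also have "\<dots> \<le> a k x + ?b k x" by (intro add_left_mono mult_right_mono L) simp
        finally show "\<bar>norm (T' (u x) *\<^sub>R ?U x - grad (\<lambda>x. T (\<phi> k x)) x)\<bar> \<le> \<bar>a k x + ?b k x\<bar>" by simp
      qed
      also have "\<dots> \<le> ennreal (2 powr q) * (modular (a k) + modular (?b k))"
        by (rule modular_add) measurable
      finally show ?thesis .
    qed
    show "(\<lambda>k. modular (\<lambda>x. norm (T' (u x) *\<^sub>R ?U x - grad (\<lambda>x. T (\<phi> k x)) x))) \<longlonglongrightarrow> 0"
    proof (rule tendsto_sandwich[OF _ _ tendsto_const])
      have "(\<lambda>k. ennreal (2 powr q) * (modular (a k) + modular (?b k))) \<longlonglongrightarrow> ennreal (2 powr q) * (0 + 0)"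
        by (intro ennreal_tendsto_cmult tendsto_add lim_a lim_b) simp
      then show "(\<lambda>k. ennreal (2 powr q) * (modular (a k) + modular (?b k))) \<longlonglongrightarrow> 0" by simp
    qed (use le in auto)
  qed
  show "(\<lambda>x. T (u x)) \<in> W10_space \<Omega> G"
    and "AE x in M. weak_gradient \<Omega> (\<lambda>x. T (u x)) x = T' (u x) *\<^sub>R ?U x"
    by (rule approximates_W10_space[OF _ Tu _ TU approx]; measurable)+
qed

end

section \<open>Smooth truncations\<close>

text \<open>Smooth approximations of the Heaviside function and of the positive part. Since
  \<open>logistic' = logistic - logistic\<^sup>2\<close>, all derivatives of \<open>softplus\<close> are polynomials in \<open>logistic\<close>.\<close>

definition logistic :: "real \<Rightarrow> real" where "logistic t = 1 / (1 + exp (- t))"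

definition softplus :: "real \<Rightarrow> real" where "softplus t = ln (1 + exp t)"

lemma logistic_bounds: "0 < logistic t" "logistic t < 1"
  unfolding logistic_def by (auto simp: add_pos_pos field_simps intro: add_pos_pos)

lemma has_real_derivative_softplus: "(softplus has_real_derivative logistic t) (at t)"
proof -
  have "0 < 1 + exp t" by (simp add: add_pos_pos)
  then have "((\<lambda>t. ln (1 + exp t)) has_real_derivative exp t / (1 + exp t)) (at t)"
    by (auto intro!: derivative_eq_intros simp: divide_simps)
  moreover have "exp t / (1 + exp t) = logistic t"
    by (simp add: logistic_def exp_minus divide_simps add_pos_pos)
  ultimately show ?thesis by (simp add: softplus_def[abs_def])
qed

lemma has_real_derivative_logistic: "(logistic has_real_derivative logistic t - (logistic t)\<^sup>2) (at t)"
proof -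
  have pos: "0 < 1 + exp (- t)" by (simp add: add_pos_pos)
  then have "((\<lambda>t. 1 / (1 + exp (- t))) has_real_derivative exp (- t) / (1 + exp (- t))\<^sup>2) (at t)"
    by (auto intro!: derivative_eq_intros simp: power2_eq_square)
  moreover have "exp (- t) / (1 + exp (- t))\<^sup>2 = logistic t - (logistic t)\<^sup>2"
    using pos by (simp add: logistic_def power2_eq_square divide_simps)
  ultimately show ?thesis by (simp add: logistic_def[abs_def])
qed

lemma smooth_real_softplus: "smooth_real softplus"
proof -
  define P :: "nat \<Rightarrow> real poly" where "P m = ((\<lambda>p. pderiv p * [:0, 1, -1:]) ^^ m) [:0, 1:]" for m
  define D where "D m = (case m of 0 \<Rightarrow> softplus | Suc m \<Rightarrow> (\<lambda>t. poly (P m) (logistic t)))" for m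
  have D: "D 0 = softplus" "\<And>m. D (Suc m) = (\<lambda>t. poly (P m) (logistic t))" by (simp_all add: D_def)
  have P: "P 0 = [:0, 1:]" "\<And>m. P (Suc m) = pderiv (P m) * [:0, 1, -1:]" by (simp_all only: P_def funpow.simps comp_def id_apply)
  have "(D m has_real_derivative D (Suc m) t) (at t)" for m t
  proof (cases m)
    case 0
    then show ?thesis using has_real_derivative_softplus by (simp add: D P)
  next
    case (Suc m)
    have "((\<lambda>t. poly (P m) (logistic t)) has_real_derivative
        poly (pderiv (P m)) (logistic t) * (logistic t - (logistic t)\<^sup>2)) (at t)"
      by (rule DERIV_chain2[OF poly_DERIV has_real_derivative_logistic])
    then show ?thesis unfolding Suc D P by (simp add: power2_eq_square algebra_simps)
  qed
  with D(1) show ?thesis unfolding smooth_real_def by blast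
qed

lemma smooth_real_cmult: "smooth_real T \<Longrightarrow> smooth_real (\<lambda>t. c * T t)"
  unfolding smooth_real_def
  by (elim exE, rule_tac x="\<lambda>m t. c * D m t" in exI) (auto intro!: derivative_eq_intros)

text \<open>The function \<open>excess k\<close> below is the signed amount by which \<open>\<bar>t\<bar>\<close> exceeds \<open>k\<close>, and
  \<open>trunc j k\<close> are smooth functions tending to it as \<open>j\<close> tends to infinity. They are odd,
  so that positive and negative values are truncated in one step and \<open>0\<close> is mapped to \<open>0\<close>.\<close>

definition trunc :: "nat \<Rightarrow> real \<Rightarrow> real \<Rightarrow> real" where
  "trunc j k t = (let a = real (Suc j) in
     (softplus (a * (t - k) + sqrt a) - softplus (a * (- t - k) + sqrt a)) / a)"

definition trunc' :: "nat \<Rightarrow> real \<Rightarrow> real \<Rightarrow> real" where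
  "trunc' j k t = (let a = real (Suc j) in
     logistic (a * (t - k) + sqrt a) + logistic (a * (- t - k) + sqrt a))"

definition excess :: "real \<Rightarrow> real \<Rightarrow> real" where
  "excess k t = max 0 (t - k) - max 0 (- t - k)"

lemma trunc_0: "trunc j k 0 = 0"
  by (simp add: trunc_def)

lemma trunc'_bounds: "\<bar>trunc' j k t\<bar> \<le> 2"
  using logistic_bounds[of "real (Suc j) * (t - k) + sqrt (real (Suc j))"]
    logistic_bounds[of "real (Suc j) * (- t - k) + sqrt (real (Suc j))"]
  unfolding trunc'_def Let_def by linarith

lemma has_real_derivative_trunc: "(trunc j k has_real_derivative trunc' j k t) (at t)"
proof -
  define a where "a = real (Suc j)"
  have "((\<lambda>t. softplus (a * (t - k) + sqrt a)) has_real_derivative logistic (a * (t - k) + sqrt a) * a) (at t)"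
    by (rule DERIV_chain2[OF has_real_derivative_softplus]) (auto intro!: derivative_eq_intros)
  moreover have "((\<lambda>t. softplus (a * (- t - k) + sqrt a)) has_real_derivative logistic (a * (- t - k) + sqrt a) * (- a)) (at t)"
    by (rule DERIV_chain2[OF has_real_derivative_softplus]) (auto intro!: derivative_eq_intros)
  ultimately have "((\<lambda>t. (softplus (a * (t - k) + sqrt a) - softplus (a * (- t - k) + sqrt a)) / a)
      has_real_derivative (logistic (a * (t - k) + sqrt a) * a - logistic (a * (- t - k) + sqrt a) * (- a)) / a) (at t)"
    by (intro DERIV_cdivide DERIV_diff)
  moreover have "a \<noteq> 0" by (simp add: a_def)
  ultimately show ?thesis
    by (simp add: trunc_def[abs_def] trunc'_def Let_def a_def[symmetric] add_divide_distrib del: of_nat_Suc)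
qed

lemma smooth_real_trunc: "smooth_real (trunc j k)"
proof -
  define a where "a = real (Suc j)"
  have "smooth_real (\<lambda>t. (1 / a) * (softplus (a * t + (sqrt a - a * k)) - softplus ((- a) * t + (sqrt a - a * k))))"
    by (intro smooth_real_cmult smooth_real_diff smooth_real_affine smooth_real_softplus)
  also have "(\<lambda>t. (1 / a) * (softplus (a * t + (sqrt a - a * k)) - softplus ((- a) * t + (sqrt a - a * k)))) = trunc j k"
    by (rule ext) (simp add: trunc_def Let_def a_def[symmetric] algebra_simps diff_divide_distrib del: of_nat_Suc)
  finally show ?thesis .
qed

lemma borel_measurable_trunc [measurable]:
  "trunc j k \<in> borel_measurable borel" "trunc' j k \<in> borel_measurable borel"
proof -
  have "continuous_on UNIV (trunc j k)"
    using has_real_derivative_trunc by (meson DERIV_isCont continuous_at_imp_continuous_on)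
  then show "trunc j k \<in> borel_measurable borel" by (rule borel_measurable_continuous_onI)
  show "trunc' j k \<in> borel_measurable borel"
    by (rule borel_measurable_continuous_onI[OF smooth_real_imp_deriv[OF smooth_real_trunc has_real_derivative_trunc]])
qed

lemma abs_trunc_le: "\<bar>trunc j k t\<bar> \<le> 2 * \<bar>t\<bar>"
proof -
  have "norm (trunc j k t - trunc j k 0) \<le> 2 * norm (t - 0)"
    by (rule field_differentiable_bound[where S=UNIV and f'="trunc' j k"])
      (use has_real_derivative_trunc trunc'_bounds in auto)
  then show ?thesis by (simp add: trunc_0)
qed

text \<open>The shift by \<open>sqrt a\<close> makes the smoothed Heaviside function tend to \<open>1\<close> at the jump as well.\<close>

lemma logistic_limit: "((\<lambda>a. logistic (a * s + sqrt a)) \<longlongrightarrow> (if 0 \<le> s then 1 else 0)) at_top"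
proof -
  consider "s > 0" | "s = 0" | "s < 0" by linarith
  then show ?thesis
  proof cases
    case 1 then show ?thesis unfolding logistic_def by simp real_asymp
  next
    case 2 then show ?thesis unfolding logistic_def by simp real_asymp
  next
    case 3 then show ?thesis unfolding logistic_def by simp real_asymp
  qed
qed

lemma softplus_limit: "((\<lambda>a. softplus (a * s + sqrt a) / a) \<longlongrightarrow> max 0 s) at_top"
proof -
  consider "s > 0" | "s = 0" | "s < 0" by linarith
  then show ?thesis
  proof cases
    case 1 then show ?thesis unfolding softplus_def by (simp add: max_def) real_asymp
  next
    case 2 then show ?thesis unfolding softplus_def by (simp add: max_def) real_asymp
  next
    case 3 then show ?thesis unfolding softplus_def by (simp add: max_def) real_asymp
  qed
qed

lemma filterlim_real_Suc: "filterlim (\<lambda>j. real (Suc j)) at_top sequentially"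
  by real_asymp

lemma trunc_limit: "(\<lambda>j. trunc j k t) \<longlonglongrightarrow> excess k t"
  unfolding trunc_def excess_def diff_divide_distrib Let_def
  by (intro tendsto_diff filterlim_compose[OF softplus_limit filterlim_real_Suc])

lemma trunc'_limit:
  assumes "0 < k"
  shows "(\<lambda>j. trunc' j k t) \<longlonglongrightarrow> (if k \<le> \<bar>t\<bar> then 1 else 0)"
proof -
  have "(\<lambda>j. trunc' j k t) \<longlonglongrightarrow> (if 0 \<le> t - k then 1 else 0) + (if 0 \<le> - t - k then 1 else 0)"
    unfolding trunc'_def Let_def
    by (intro tendsto_add filterlim_compose[OF logistic_limit filterlim_real_Suc])
  also have "(if 0 \<le> t - k then 1 else 0) + (if 0 \<le> - t - k then 1 else 0 :: real) = (if k \<le> \<bar>t\<bar> then 1 else 0)"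
    using assms by (auto simp: abs_if)
  finally show ?thesis .
qed

section \<open>The level set inequality\<close>

lemma nn_integral_translate:
  fixes f :: "real^'n \<Rightarrow> ennreal"
  assumes "f \<in> borel_measurable borel"
  shows "(\<integral>\<^sup>+x. f (x + z) \<partial>lborel) = (\<integral>\<^sup>+x. f x \<partial>lborel)"
  using nn_integral_distr[of "(+) z" lborel borel f] lborel_distr_plus[of z] assms
  by (simp add: add.commute)

text \<open>Cut the translation by \<open>z\<close> into \<open>m\<close> steps. By translation invariance the left hand side is at
  most \<open>m\<close> times the integral for the step \<open>z / m\<close>, which is the integral of a difference quotient.\<close>

lemma test_function_translation_estimate:
  assumes \<phi>: "\<phi> \<in> test_functions \<Omega>"
  shows "(\<integral>\<^sup>+x. ennreal \<bar>\<phi> (x + z) - \<phi> x\<bar> \<partial>lborel) \<le> ennreal (norm z) * (\<integral>\<^sup>+x. ennreal (norm (grad \<phi> x)) \<partial>lborel)"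
proof -
  have [measurable]: "\<phi> \<in> borel_measurable borel" "grad \<phi> \<in> borel_measurable borel"
    using test_functions_continuous[OF \<phi>] by (auto intro: borel_measurable_continuous_onI)
  let ?Q = "\<lambda>m x. real (Suc m) * (\<phi> (x + z /\<^sub>R real (Suc m)) - \<phi> x)"
  let ?I = "\<integral>\<^sup>+x. ennreal \<bar>\<phi> (x + z) - \<phi> x\<bar> \<partial>lborel"
  have le: "?I \<le> (\<integral>\<^sup>+x. ennreal \<bar>?Q m x\<bar> \<partial>lborel)" for m
  proof -
    let ?n = "Suc m" let ?z = "z /\<^sub>R real (Suc m)"
    have "ennreal \<bar>\<phi> (x + z) - \<phi> x\<bar> \<le> (\<Sum>i<?n. ennreal \<bar>\<phi> (x + real i *\<^sub>R ?z + ?z) - \<phi> (x + real i *\<^sub>R ?z)\<bar>)" for x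
    proof -
      have "\<phi> (x + z) - \<phi> x = (\<Sum>i<?n. \<phi> (x + real (Suc i) *\<^sub>R ?z) - \<phi> (x + real i *\<^sub>R ?z))"
        by (subst sum_lessThan_telescope) simp
      also have "\<dots> = (\<Sum>i<?n. \<phi> (x + real i *\<^sub>R ?z + ?z) - \<phi> (x + real i *\<^sub>R ?z))"
        by (simp add: algebra_simps)
      finally have eq: "\<phi> (x + z) - \<phi> x = (\<Sum>i<?n. \<phi> (x + real i *\<^sub>R ?z + ?z) - \<phi> (x + real i *\<^sub>R ?z))" .
      have "ennreal \<bar>\<phi> (x + z) - \<phi> x\<bar> \<le> ennreal (\<Sum>i<?n. \<bar>\<phi> (x + real i *\<^sub>R ?z + ?z) - \<phi> (x + real i *\<^sub>R ?z)\<bar>)"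
        unfolding eq by (intro ennreal_leI sum_abs)
      also have "\<dots> = (\<Sum>i<?n. ennreal \<bar>\<phi> (x + real i *\<^sub>R ?z + ?z) - \<phi> (x + real i *\<^sub>R ?z)\<bar>)"
        by (rule sum_ennreal[symmetric]) simp
      finally show ?thesis .
    qed
    then have "?I \<le> (\<integral>\<^sup>+x. (\<Sum>i<?n. ennreal \<bar>\<phi> (x + real i *\<^sub>R ?z + ?z) - \<phi> (x + real i *\<^sub>R ?z)\<bar>) \<partial>lborel)"
      by (intro nn_integral_mono)
    also have "\<dots> = (\<Sum>i<?n. \<integral>\<^sup>+x. ennreal \<bar>\<phi> (x + real i *\<^sub>R ?z + ?z) - \<phi> (x + real i *\<^sub>R ?z)\<bar> \<partial>lborel)"
      by (intro nn_integral_sum) measurable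
    also have "\<dots> = (\<Sum>i<?n. \<integral>\<^sup>+x. ennreal \<bar>\<phi> (x + ?z) - \<phi> x\<bar> \<partial>lborel)"
      by (intro sum.cong refl nn_integral_translate[of "\<lambda>x. ennreal \<bar>\<phi> (x + ?z) - \<phi> x\<bar>"]) measurable
    also have "\<dots> = ennreal (real ?n) * (\<integral>\<^sup>+x. ennreal \<bar>\<phi> (x + ?z) - \<phi> x\<bar> \<partial>lborel)"
      by (simp only: sum_constant card_lessThan ennreal_of_nat_eq_real_of_nat)
    also have "\<dots> = (\<integral>\<^sup>+x. ennreal (real ?n) * ennreal \<bar>\<phi> (x + ?z) - \<phi> x\<bar> \<partial>lborel)"
      by (rule nn_integral_cmult[symmetric]) measurable
    also have "\<dots> = (\<integral>\<^sup>+x. ennreal \<bar>?Q m x\<bar> \<partial>lborel)"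
      by (simp add: ennreal_mult'[symmetric] abs_mult del: of_nat_Suc)
    finally show ?thesis .
  qed
  obtain w where w: "integrable lborel w" "\<And>m x. norm (?Q m x) \<le> w x"
    using difference_quotients_bounded_convergence(2)[OF \<phi>, of z] by blast
  have "(\<lambda>m. \<integral>\<^sup>+x. ennreal \<bar>?Q m x\<bar> \<partial>lborel) \<longlonglongrightarrow> (\<integral>\<^sup>+x. ennreal \<bar>grad \<phi> x \<bullet> z\<bar> \<partial>lborel)"
  proof (rule nn_integral_dominated_convergence[where w="\<lambda>x. ennreal (w x)"])
    have "integrable lborel (\<lambda>x. \<bar>w x\<bar>)" using w(1) by simp
    then have "(\<integral>\<^sup>+x. ennreal \<bar>w x\<bar> \<partial>lborel) < \<infinity>" by (simp add: integrable_iff_bounded)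
    moreover have "0 \<le> w x" for x using w(2)[of 0 x] norm_ge_zero order.trans by blast
    ultimately show "(\<integral>\<^sup>+x. ennreal (w x) \<partial>lborel) < \<infinity>" by simp
    show "(\<lambda>x. ennreal (w x)) \<in> borel_measurable lborel" using w(1) by measurable
    show "AE x in lborel. ennreal \<bar>?Q j x\<bar> \<le> ennreal (w x)" for j
      using w(2)[of j] by (intro AE_I2 ennreal_leI) simp
    show "AE x in lborel. (\<lambda>m. ennreal \<bar>?Q m x\<bar>) \<longlonglongrightarrow> ennreal \<bar>grad \<phi> x \<bullet> z\<bar>"
      by (intro AE_I2 tendsto_ennrealI tendsto_rabs difference_quotients_bounded_convergence(1)[OF \<phi>])
  qed measurable
  then have "?I \<le> (\<integral>\<^sup>+x. ennreal \<bar>grad \<phi> x \<bullet> z\<bar> \<partial>lborel)"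
    by (rule LIMSEQ_le_const) (use le in auto)
  also have "\<dots> \<le> (\<integral>\<^sup>+x. ennreal (norm z) * ennreal (norm (grad \<phi> x)) \<partial>lborel)"
    using Cauchy_Schwarz_ineq2[of "grad \<phi> _" z]
    by (intro nn_integral_mono) (simp add: ennreal_mult'[symmetric] mult.commute ennreal_leI)
  also have "\<dots> = ennreal (norm z) * (\<integral>\<^sup>+x. ennreal (norm (grad \<phi> x)) \<partial>lborel)"
    by (rule nn_integral_cmult) measurable
  finally show ?thesis .
qed

lemma nn_integral_lebesgue_on_eq_lborel:
  fixes f :: "real^'n \<Rightarrow> ennreal"
  assumes "\<Omega> \<in> sets lebesgue" "\<And>x. x \<notin> \<Omega> \<Longrightarrow> f x = 0"
  shows "(\<integral>\<^sup>+x. f x \<partial>lebesgue_on \<Omega>) = (\<integral>\<^sup>+x. f x \<partial>lborel)"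
proof -
  have "(\<integral>\<^sup>+x. f x \<partial>lebesgue_on \<Omega>) = (\<integral>\<^sup>+x. f x * indicator \<Omega> x \<partial>lebesgue)"
    using assms(1) by (subst nn_integral_restrict_space) auto
  also have "\<dots> = (\<integral>\<^sup>+x. f x \<partial>lebesgue)"
    using assms(2) by (intro nn_integral_cong) (auto simp: indicator_def)
  finally show ?thesis by (simp add: nn_integral_completion)
qed

context musielak
begin

text \<open>The function \<open>w\<close> is a Borel representative of the extension of \<open>v\<close> by zero. Borel measurability
  on the whole space is what makes \<open>w (x + z)\<close> jointly measurable later on.\<close>

lemma W10_space_translation_estimate:
  assumes v: "v \<in> W10_space \<Omega> G" and w [measurable]: "w \<in> borel_measurable borel"
    and eq: "AE x in lborel. w x = indicator \<Omega> x * v x"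
  shows "(\<integral>\<^sup>+x. ennreal \<bar>w (x + z) - w x\<bar> \<partial>lborel) \<le> ennreal (norm z * (LINT x|M. norm (weak_gradient \<Omega> v x)))"
proof -
  let ?V = "weak_gradient \<Omega> v"
  note vD = W1_space_D[OF W10_space_D[OF v]]
  obtain \<phi> where appr: "approximates \<phi> v ?V" using W10_space_approximates[OF v] by blast
  note a = approximates_L1[OF vD(1,2,4,5) appr] and int = approximates_integrable[OF vD(1,2,4,5) appr]
  have \<phi>: "\<phi> k \<in> test_functions \<Omega>" for k using appr by (simp add: approximates_def)
  have [measurable]: "\<phi> k \<in> borel_measurable borel" "grad (\<phi> k) \<in> borel_measurable borel" for k
    using test_functions_continuous[OF \<phi>] by (auto intro: borel_measurable_continuous_onI)
  let ?e = "\<lambda>k. LINT x|M. \<bar>v x - \<phi> k x\<bar>" and ?d = "\<lambda>k. LINT x|M. norm (?V x - grad (\<phi> k) x)"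
  let ?I = "LINT x|M. norm (?V x)"
  have dist: "(\<integral>\<^sup>+x. ennreal \<bar>w x - \<phi> k x\<bar> \<partial>lborel) = ennreal (?e k)" for k
  proof -
    have "(\<integral>\<^sup>+x. ennreal \<bar>w x - \<phi> k x\<bar> \<partial>lborel) = (\<integral>\<^sup>+x. ennreal \<bar>indicator \<Omega> x * v x - \<phi> k x\<bar> \<partial>lborel)"
      using eq by (intro nn_integral_cong_AE) (auto elim: eventually_mono)
    also have "\<dots> = (\<integral>\<^sup>+x. ennreal \<bar>indicator \<Omega> x * v x - \<phi> k x\<bar> \<partial>M)"
      by (rule nn_integral_lebesgue_on_eq_lborel[symmetric, OF sets_\<Omega>])
        (use test_functions_zero_outside[OF \<phi>] in simp)
    also have "\<dots> = (\<integral>\<^sup>+x. ennreal \<bar>v x - \<phi> k x\<bar> \<partial>M)"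
      by (intro nn_integral_cong) simp
    also have "\<dots> = ennreal (?e k)"
      using a(3)[of k] by (intro nn_integral_eq_integral) auto
    finally show ?thesis .
  qed
  have grad: "(\<integral>\<^sup>+x. ennreal (norm (grad (\<phi> k) x)) \<partial>lborel) \<le> ennreal (?I + ?d k)" for k
  proof -
    have z: "grad (\<phi> k) x = 0" if "x \<notin> \<Omega>" for x
      using partial_deriv_zero_outside[OF \<phi> that] by (simp add: grad_def vec_eq_iff)
    have "(\<integral>\<^sup>+x. ennreal (norm (grad (\<phi> k) x)) \<partial>lborel) = (\<integral>\<^sup>+x. ennreal (norm (grad (\<phi> k) x)) \<partial>M)"
      by (rule nn_integral_lebesgue_on_eq_lborel[symmetric, OF sets_\<Omega>]) (simp add: z)
    also have "\<dots> \<le> (\<integral>\<^sup>+x. ennreal (norm (?V x) + norm (?V x - grad (\<phi> k) x)) \<partial>M)"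
      using norm_triangle_sub[of "grad (\<phi> k) _" "?V _"]
      by (intro nn_integral_mono ennreal_leI) (simp add: norm_minus_commute)
    also have "\<dots> = ennreal (LINT x|M. norm (?V x) + norm (?V x - grad (\<phi> k) x))"
      using int a(4)[of k] by (intro nn_integral_eq_integral) auto
    also have "\<dots> = ennreal (?I + ?d k)" using int a(4)[of k] by simp
    finally show ?thesis .
  qed
  have "(\<integral>\<^sup>+x. ennreal \<bar>w (x + z) - w x\<bar> \<partial>lborel) \<le> ennreal (2 * ?e k + norm z * (?I + ?d k))" for k
  proof -
    have I0: "0 \<le> ?I" "0 \<le> ?d k" "0 \<le> ?e k" by (auto intro!: integral_nonneg_AE)
    have "(\<integral>\<^sup>+x. ennreal \<bar>w (x + z) - w x\<bar> \<partial>lborel) \<le> (\<integral>\<^sup>+x. (ennreal \<bar>w (x + z) - \<phi> k (x + z)\<bar> + ennreal \<bar>w x - \<phi> k x\<bar>) + ennreal \<bar>\<phi> k (x + z) - \<phi> k x\<bar> \<partial>lborel)"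
      by (intro nn_integral_mono) (simp add: ennreal_plus[symmetric] ennreal_leI del: ennreal_plus)
    also have "\<dots> = ((\<integral>\<^sup>+x. ennreal \<bar>w (x + z) - \<phi> k (x + z)\<bar> \<partial>lborel) + (\<integral>\<^sup>+x. ennreal \<bar>w x - \<phi> k x\<bar> \<partial>lborel)) + (\<integral>\<^sup>+x. ennreal \<bar>\<phi> k (x + z) - \<phi> k x\<bar> \<partial>lborel)"
      by (subst nn_integral_add; (subst nn_integral_add)?; measurable)
    also have "(\<integral>\<^sup>+x. ennreal \<bar>w (x + z) - \<phi> k (x + z)\<bar> \<partial>lborel) = ennreal (?e k)"
      by (subst nn_integral_translate[of "\<lambda>x. ennreal \<bar>w x - \<phi> k x\<bar>"]) (auto simp: dist)
    also have "(\<integral>\<^sup>+x. ennreal \<bar>w x - \<phi> k x\<bar> \<partial>lborel) = ennreal (?e k)" by (rule dist)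
    also have "(ennreal (?e k) + ennreal (?e k)) + (\<integral>\<^sup>+x. ennreal \<bar>\<phi> k (x + z) - \<phi> k x\<bar> \<partial>lborel)
        \<le> (ennreal (?e k) + ennreal (?e k)) + ennreal (norm z) * ennreal (?I + ?d k)"
      by (intro add_left_mono order.trans[OF test_function_translation_estimate[OF \<phi>]] mult_left_mono grad) simp
    also have "\<dots> = ennreal (2 * ?e k + norm z * (?I + ?d k))"
      using I0 by (simp add: ennreal_mult'[symmetric] ennreal_plus[symmetric] del: ennreal_plus)
    finally show ?thesis .
  qed
  moreover have "(\<lambda>k. ennreal (2 * ?e k + norm z * (?I + ?d k))) \<longlonglongrightarrow> ennreal (2 * 0 + norm z * (?I + 0))"
    by (intro tendsto_intros tendsto_ennrealI a)
  ultimately show ?thesis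
    by (intro LIMSEQ_le_const) auto
qed

text \<open>The difference of two excess functions has a gradient supported on \<open>k \<le> \<bar>u\<bar> < h\<close>, which
  localizes the translation estimate to that set. The smooth approximations pass to the limit by
  Fatou's lemma on the left and dominated convergence on the right.\<close>

lemma excess_translation_estimate:
  assumes u: "u \<in> W10_space \<Omega> G" and w [measurable]: "w \<in> borel_measurable borel"
    and eq: "AE x in lborel. w x = indicator \<Omega> x * u x" and kh: "0 < k" "k < h"
  defines "\<tau> \<equiv> \<lambda>t. excess k t - excess h t"
  shows "(\<integral>\<^sup>+x. ennreal \<bar>\<tau> (w (x + z)) - \<tau> (w x)\<bar> \<partial>lborel)
    \<le> ennreal (norm z * (LINT x|M. indicator {x \<in> space M. k \<le> \<bar>u x\<bar> \<and> \<bar>u x\<bar> < h} x * norm (weak_gradient \<Omega> u x)))"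
proof -
  let ?U = "weak_gradient \<Omega> u"
  note uD = W1_space_D[OF W10_space_D[OF u]]
  note [measurable] = uD(1,4)
  have intU: "integrable M (\<lambda>x. norm (?U x))"
    by (rule integrable_if_modular_finite(2)[OF measurable_compose[OF uD(4) borel_measurable_norm] uD(5)])
  let ?I = "LINT x|M. indicator {x \<in> space M. k \<le> \<bar>u x\<bar> \<and> \<bar>u x\<bar> < h} x * norm (?U x)"
  define T where "T j t = trunc j k t - trunc j h t" for j t
  define T' where "T' j t = trunc' j k t - trunc' j h t" for j t
  have der: "(T j has_real_derivative T' j t) (at t)" for j t
    unfolding T_def[abs_def] T'_def by (intro DERIV_diff has_real_derivative_trunc)
  have sm: "smooth_real (T j)" for j
    unfolding T_def[abs_def] by (intro smooth_real_diff smooth_real_trunc)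
  have bd: "\<bar>T' j t\<bar> \<le> 4" for j t
    using trunc'_bounds[of j k t] trunc'_bounds[of j h t] unfolding T'_def by linarith
  have T0: "T j 0 = 0" for j by (simp add: T_def trunc_0)
  have [measurable]: "T j \<in> borel_measurable borel" "T' j \<in> borel_measurable borel" for j
    unfolding T_def[abs_def] T'_def[abs_def] by measurable
  have est: "(\<integral>\<^sup>+x. ennreal \<bar>T j (w (x + z)) - T j (w x)\<bar> \<partial>lborel) \<le> ennreal (norm z * (LINT x|M. \<bar>T' j (u x)\<bar> * norm (?U x)))" for j
  proof -
    note comp = W10_space_compose[OF u sm T0 der bd, of j]
    have "AE x in lborel. T j (w x) = indicator \<Omega> x * T j (u x)"
      using eq by eventually_elim (auto simp: indicator_def T0)
    moreover have "(\<lambda>x. T j (w x)) \<in> borel_measurable borel" by measurable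
    ultimately have "(\<integral>\<^sup>+x. ennreal \<bar>T j (w (x + z)) - T j (w x)\<bar> \<partial>lborel)
        \<le> ennreal (norm z * (LINT x|M. norm (weak_gradient \<Omega> (\<lambda>x. T j (u x)) x)))"
      using W10_space_translation_estimate[OF comp(1), of "\<lambda>x. T j (w x)" z] by simp
    also have "(LINT x|M. norm (weak_gradient \<Omega> (\<lambda>x. T j (u x)) x)) = (LINT x|M. \<bar>T' j (u x)\<bar> * norm (?U x))"
    proof (rule integral_cong_AE)
      show "AE x in M. norm (weak_gradient \<Omega> (\<lambda>x. T j (u x)) x) = \<bar>T' j (u x)\<bar> * norm (?U x)"
        using comp(2) by eventually_elim simp
      show "(\<lambda>x. norm (weak_gradient \<Omega> (\<lambda>x. T j (u x)) x)) \<in> borel_measurable M"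
        by (rule measurable_compose[OF W1_space_D(4)[OF W10_space_D[OF comp(1)]] borel_measurable_norm])
      show "(\<lambda>x. \<bar>T' j (u x)\<bar> * norm (?U x)) \<in> borel_measurable M" by measurable
    qed
    finally show ?thesis .
  qed
  have Tlim: "(\<lambda>j. T j t) \<longlonglongrightarrow> \<tau> t" for t
    unfolding T_def \<tau>_def by (intro tendsto_diff trunc_limit)
  have T'lim: "(\<lambda>j. T' j t) \<longlonglongrightarrow> (if k \<le> \<bar>t\<bar> \<and> \<bar>t\<bar> < h then 1 else 0)" for t
  proof -
    have "(\<lambda>j. T' j t) \<longlonglongrightarrow> (if k \<le> \<bar>t\<bar> then 1 else 0) - (if h \<le> \<bar>t\<bar> then 1 else 0)"
      unfolding T'_def using kh by (intro tendsto_diff trunc'_limit) auto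
    also have "(if k \<le> \<bar>t\<bar> then 1 else 0) - (if h \<le> \<bar>t\<bar> then 1 else 0) = (if k \<le> \<bar>t\<bar> \<and> \<bar>t\<bar> < h then 1 else (0::real))"
      using kh by auto
    finally show ?thesis .
  qed
  have "(\<lambda>j. LINT x|M. \<bar>T' j (u x)\<bar> * norm (?U x)) \<longlonglongrightarrow> ?I"
  proof (rule integral_dominated_convergence[where w="\<lambda>x. 4 * norm (?U x)"])
    show "AE x in M. (\<lambda>j. \<bar>T' j (u x)\<bar> * norm (?U x)) \<longlonglongrightarrow>
        indicator {x \<in> space M. k \<le> \<bar>u x\<bar> \<and> \<bar>u x\<bar> < h} x * norm (?U x)"
    proof (rule AE_I2)
      fix x assume "x \<in> space M"
      then show "(\<lambda>j. \<bar>T' j (u x)\<bar> * norm (?U x)) \<longlonglongrightarrow>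
        indicator {x \<in> space M. k \<le> \<bar>u x\<bar> \<and> \<bar>u x\<bar> < h} x * norm (?U x)"
        using tendsto_mult_right[OF tendsto_rabs[OF T'lim[of "u x"]], of "norm (?U x)"]
        by (auto simp: indicator_def split: if_splits)
    qed
    show "AE x in M. norm (\<bar>T' j (u x)\<bar> * norm (?U x)) \<le> 4 * norm (?U x)" for j
      using bd by (intro AE_I2) (simp add: abs_mult mult_right_mono)
  qed (use intU in \<open>measurable, simp\<close>)
  then have "(\<lambda>j. ennreal (norm z * (LINT x|M. \<bar>T' j (u x)\<bar> * norm (?U x)))) \<longlonglongrightarrow> ennreal (norm z * ?I)"
    by (intro tendsto_ennrealI tendsto_mult_left)
  then have lim: "liminf (\<lambda>j. ennreal (norm z * (LINT x|M. \<bar>T' j (u x)\<bar> * norm (?U x)))) = ennreal (norm z * ?I)"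
    by (rule lim_imp_Liminf[OF sequentially_bot])
  have "(\<integral>\<^sup>+x. ennreal \<bar>\<tau> (w (x + z)) - \<tau> (w x)\<bar> \<partial>lborel)
      = (\<integral>\<^sup>+x. liminf (\<lambda>j. ennreal \<bar>T j (w (x + z)) - T j (w x)\<bar>) \<partial>lborel)"
    by (intro nn_integral_cong lim_imp_Liminf[OF sequentially_bot, symmetric] tendsto_ennrealI tendsto_rabs tendsto_diff Tlim)
  also have "\<dots> \<le> liminf (\<lambda>j. \<integral>\<^sup>+x. ennreal \<bar>T j (w (x + z)) - T j (w x)\<bar> \<partial>lborel)"
    by (rule nn_integral_liminf) measurable
  also have "\<dots> \<le> liminf (\<lambda>j. ennreal (norm z * (LINT x|M. \<bar>T' j (u x)\<bar> * norm (?U x))))"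
    by (intro Liminf_mono always_eventually allI est)
  finally show ?thesis unfolding lim .
qed

text \<open>Average the translation estimate over \<open>z\<close> in a ball of volume twice that of
  \<open>{k \<le> \<bar>u\<bar>}\<close>. For \<open>x\<close> with \<open>h \<le> \<bar>u x\<bar>\<close>, the points \<open>x + z\<close> with \<open>k \<le> \<bar>u (x + z)\<bar>\<close> fill at most half of the
  ball, and at the others the truncated function differs by \<open>h - k\<close> from its value at \<open>x\<close>.\<close>

lemma level_set_inequality:
  assumes u: "u \<in> W10_space \<Omega> G" and kh: "0 < k" "k < h"
  shows "(h - k) * measure M {x \<in> space M. h \<le> \<bar>u x\<bar>}
    \<le> 2 * (2 / unit_ball_vol (real CARD('n))) powr (1 / real CARD('n))
        * measure M {x \<in> space M. k \<le> \<bar>u x\<bar>} powr (1 / real CARD('n))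
        * (LINT x|M. indicator {x \<in> space M. k \<le> \<bar>u x\<bar> \<and> \<bar>u x\<bar> < h} x * norm (weak_gradient \<Omega> u x))"
proof -
  note uD = W1_space_D[OF W10_space_D[OF u]]
  note [measurable] = uD(1)
  let ?I = "LINT x|M. indicator {x \<in> space M. k \<le> \<bar>u x\<bar> \<and> \<bar>u x\<bar> < h} x * norm (weak_gradient \<Omega> u x)"
  let ?m = "\<lambda>k. measure M {x \<in> space M. k \<le> \<bar>u x\<bar>}"
  let ?n = "real CARD('n)" and ?\<omega> = "unit_ball_vol (real CARD('n))"
  have I0: "0 \<le> ?I" by (intro integral_nonneg_AE) auto
  show ?thesis
  proof (cases "?m k = 0")
    case True
    have "?m h \<le> ?m k"
    proof (rule finite_measure_mono)
      show "{x \<in> space M. h \<le> \<bar>u x\<bar>} \<subseteq> {x \<in> space M. k \<le> \<bar>u x\<bar>}" using kh by auto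
    qed measurable
    with True have "?m h = 0" using measure_nonneg[of M] by (simp add: order_antisym)
    then show ?thesis using True by simp
  next
    case False
    then have mk: "0 < ?m k" by (simp add: zero_less_measure_iff)
    have "(\<lambda>x. indicator \<Omega> x * u x) \<in> borel_measurable lebesgue"
      using uD(1) sets_\<Omega> by (subst (asm) borel_measurable_restrict_space_iff) auto
    then obtain w where w [measurable]: "w \<in> borel_measurable borel"
      and eq: "AE x in lborel. w x = indicator \<Omega> x * u x"
      using completion_ex_borel_measurable_real[of "\<lambda>x. indicator \<Omega> x * u x" lborel] by (auto simp: eq_commute)
    have meas: "emeasure lborel {x. l \<le> \<bar>w x\<bar>} = ennreal (?m l)" if "0 < l" for l
    proof -
      have "emeasure lborel {x. l \<le> \<bar>w x\<bar>} = (\<integral>\<^sup>+x. indicator {x. l \<le> \<bar>w x\<bar>} x \<partial>lborel)"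
        by (rule nn_integral_indicator[symmetric]) simp
      also have "\<dots> = (\<integral>\<^sup>+x. indicator {x \<in> space M. l \<le> \<bar>u x\<bar>} x \<partial>lborel)"
      proof (rule nn_integral_cong_AE)
        show "AE x in lborel. indicator {x. l \<le> \<bar>w x\<bar>} x = (indicator {x \<in> space M. l \<le> \<bar>u x\<bar>} x :: ennreal)"
          using eq
        proof eventually_elim
          case (elim x)
          then show ?case using \<open>0 < l\<close> by (cases "x \<in> \<Omega>") (auto simp: indicator_def)
        qed
      qed
      also have "\<dots> = (\<integral>\<^sup>+x. indicator {x \<in> space M. l \<le> \<bar>u x\<bar>} x \<partial>M)"
        by (rule nn_integral_lebesgue_on_eq_lborel[symmetric, OF sets_\<Omega>]) simp
      also have "\<dots> = emeasure M {x \<in> space M. l \<le> \<bar>u x\<bar>}"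
        by (rule nn_integral_indicator) measurable
      finally show ?thesis by (simp add: emeasure_eq_measure)
    qed
    define \<tau> where "\<tau> t = excess k t - excess h t" for t
    have [measurable]: "\<tau> \<in> borel_measurable borel" unfolding \<tau>_def excess_def by measurable
    have \<tau>0: "\<tau> t = 0" if "\<not> k \<le> \<bar>t\<bar>" for t
      using that kh by (auto simp: \<tau>_def excess_def)
    have \<tau>h: "\<bar>\<tau> t\<bar> = h - k" if "h \<le> \<bar>t\<bar>" for t
      using that kh by (auto simp: \<tau>_def excess_def abs_if split: if_splits)
    \<comment> \<open>the radius of a ball of volume \<open>2 * ?m k\<close>\<close>
    define r where "r = (2 * ?m k / ?\<omega>) powr (1 / ?n)"
    have \<omega>: "0 < ?\<omega>" by simp
    then have \<omega>0: "?\<omega> \<noteq> 0" by linarith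
    have r: "0 < r" using mk \<omega>0 by (simp add: r_def)
    have [measurable]: "ball (0::real^'n) r \<in> sets borel" by simp
    have vol: "emeasure lborel (ball (0::real^'n) r) = ennreal (2 * ?m k)"
    proof -
      have "r ^ CARD('n) = 2 * ?m k / ?\<omega>"
      proof -
        have "r ^ CARD('n) = r powr ?n" using r by (simp add: powr_realpow)
        also have "\<dots> = 2 * ?m k / ?\<omega>" using mk \<omega> unfolding r_def powr_powr by simp
        finally show ?thesis .
      qed
      then show ?thesis using r emeasure_ball[of r "0::real^'n"] \<omega>0 by simp
    qed
    let ?f = "\<lambda>z x. ennreal \<bar>\<tau> (w (x + z)) - \<tau> (w x)\<bar>"
    let ?B = "ball (0::real^'n) r"
    have "(\<integral>\<^sup>+x. (\<integral>\<^sup>+z. ?f z x * indicator ?B z \<partial>lborel) \<partial>lborel) = (\<integral>\<^sup>+z. (\<integral>\<^sup>+x. ?f z x * indicator ?B z \<partial>lborel) \<partial>lborel)"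
      by (rule lborel_pair.Fubini') measurable
    also have "\<dots> \<le> (\<integral>\<^sup>+z. ennreal (r * ?I) * indicator ?B z \<partial>lborel)"
    proof (rule nn_integral_mono)
      fix z :: "real^'n"
      show "(\<integral>\<^sup>+x. ?f z x * indicator ?B z \<partial>lborel) \<le> ennreal (r * ?I) * indicator ?B z"
      proof (cases "z \<in> ?B")
        case True
        have "(\<integral>\<^sup>+x. ?f z x \<partial>lborel) \<le> ennreal (norm z * ?I)"
          using excess_translation_estimate[OF u w eq kh] by (simp add: \<tau>_def)
        also have "\<dots> \<le> ennreal (r * ?I)" using True I0 by (intro ennreal_leI mult_right_mono) auto
        finally show ?thesis using True by simp
      qed simp
    qed
    also have "\<dots> = ennreal (r * ?I) * ennreal (2 * ?m k)"
      by (subst nn_integral_cmult_indicator) (auto simp: vol)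
    finally have upper: "(\<integral>\<^sup>+x. (\<integral>\<^sup>+z. ?f z x * indicator ?B z \<partial>lborel) \<partial>lborel) \<le> ennreal (r * ?I) * ennreal (2 * ?m k)" .
    have inner: "ennreal ((h - k) * ?m k) \<le> (\<integral>\<^sup>+z. ?f z x * indicator ?B z \<partial>lborel)" if x: "h \<le> \<bar>w x\<bar>" for x
    proof -
      let ?S = "{z. k \<le> \<bar>w (x + z)\<bar>}"
      have "emeasure lborel ?S = (\<integral>\<^sup>+z. indicator {y. k \<le> \<bar>w y\<bar>} (z + x) \<partial>lborel)"
      proof -
        have "emeasure lborel ?S = (\<integral>\<^sup>+z. indicator ?S z \<partial>lborel)"
          by (rule nn_integral_indicator[symmetric]) measurable
        also have "\<dots> = (\<integral>\<^sup>+z. indicator {y. k \<le> \<bar>w y\<bar>} (z + x) \<partial>lborel)"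
          by (intro nn_integral_cong) (simp add: indicator_def add.commute)
        finally show ?thesis .
      qed
      also have "\<dots> = (\<integral>\<^sup>+z. indicator {y. k \<le> \<bar>w y\<bar>} z \<partial>lborel)"
        by (rule nn_integral_translate) measurable
      also have "\<dots> = ennreal (?m k)" using kh by (subst nn_integral_indicator) (auto simp: meas)
      finally have S: "emeasure lborel ?S = ennreal (?m k)" .
      have "ennreal (2 * ?m k) \<le> emeasure lborel (?B - ?S) + emeasure lborel ?S"
      proof -
        have "emeasure lborel ?B \<le> emeasure lborel ((?B - ?S) \<union> ?S)" by (intro emeasure_mono) auto
        also have "\<dots> \<le> emeasure lborel (?B - ?S) + emeasure lborel ?S" by (intro emeasure_subadditive) auto
        finally show ?thesis by (simp add: vol)
      qed
      also have "ennreal (2 * ?m k) = ennreal (?m k) + ennreal (?m k)"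
        by (simp add: ennreal_plus[symmetric] del: ennreal_plus)
      finally have BS: "ennreal (?m k) \<le> emeasure lborel (?B - ?S)"
        unfolding S by (simp add: ennreal_add_left_cancel_le add.commute)
      have "ennreal ((h - k) * ?m k) = ennreal (h - k) * ennreal (?m k)" using kh by (simp add: ennreal_mult')
      also have "\<dots> \<le> ennreal (h - k) * emeasure lborel (?B - ?S)" by (intro mult_left_mono BS) simp
      also have "\<dots> = (\<integral>\<^sup>+z. ennreal (h - k) * indicator (?B - ?S) z \<partial>lborel)"
        by (rule nn_integral_cmult_indicator[symmetric]) measurable
      also have "\<dots> \<le> (\<integral>\<^sup>+z. ?f z x * indicator ?B z \<partial>lborel)"
        using \<tau>h[OF x] \<tau>0 by (intro nn_integral_mono) (auto simp: indicator_def)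
      finally show ?thesis .
    qed
    have "ennreal ((h - k) * ?m k) * ennreal (?m h) = (\<integral>\<^sup>+x. ennreal ((h - k) * ?m k) * indicator {x. h \<le> \<bar>w x\<bar>} x \<partial>lborel)"
      using kh by (subst nn_integral_cmult_indicator) (auto simp: meas)
    also have "\<dots> \<le> (\<integral>\<^sup>+x. (\<integral>\<^sup>+z. ?f z x * indicator ?B z \<partial>lborel) \<partial>lborel)"
      using inner by (intro nn_integral_mono) (auto simp: indicator_def)
    also note upper
    finally have "ennreal ((h - k) * ?m k * ?m h) \<le> ennreal (r * ?I * (2 * ?m k))"
      using kh r I0 by (simp add: ennreal_mult'[symmetric])
    then have "(h - k) * ?m k * ?m h \<le> r * ?I * (2 * ?m k)"
      using r I0 by (subst (asm) ennreal_le_iff) auto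
    then have "?m k * ((h - k) * ?m h) \<le> ?m k * (2 * r * ?I)" by (simp add: mult_ac)
    then have "(h - k) * ?m h \<le> 2 * r * ?I" using mk by simp
    also have "r = (2 / ?\<omega>) powr (1 / ?n) * ?m k powr (1 / ?n)"
      using mk unfolding r_def by (subst powr_mult[symmetric]) auto
    finally show ?thesis by (simp add: mult_ac)
  qed
qed

end

section \<open>From level set estimates to boundedness\<close>

text \<open>Hoelder's inequality for \<open>d\<close> and the indicator of \<open>S\<close>: integrate Young's inequality for
  \<open>d x / l\<close> and choose \<open>l\<close> optimally.\<close>

lemma finite_measure_Hoelder_set:
  fixes d :: "'a \<Rightarrow> real"
  assumes "finite_measure M" and [measurable]: "d \<in> borel_measurable M" "S \<in> sets M"
    and d: "\<And>x. 0 \<le> d x" and p: "1 < p" and int: "integrable M (\<lambda>x. d x powr p)"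
  shows "(LINT x|M. indicator S x * d x)
    \<le> measure M S powr (1 - 1 / p) * (LINT x|M. indicator S x * d x powr p) powr (1 / p)"
proof -
  interpret finite_measure M by fact
  let ?s = "measure M S" and ?I = "LINT x|M. indicator S x * d x powr p"
  have intS: "integrable M (\<lambda>x. indicator S x * d x powr p)"
    using integrable_real_mult_indicator[OF assms(3) int] by (simp add: mult.commute)
  have Young: "t \<le> (1 - 1 / p) + t powr p / p" if "0 \<le> t" for t
    using Youngs_inequality[of p "p / (p - 1)" t 1] p that by (simp add: field_simps)
  have bound: "(LINT x|M. indicator S x * d x) \<le> l * ((1 - 1 / p) * ?s + ?I / (p * l powr p))"
    if l: "l > 0" for l
  proof -
    have "indicator S x * d x \<le> l * ((1 - 1 / p) * indicator S x + indicator S x * d x powr p / (p * l powr p))" for x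
    proof -
      have "d x = l * (d x / l)" using l by simp
      also have "\<dots> \<le> l * ((1 - 1 / p) + (d x / l) powr p / p)"
        using Young[of "d x / l"] l d[of x] by (intro mult_left_mono) auto
      also have "\<dots> = l * ((1 - 1 / p) + d x powr p / (p * l powr p))"
        using l d[of x] by (simp add: powr_divide)
      finally show ?thesis by (simp add: indicator_def)
    qed
    moreover have intI: "integrable M (indicator S :: 'a \<Rightarrow> real)"
      by (auto simp: less_top[symmetric])
    moreover have "integrable M (\<lambda>x. l * ((1 - 1 / p) * indicator S x + indicator S x * d x powr p / (p * l powr p)))"
      by (intro integrable_mult_right Bochner_Integration.integrable_add integrable_divide intS intI)
    ultimately have "(LINT x|M. indicator S x * d x)
      \<le> (LINT x|M. l * ((1 - 1 / p) * indicator S x + indicator S x * d x powr p / (p * l powr p)))"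
      using l p by (intro integral_mono') (auto simp: d intro!: divide_nonneg_nonneg)
    also have "\<dots> = l * ((1 - 1 / p) * ?s + ?I / (p * l powr p))"
      using intS intI by (simp add: Bochner_Integration.integral_add)
    finally show ?thesis .
  qed
  have I0: "0 \<le> ?I" by (intro integral_nonneg_AE) auto
  consider "?s = 0" | "?I = 0" | "?s > 0" "?I > 0"
    using I0 zero_less_measure_iff[of M S] by linarith
  then show ?thesis
  proof cases
    case 1
    then have "AE x in M. x \<notin> S"
      by (intro AE_not_in) (auto simp: null_sets_def emeasure_eq_measure)
    then have "(LINT x|M. indicator S x * d x) = 0"
      by (intro integral_eq_zero_AE) auto
    then show ?thesis by simp
  next
    case 2
    have "(LINT x|M. indicator S x * d x) \<le> 0 + e" if "e > 0" for e
    proof -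
      let ?l = "e / (?s + 1)"
      have "(LINT x|M. indicator S x * d x) \<le> ?l * ((1 - 1 / p) * ?s)"
        using bound[of ?l] that 2 by (simp add: add_nonneg_pos)
      also have "\<dots> \<le> ?l * (1 * (?s + 1))"
        using p that by (intro mult_left_mono mult_mono) (auto simp: add_nonneg_pos)
      also have "\<dots> = e" using measure_nonneg[of M S] by (simp add: add_nonneg_eq_0_iff)
      finally show ?thesis by simp
    qed
    then have "(LINT x|M. indicator S x * d x) \<le> 0" by (rule field_le_epsilon)
    with 2 show ?thesis by simp
  next
    case 3
    let ?l = "(?I / ?s) powr (1 / p)"
    have lp: "?l powr p = ?I / ?s" using 3 p by (simp add: powr_powr)
    have "(LINT x|M. indicator S x * d x) \<le> ?l * ((1 - 1 / p) * ?s + ?I / (p * ?l powr p))"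
      using 3 by (intro bound) simp
    also have "\<dots> = ?l * ?s"
      unfolding lp using 3 p by (simp add: field_simps)
    also have "\<dots> = ?s powr (1 - 1 / p) * ?I powr (1 / p)"
      using 3 p by (simp add: powr_divide powr_diff)
    finally show ?thesis .
  qed
qed

text \<open>A small enough first term forces geometric decay. The ratio \<open>r = 2 powr - n\<close> is chosen so that
  \<open>(r ^ j) powr (1 / n)\<close> cancels the factor \<open>2 ^ j\<close>.\<close>

lemma powr_superlinear_recursion_tendsto_0:
  fixes Y :: "nat \<Rightarrow> real"
  assumes Y0: "\<And>j. 0 \<le> Y j" and n: "n > 0" and A: "A > 0"
    and rec: "\<And>j. Y (Suc j) \<le> A * 2 ^ j * Y j powr (1 + 1 / n)"
    and small: "Y 0 \<le> (2 powr - n / A) powr n"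
  shows "Y \<longlonglongrightarrow> 0"
proof -
  define r :: real where "r = 2 powr - n"
  have r: "0 < r" "r < 1" using n by (simp_all add: r_def powr_minus_divide)
  have "A * Y 0 powr (1 / n) \<le> A * ((r / A) powr n) powr (1 / n)"
    using small Y0 A n by (intro mult_left_mono powr_mono2) (auto simp: r_def)
  also have "\<dots> = r" using A n r by (simp add: powr_powr)
  finally have Ar: "A * Y 0 powr (1 / n) \<le> r" .
  have le: "Y j \<le> Y 0 * r ^ j" for j
  proof (induction j)
    case (Suc j)
    have rj: "(r ^ j) powr (1 / n) = (1/2) ^ j"
    proof -
      have "(r ^ j) powr (1 / n) = (r powr (1 / n)) ^ j"
        using r by (simp add: powr_power powr_powr powr_realpow[symmetric] mult.commute)
      also have "r powr (1 / n) = 1 / 2" unfolding r_def powr_powr using n by (simp add: powr_minus)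
      finally show ?thesis .
    qed
    have "Y (Suc j) \<le> A * 2 ^ j * (Y 0 * r ^ j) powr (1 + 1 / n)"
      using Suc A n Y0 by (intro order.trans[OF rec] mult_left_mono powr_mono2) auto
    also have "\<dots> = (A * Y 0 powr (1 / n)) * (Y 0 * r ^ j) * (2 ^ j * (r ^ j) powr (1 / n))"
      using Y0[of 0] r by (cases "Y 0 = 0") (simp_all add: powr_add powr_mult)
    also have "\<dots> = (A * Y 0 powr (1 / n)) * (Y 0 * r ^ j)"
      by (simp add: rj power_divide)
    also have "\<dots> \<le> r * (Y 0 * r ^ j)"
      using Ar Y0 r by (intro mult_right_mono) auto
    finally show ?case by (simp add: mult_ac)
  qed simp
  have "(\<lambda>j. Y 0 * r ^ j) \<longlonglongrightarrow> Y 0 * 0"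
    using r by (intro tendsto_intros LIMSEQ_power_zero) auto
  then have lim: "(\<lambda>j. Y 0 * r ^ j) \<longlonglongrightarrow> 0" by simp
  show ?thesis
    by (rule tendsto_sandwich[OF _ _ tendsto_const lim]) (use Y0 le in auto)
qed

text \<open>The real variable part of the argument, with \<open>w\<close> for \<open>\<bar>u\<bar>\<close> and \<open>d\<close> for \<open>\<bar>Du\<bar>\<close>. The level set
  inequality is all that it knows about the relation between the two.\<close>

locale critical_levels = finite_measure M for M :: "'a measure" +
  fixes w d :: "'a \<Rightarrow> real" and p q n C :: real
  assumes w_meas [measurable]: "w \<in> borel_measurable M" and d_meas [measurable]: "d \<in> borel_measurable M"
    and w_nonneg: "\<And>x. 0 \<le> w x" and d_nonneg: "\<And>x. 0 \<le> d x"
    and p_gt_1: "1 < p" and p_less_n: "p < n" and q_def: "q = n * p / (n - p)"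
    and C_pos: "0 < C"
    and int_dp: "integrable M (\<lambda>x. d x powr p)"
    and level: "\<And>k h. 0 < k \<Longrightarrow> k < h \<Longrightarrow>
      (h - k) * measure M {x \<in> space M. h \<le> w x}
        \<le> C * measure M {x \<in> space M. k \<le> w x} powr (1 / n)
            * (LINT x|M. indicator {x \<in> space M. k \<le> w x \<and> w x < h} x * d x)"
begin

definition m :: "real \<Rightarrow> real" where "m k = measure M {x \<in> space M. k \<le> w x}"

definition energy :: "real \<Rightarrow> real \<Rightarrow> real" where
  "energy k h = (LINT x|M. indicator {x \<in> space M. k \<le> w x \<and> w x < h} x * d x powr p)"

definition tail :: "('a \<Rightarrow> real) \<Rightarrow> real \<Rightarrow> real" where
  "tail f k = (LINT x|M. indicator {x \<in> space M. k \<le> w x} x * f x)"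

lemma q_gt: "1 < q" "p < q" and q_exponents: "1 / n + (1 - 1 / p) = 1 - 1 / q" "1 / p = 1 / q + 1 / n"
proof -
  have n: "1 < n" "0 < n - p" using p_gt_1 p_less_n by auto
  have "p * (n - p) < n * p" using n p_gt_1 by (simp add: algebra_simps)
  then show "p < q" using n by (simp add: q_def field_simps)
  with p_gt_1 show "1 < q" by simp
  have "1 / q = 1 / p - 1 / n" unfolding q_def using n p_gt_1 by (simp add: field_simps)
  then show "1 / n + (1 - 1 / p) = 1 - 1 / q" "1 / p = 1 / q + 1 / n" by simp_all
qed

lemma m_nonneg: "0 \<le> m k" by (simp add: m_def)

lemma m_antimono: "k \<le> h \<Longrightarrow> m h \<le> m k"
  unfolding m_def by (intro finite_measure_mono) auto

lemma integrable_indicator_times: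
  "integrable M f \<Longrightarrow> Measurable.pred M P \<Longrightarrow> integrable M (\<lambda>x. indicator {x \<in> space M. P x} x * f x)"
  for f :: "'a \<Rightarrow> real"
  using integrable_real_mult_indicator[of "{x \<in> space M. P x}" M f] by (simp add: mult.commute)

lemma energy_nonneg: "0 \<le> energy k h"
  unfolding energy_def by (intro integral_nonneg_AE) auto

lemma energy_le_tail: "energy k h \<le> tail (\<lambda>x. d x powr p) k"
  unfolding energy_def tail_def
  by (intro integral_mono integrable_indicator_times int_dp) (auto simp: indicator_def)

lemma energy_add:
  assumes "k \<le> h" "h \<le> l"
  shows "energy k h + energy h l = energy k l"
proof -
  have i: "integrable M (\<lambda>x. indicator {x \<in> space M. k \<le> w x \<and> w x < h} x * d x powr p)" for k h
    by (intro integrable_indicator_times int_dp) measurable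
  show ?thesis
    unfolding energy_def Bochner_Integration.integral_add[OF i i, symmetric]
    by (rule Bochner_Integration.integral_cong) (use assms in \<open>auto simp: indicator_def\<close>)
qed

lemma tail_tendsto_0:
  assumes "integrable M f"
  shows "(tail f \<longlongrightarrow> 0) at_top"
proof -
  have "((\<lambda>k. LINT x|M. indicator {x \<in> space M. k \<le> w x} x * f x) \<longlongrightarrow> (LINT x|M. 0)) at_top"
  proof (rule integral_dominated_convergence_at_top[where w="\<lambda>x. norm (f x)"])
    show "AE x in M. ((\<lambda>k. indicator {x \<in> space M. k \<le> w x} x * f x) \<longlongrightarrow> 0) at_top"
    proof (rule AE_I2)
      fix x
      show "((\<lambda>k. indicator {x \<in> space M. k \<le> w x} x * f x) \<longlongrightarrow> 0) at_top"
        by (rule tendsto_eventually, rule eventually_mono[OF eventually_gt_at_top[of "w x"]])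
          (auto simp: indicator_def)
    qed
  qed (use assms in \<open>auto simp: indicator_def\<close>)
  then show ?thesis by (simp add: tail_def[abs_def])
qed

lemma level_energy:
  assumes "0 < k" "k < h"
  shows "(h - k) * m h \<le> C * m k powr (1 - 1 / q) * energy k h powr (1 / p)"
proof -
  let ?S = "{x \<in> space M. k \<le> w x \<and> w x < h}"
  have "(h - k) * m h \<le> C * m k powr (1 / n) * (LINT x|M. indicator ?S x * d x)"
    using level[OF assms] by (simp add: m_def)
  also have "\<dots> \<le> C * m k powr (1 / n) * (measure M ?S powr (1 - 1 / p) * energy k h powr (1 / p))"
    unfolding energy_def using C_pos
    by (intro mult_left_mono finite_measure_Hoelder_set finite_measure_axioms d_nonneg p_gt_1 int_dp) auto
  also have "\<dots> \<le> C * m k powr (1 / n) * (m k powr (1 - 1 / p) * energy k h powr (1 / p))"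
    using C_pos p_gt_1 unfolding m_def
    by (intro mult_left_mono mult_right_mono powr_mono2 finite_measure_mono) auto
  also have "\<dots> = C * m k powr (1 - 1 / q) * energy k h powr (1 / p)"
    by (simp add: q_exponents(1)[symmetric] powr_add)
  finally show ?thesis .
qed

text \<open>A form of Young's inequality: either \<open>X\<close> is at most half of \<open>a powr (1 / q)\<close>, or \<open>a\<close> is bounded by
  a power of \<open>X\<close>.\<close>

lemma absorb_powr:
  fixes X a :: real
  assumes "0 \<le> X" "0 \<le> a"
  shows "X * a powr (1 - 1 / q) \<le> a / 2 + (2 * X) powr q"
proof (cases "X \<le> a powr (1 / q) / 2")
  case True
  have "X * a powr (1 - 1 / q) \<le> a powr (1 / q) / 2 * a powr (1 - 1 / q)"
    using True by (intro mult_right_mono) auto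
  also have "\<dots> = a / 2"
    using assms by (cases "a = 0") (simp_all add: powr_add[symmetric])
  finally show ?thesis by (simp add: add_increasing2)
next
  case False
  have "a = (a powr (1 / q)) powr q" using assms q_gt by (cases "a = 0") (simp_all add: powr_powr)
  also have "\<dots> \<le> (2 * X) powr q" using False q_gt by (intro powr_mono2) auto
  finally have a: "a \<le> (2 * X) powr q" .
  have "a powr (1 - 1 / q) \<le> ((2 * X) powr q) powr (1 - 1 / q)"
    using a assms q_gt by (intro powr_mono2) auto
  also have "\<dots> = (2 * X) powr (q - 1)"
    using q_gt by (simp add: powr_powr right_diff_distrib)
  finally have "X * a powr (1 - 1 / q) \<le> (2 * X) * (2 * X) powr (q - 1)"
    using assms by (intro mult_mono) auto
  also have "\<dots> = (2 * X) powr q"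
    using assms by (cases "X = 0") (simp_all add: powr_diff)
  finally show ?thesis using assms by simp
qed

definition D :: real where "D = (2 * (C * 2 powr q)) powr q"

text \<open>Multiplied by the appropriate power of \<open>t\<close>, the level set inequality becomes scale
  invariant, because \<open>q\<close> is the Sobolev exponent.\<close>

lemma dyadic_step:
  assumes t: "0 < t"
  shows "(2 * t) powr q * m (2 * t) \<le> (t powr q * m t) / 2 + D * energy t (2 * t) powr (q / p)"
proof -
  let ?e = "energy t (2 * t) powr (1 / p)"
  have "(2 * t) powr q * m (2 * t) = 2 powr q * t powr (q - 1) * ((2 * t - t) * m (2 * t))"
    using t by (simp add: powr_mult powr_diff)
  also have "\<dots> \<le> 2 powr q * t powr (q - 1) * (C * m t powr (1 - 1 / q) * ?e)"
    using t by (intro mult_left_mono level_energy) auto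
  also have "\<dots> = (C * 2 powr q * ?e) * (t powr q * m t) powr (1 - 1 / q)"
    using t m_nonneg q_gt by (simp add: powr_mult powr_powr right_diff_distrib)
  also have "\<dots> \<le> (t powr q * m t) / 2 + (2 * (C * 2 powr q * ?e)) powr q"
    using C_pos m_nonneg by (intro absorb_powr) auto
  also have "(2 * (C * 2 powr q * ?e)) powr q = D * ?e powr q"
    using C_pos unfolding D_def by (subst powr_mult[symmetric]) (auto simp: mult_ac)
  also have "?e powr q = energy t (2 * t) powr (q / p)"
    by (simp add: powr_powr)
  finally show ?thesis .
qed

text \<open>The halved terms of \<open>dyadic_step\<close> are absorbed by telescoping. The energies of the dyadic layers
  add up to at most the energy above level \<open>k\<close>, hence their powers \<open>q / p > 1\<close> to at most that
  power of it.\<close>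

lemma dyadic_sum:
  assumes k: "0 < k"
  defines "a \<equiv> \<lambda>j. (2 ^ j * k) powr q * m (2 ^ j * k)"
  shows "(\<Sum>j<J. a j) \<le> 2 * k powr q * m k + 2 * D * tail (\<lambda>x. d x powr p) k powr (q / p)"
proof -
  let ?E = "tail (\<lambda>x. d x powr p) k"
  define b where "b j = energy (2 ^ j * k) (2 ^ Suc j * k)" for j :: nat
  have k2: "k \<le> 2 ^ j * k" for j :: nat using k by simp
  have b0: "0 \<le> b j" for j by (simp add: b_def energy_nonneg)
  have sum_b: "(\<Sum>j<J. b j) = energy k (2 ^ J * k)" for J
  proof (induction J)
    case 0
    show ?case by (simp add: energy_def)
  next
    case (Suc J)
    then show ?case using energy_add[OF k2[of J], of "2 ^ Suc J * k"] k by (simp add: b_def)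
  qed
  have bE: "b j \<le> ?E" for j
    using sum_b[of "Suc j"] sum_nonneg[of "{..<j}" b] b0 energy_le_tail[of k "2 ^ Suc j * k"] by simp
  have D0: "0 \<le> D" by (simp add: D_def)
  have step: "a (Suc j) \<le> a j / 2 + D * ?E powr (q / p - 1) * b j" for j
  proof -
    have "a (Suc j) \<le> a j / 2 + D * b j powr (q / p)"
      using dyadic_step[of "2 ^ j * k"] k by (simp add: a_def b_def mult.assoc)
    also have "b j powr (q / p) = b j powr (q / p - 1) * b j"
      using b0[of j] by (cases "b j = 0") (simp_all add: powr_diff)
    also have "D * (b j powr (q / p - 1) * b j) \<le> D * (?E powr (q / p - 1) * b j)"
      using bE b0 D0 q_gt p_gt_1 by (intro mult_left_mono mult_right_mono powr_mono2) auto
    finally show ?thesis by (simp add: mult_ac)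
  qed
  have tele: "a J + (\<Sum>j<J. a j) / 2 \<le> a 0 + D * ?E powr (q / p - 1) * (\<Sum>j<J. b j)" for J
  proof (induction J)
    case (Suc J)
    then show ?case using step[of J] by (simp add: algebra_simps add_divide_distrib)
  qed simp
  have "(\<Sum>j<J. a j) / 2 \<le> a 0 + D * ?E powr (q / p - 1) * energy k (2 ^ J * k)"
  proof -
    have "0 \<le> a J" by (simp add: a_def m_nonneg)
    with tele[of J] show ?thesis unfolding sum_b by linarith
  qed
  also have "\<dots> \<le> a 0 + D * ?E powr (q / p - 1) * ?E"
    using D0 by (intro add_left_mono mult_left_mono energy_le_tail) auto
  also have "D * ?E powr (q / p - 1) * ?E = D * ?E powr (q / p)"
    using bE[of 0] b0[of 0] by (cases "?E = 0") (simp_all add: powr_diff)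
  finally show ?thesis by (simp add: a_def mult_ac)
qed

text \<open>A Sobolev inequality above level \<open>k\<close>: replace \<open>w\<close> on the layer
  \<open>2 ^ j * k \<le> w < 2 ^ Suc j * k\<close> by the upper end of the layer and sum.\<close>

lemma tail_powr_le:
  assumes k: "0 < k"
  shows "integrable M (\<lambda>x. indicator {x \<in> space M. k \<le> w x} x * w x powr q)"
    and "tail (\<lambda>x. w x powr q) k
      \<le> 2 powr q * (2 * k powr q * m k + 2 * D * tail (\<lambda>x. d x powr p) k powr (q / p))"
proof -
  let ?B = "2 powr q * (2 * k powr q * m k + 2 * D * tail (\<lambda>x. d x powr p) k powr (q / p))"
  let ?f = "\<lambda>x. indicator {x \<in> space M. k \<le> w x} x * w x powr q"
  let ?g = "\<lambda>j x. (2 ^ Suc j * k) powr q * indicator {x \<in> space M. 2 ^ j * k \<le> w x} x"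
  have le_suminf: "g j \<le> suminf g" for g :: "nat \<Rightarrow> ennreal" and j
    using sum_le_suminf[of g "{j}"] by simp
  have ge: "ennreal (?f x) \<le> (\<Sum>j. ennreal (?g j x))" if x: "x \<in> space M" for x
  proof (cases "k \<le> w x")
    case True
    define j where "j = (LEAST j. w x < 2 ^ Suc j * k)"
    obtain i0 where "w x / k < 2 ^ i0" using real_arch_pow[of 2 "w x / k"] by auto
    then have "w x < 2 ^ i0 * k" using k by (simp add: field_simps)
    also have "\<dots> \<le> 2 ^ Suc i0 * k" using k by simp
    finally have "w x < 2 ^ Suc i0 * k" .
    then have lt: "w x < 2 ^ Suc j * k" unfolding j_def by (rule LeastI)
    have ge: "2 ^ j * k \<le> w x"
    proof (cases j)
      case (Suc i)
      then have "\<not> w x < 2 ^ Suc i * k" using not_less_Least[of i "\<lambda>j. w x < 2 ^ Suc j * k"] by (simp add: j_def)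
      then show ?thesis using Suc by simp
    qed (use True in simp)
    have "?f x \<le> ?g j x"
      using ge True x lt w_nonneg q_gt by (auto simp: indicator_def intro!: powr_mono2)
    then have "ennreal (?f x) \<le> ennreal (?g j x)" by (rule ennreal_leI)
    also have "\<dots> \<le> (\<Sum>j. ennreal (?g j x))"
      by (rule le_suminf)
    finally show ?thesis .
  qed simp
  have "(\<integral>\<^sup>+x. ennreal (?f x) \<partial>M) \<le> (\<integral>\<^sup>+x. (\<Sum>j. ennreal (?g j x)) \<partial>M)"
    by (intro nn_integral_mono ge)
  also have "\<dots> = (\<Sum>j. \<integral>\<^sup>+x. ennreal (?g j x) \<partial>M)"
    by (rule nn_integral_suminf) measurable
  also have "\<dots> = (\<Sum>j. ennreal (2 powr q * ((2 ^ j * k) powr q * m (2 ^ j * k))))"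
  proof (rule suminf_cong)
    fix j
    have "(\<integral>\<^sup>+x. ennreal (?g j x) \<partial>M) = ennreal ((2 ^ Suc j * k) powr q) * emeasure M {x \<in> space M. 2 ^ j * k \<le> w x}"
      by (subst nn_integral_cmult_indicator[symmetric]) (auto simp: ennreal_mult' ennreal_indicator)
    also have "\<dots> = ennreal ((2 ^ Suc j * k) powr q * m (2 ^ j * k))"
      by (simp add: emeasure_eq_measure m_def ennreal_mult')
    also have "(2 ^ Suc j * k) powr q * m (2 ^ j * k) = 2 powr q * ((2 ^ j * k) powr q * m (2 ^ j * k))"
      using k by (simp add: powr_mult)
    finally show "(\<integral>\<^sup>+x. ennreal (?g j x) \<partial>M) = ennreal (2 powr q * ((2 ^ j * k) powr q * m (2 ^ j * k)))" .
  qed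
  also have "\<dots> \<le> ennreal ?B"
  proof (rule suminf_le_const)
    fix J
    have "(\<Sum>j<J. ennreal (2 powr q * ((2 ^ j * k) powr q * m (2 ^ j * k))))
      = ennreal (2 powr q * (\<Sum>j<J. (2 ^ j * k) powr q * m (2 ^ j * k)))"
      using m_nonneg by (subst sum_ennreal) (auto simp: sum_distrib_left)
    also have "\<dots> \<le> ennreal ?B"
      by (intro ennreal_leI mult_left_mono dyadic_sum[OF k]) auto
    finally show "(\<Sum>j<J. ennreal (2 powr q * ((2 ^ j * k) powr q * m (2 ^ j * k)))) \<le> ennreal ?B" .
  qed simp
  finally have fin: "(\<integral>\<^sup>+x. ennreal (?f x) \<partial>M) \<le> ennreal ?B" .
  show int: "integrable M ?f"
    by (rule integrableI_nonneg) (use fin in \<open>auto simp: le_less_trans\<close>)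
  have "ennreal (LINT x|M. ?f x) = (\<integral>\<^sup>+x. ennreal (?f x) \<partial>M)"
    by (rule nn_integral_eq_integral[symmetric, OF int]) auto
  with fin have "ennreal (LINT x|M. ?f x) \<le> ennreal ?B" by simp
  moreover have "0 \<le> ?B" using m_nonneg by (auto simp: D_def)
  ultimately show "tail (\<lambda>x. w x powr q) k \<le> ?B"
    unfolding tail_def by (simp add: ennreal_le_iff)
qed

lemma integrable_powr_critical: "integrable M (\<lambda>x. w x powr q)"
proof (rule Bochner_Integration.integrable_bound)
  show "integrable M (\<lambda>x. indicator {x \<in> space M. 1 \<le> w x} x * w x powr q + 1)"
    using tail_powr_le(1)[of 1] by simp
  show "AE x in M. norm (w x powr q) \<le> norm (indicator {x \<in> space M. 1 \<le> w x} x * w x powr q + 1)"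
  proof (rule AE_I2)
    fix x assume x: "x \<in> space M"
    have "w x powr q \<le> 1" if "w x < 1" using that w_nonneg q_gt powr_le1[of q "w x"] by simp
    then show "norm (w x powr q) \<le> norm (indicator {x \<in> space M. 1 \<le> w x} x * w x powr q + 1)"
      using x by (cases "1 \<le> w x") auto
  qed
qed measurable

text \<open>For large \<open>k\<close> the energy above level \<open>k\<close> is small, so its superlinear power coming from
  \<open>tail_powr_le\<close> is absorbed and the energy is bounded by a multiple of \<open>k powr q * m k\<close>. Inserting
  this into the level set inequality gives De Giorgi's recursion.\<close>

lemma bounded_if_Caccioppoli:
  assumes Cacc: "\<And>k. 1 \<le> k \<Longrightarrow> tail (\<lambda>x. d x powr p) k \<le> C' * tail (\<lambda>x. w x powr q) k"
    and C': "0 < C'"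
  shows "\<exists>K. AE x in M. w x \<le> K"
proof -
  let ?E = "tail (\<lambda>x. d x powr p)" and ?F = "tail (\<lambda>x. w x powr q)"
  define c1 where "c1 = C' * 2 powr q * 2"
  have c1: "0 < c1" using C' by (simp add: c1_def)
  have D: "0 < D" using C_pos by (simp add: D_def)
  have E0: "0 \<le> ?E k" for k unfolding tail_def by (intro integral_nonneg_AE) auto
  have "((\<lambda>k. c1 * D * ?E k powr (q / p - 1)) \<longlongrightarrow> c1 * D * 0 powr (q / p - 1)) at_top"
    using q_gt p_gt_1 E0
    by (intro tendsto_intros tendsto_powr2 tail_tendsto_0 int_dp) (auto simp: eventually_at_top_linorder)
  then have "eventually (\<lambda>k. c1 * D * ?E k powr (q / p - 1) < 1 / 2) at_top"
    by (rule order_tendstoD) (use q_gt p_gt_1 in auto)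
  then obtain k0 where k0: "\<And>k. k \<ge> k0 \<Longrightarrow> c1 * D * ?E k powr (q / p - 1) < 1 / 2"
    by (auto simp: eventually_at_top_linorder)
  define c2 where "c2 = 2 * c1"
  have absorbed: "?E k \<le> c2 * k powr q * m k" if k: "k \<ge> k0" "k \<ge> 1" for k
  proof -
    have "?E k \<le> C' * ?F k" using k by (intro Cacc)
    also have "\<dots> \<le> C' * (2 powr q * (2 * k powr q * m k + 2 * D * ?E k powr (q / p)))"
      using k C' by (intro mult_left_mono tail_powr_le(2)) auto
    also have "\<dots> = c1 * k powr q * m k + c1 * D * ?E k powr (q / p)"
      by (simp add: c1_def algebra_simps)
    also have "?E k powr (q / p) = ?E k powr (q / p - 1) * ?E k"
      using E0[of k] by (cases "?E k = 0") (simp_all add: powr_diff)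
    also have "c1 * D * (?E k powr (q / p - 1) * ?E k) \<le> 1 / 2 * ?E k"
      using mult_right_mono[OF less_imp_le[OF k0[OF k(1)]] E0[of k]] by (simp add: mult_ac)
    finally show ?thesis by (simp add: c2_def)
  qed
  define A where "A = 2 * C * (c2 * 2 powr q) powr (1 / p)"
  have A: "0 < A" using C_pos c1 by (simp add: A_def c2_def)
  have n: "0 < n" using p_gt_1 p_less_n by simp
  have "(?F \<longlongrightarrow> 0) at_top" by (rule tail_tendsto_0[OF integrable_powr_critical])
  then have "eventually (\<lambda>k. ?F k < (2 powr - n / A) powr n) at_top"
    by (rule order_tendstoD) (use A in simp)
  then have "eventually (\<lambda>k. ?F k < (2 powr - n / A) powr n \<and> k \<ge> k0 \<and> k \<ge> 1) at_top"
    by (intro eventually_conj eventually_ge_at_top)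
  then obtain K where K: "?F K < (2 powr - n / A) powr n" "K \<ge> k0" "K \<ge> 1"
    by (auto simp: eventually_at_top_linorder)
  \<comment> \<open>levels increasing from \<open>K\<close> to \<open>2 * K\<close>, with gaps halving in each step\<close>
  define l where "l j = K * (2 - (1/2) ^ j)" for j :: nat
  define Y where "Y j = K powr q * m (l j)" for j
  have lK: "K \<le> l j" "l j \<le> 2 * K" for j
  proof -
    have "(1/2 :: real) ^ j \<le> 1" by (simp add: power_le_one)
    then have "K * 1 \<le> K * (2 - (1/2) ^ j)" using K by (intro mult_left_mono) auto
    then show "K \<le> l j" by (simp add: l_def)
    have "K * (2 - (1/2) ^ j) \<le> K * 2" using K by (intro mult_left_mono) auto
    then show "l j \<le> 2 * K" by (simp add: l_def)
  qed
  have l_step: "l (Suc j) - l j = K * (1/2) ^ Suc j" for j by (simp add: l_def algebra_simps)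
  have "Y \<longlonglongrightarrow> 0"
  proof (rule powr_superlinear_recursion_tendsto_0[OF _ n A])
    show "0 \<le> Y j" for j using m_nonneg by (simp add: Y_def)
    have "Y 0 = (LINT x|M. indicator {x \<in> space M. K \<le> w x} x * K powr q)"
      by (simp add: Y_def l_def m_def)
    also have "\<dots> \<le> ?F K"
      unfolding tail_def using K q_gt
      by (intro integral_mono integrable_indicator_times integrable_powr_critical)
        (auto simp: indicator_def intro!: powr_mono2)
    finally show "Y 0 \<le> (2 powr - n / A) powr n" using K by simp
    fix j
    have "energy (l j) (l (Suc j)) \<le> c2 * l j powr q * m (l j)"
      using lK[of j] K by (intro order.trans[OF energy_le_tail] absorbed) auto
    also have "\<dots> \<le> c2 * (2 * K) powr q * m (l j)"
      using lK[of j] K q_gt c1 m_nonneg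
      by (intro mult_right_mono mult_left_mono powr_mono2) (auto simp: c2_def)
    also have "\<dots> = c2 * 2 powr q * Y j" using K by (simp add: Y_def powr_mult)
    finally have E: "energy (l j) (l (Suc j)) \<le> c2 * 2 powr q * Y j" .
    have "Y (Suc j) = 2 ^ Suc j * K powr (q - 1) * ((l (Suc j) - l j) * m (l (Suc j)))"
      using K by (simp add: Y_def l_step powr_diff power_divide)
    also have "\<dots> \<le> 2 ^ Suc j * K powr (q - 1) * (C * m (l j) powr (1 - 1 / q) * energy (l j) (l (Suc j)) powr (1 / p))"
    proof -
      have "0 < K * (1/2) ^ Suc j" using K by simp
      with l_step[of j] have "l j < l (Suc j)" by linarith
      then show ?thesis
        using K lK(1)[of j] by (intro mult_left_mono level_energy) auto
    qed
    also have "\<dots> \<le> 2 ^ Suc j * K powr (q - 1) * (C * m (l j) powr (1 - 1 / q) * (c2 * 2 powr q * Y j) powr (1 / p))"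
      using E C_pos p_gt_1 energy_nonneg by (intro mult_left_mono powr_mono2) auto
    also have "\<dots> = A * 2 ^ j * ((K powr (q - 1) * m (l j) powr (1 - 1 / q)) * Y j powr (1 / p))"
      using c1 m_nonneg by (simp add: A_def powr_mult c2_def Y_def)
    also have "K powr (q - 1) * m (l j) powr (1 - 1 / q) = Y j powr (1 - 1 / q)"
      using m_nonneg q_gt by (simp add: Y_def powr_mult powr_powr right_diff_distrib)
    also have "Y j powr (1 - 1 / q) * Y j powr (1 / p) = Y j powr (1 + 1 / n)"
      using q_exponents(2) by (simp add: powr_add[symmetric])
    finally show "Y (Suc j) \<le> A * 2 ^ j * Y j powr (1 + 1 / n)" .
  qed
  moreover have "K powr q * m (2 * K) \<le> Y j" for j
    using lK[of j] by (auto simp: Y_def intro!: mult_left_mono m_antimono)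
  ultimately have "K powr q * m (2 * K) \<le> 0"
    by (intro LIMSEQ_le_const[of Y 0]) auto
  then have "m (2 * K) = 0" using K m_nonneg[of "2 * K"] by (simp add: mult_le_0_iff)
  then have "AE x in M. \<not> 2 * K \<le> w x"
    by (subst AE_iff_measurable[OF _ refl]) (auto simp: m_def emeasure_eq_measure)
  then show ?thesis by (intro exI[of _ "2 * K"]) auto
qed

end

section \<open>The Caccioppoli inequality\<close>

text \<open>Young's inequality for \<open>h\<close> and its complementary function \<open>c\<close>. The inverse is meaningful since
  \<open>c\<close> maps the half line bijectively onto itself: it vanishes at \<open>0\<close> and is convex, positive and
  unbounded on \<open>t > 0\<close>.\<close>

lemma complementary_function_inverse:
  fixes h :: "real \<Rightarrow> real"
  assumes h0: "h 0 = 0" and pos: "\<And>t. 0 < t \<Longrightarrow> 0 < h t"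
    and small: "((\<lambda>t. h t / t) \<longlongrightarrow> 0) (at 0)" and large: "filterlim (\<lambda>t. h t / t) at_top at_top"
  defines "c \<equiv> \<lambda>t. SUP s\<in>{0..}. t * s - h s"
  assumes y: "0 \<le> y" and s: "0 \<le> s"
  shows "the_inv_into {0..} c y * s \<le> y + h s"
proof -
  have nonneg: "0 \<le> h t" if "0 \<le> t" for t using that h0 pos[of t] by (cases "t = 0") auto
  have bdd: "bdd_above ((\<lambda>s. t * s - h s) ` {0..})" for t
  proof -
    have "eventually (\<lambda>s. t \<le> h s / s \<and> 0 < s) at_top"
      using large eventually_gt_at_top[of 0] by (auto simp: filterlim_at_top intro: eventually_conj)
    then obtain S where S: "\<And>s. S \<le> s \<Longrightarrow> t \<le> h s / s \<and> 0 < s" by (auto simp: eventually_at_top_linorder)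
    have "t * s - h s \<le> \<bar>t\<bar> * \<bar>S\<bar>" if "0 \<le> s" for s
    proof (cases "S \<le> s")
      case True
      then have "t \<le> h s / s" "0 < s" using S by auto
      then have "t * s \<le> h s" by (simp add: pos_le_divide_eq)
      moreover have "0 \<le> \<bar>t\<bar> * \<bar>S\<bar>" by simp
      ultimately show ?thesis by linarith
    next
      case False
      have "t * s \<le> \<bar>t\<bar> * \<bar>S\<bar>" using False that by (intro mult_mono) auto
      then show ?thesis using nonneg[OF that] by linarith
    qed
    then show ?thesis by (intro bdd_aboveI2) auto
  qed
  have ge: "t * s - h s \<le> c t" if "0 \<le> s" for t s
    unfolding c_def using that by (intro cSUP_upper bdd) auto
  have least: "c t \<le> b" if "\<And>s. 0 \<le> s \<Longrightarrow> t * s - h s \<le> b" for t b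
    unfolding c_def using that by (intro cSUP_least) auto
  have c0: "c 0 = 0"
    using ge[of 0 0] h0 nonneg by (intro antisym least) auto
  have cpos: "0 < c t" if "0 < t" for t
  proof -
    have "eventually (\<lambda>s. h s / s < t) (at 0)" using small that by (rule order_tendstoD)
    then have "eventually (\<lambda>s. h s / s < t) (at_right 0)" by (simp add: eventually_at_split)
    then have "eventually (\<lambda>s. h s / s < t \<and> 0 < s) (at_right (0::real))"
      by (intro eventually_conj eventually_at_right_less)
    then obtain s where "h s / s < t" "0 < s"
      using eventually_happens'[OF trivial_limit_at_right_real] by blast
    then have "0 < t * s - h s" by (simp add: field_simps)
    with ge[of s t] \<open>0 < s\<close> show ?thesis by linarith
  qed
  have mono: "c a < c b" if "0 \<le> a" "a < b" for a b
  proof -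
    have "c a \<le> a / b * c b"
    proof (rule least)
      fix s :: real assume s: "0 \<le> s"
      have "a * s - h s \<le> a / b * (b * s - h s)"
      proof -
        have "a / b * h s \<le> 1 * h s" using that nonneg[OF s] by (intro mult_right_mono) auto
        then show ?thesis using that by (simp add: algebra_simps)
      qed
      also have "\<dots> \<le> a / b * c b" using that s by (intro mult_left_mono ge) auto
      finally show "a * s - h s \<le> a / b * c b" .
    qed
    also have "\<dots> < c b" using that cpos[of b] by (simp add: divide_less_eq)
    finally show ?thesis .
  qed
  have "convex_on UNIV c"
  proof (rule convex_onI)
    fix t x z :: real assume t: "0 < t" "t < 1"
    have "((1 - t) * x + t * z) * s - h s \<le> (1 - t) * c x + t * c z" if "0 \<le> s" for s
    proof -
      have "((1 - t) * x + t * z) * s - h s = (1 - t) * (x * s - h s) + t * (z * s - h s)"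
        by (simp add: algebra_simps)
      also have "\<dots> \<le> (1 - t) * c x + t * c z"
        using t that by (intro add_mono mult_left_mono ge) auto
      finally show ?thesis .
    qed
    then show "c ((1 - t) *\<^sub>R x + t *\<^sub>R z) \<le> (1 - t) * c x + t * c z"
      by (intro least) simp
  qed simp
  then have "continuous_on UNIV c" by (rule convex_on_continuous[OF open_UNIV])
  then have cont: "continuous_on {0..y + h 1} c" by (rule continuous_on_subset) simp
  have "y \<le> c (y + h 1)" using ge[of 1 "y + h 1"] by simp
  with IVT'[of c 0 y "y + h 1", OF _ _ _ cont] y c0 nonneg[of 1] obtain m where "0 \<le> m" "c m = y"
    by auto
  then have "y \<in> c ` {0..}" by auto
  moreover have "inj_on c {0..}" by (rule linorder_inj_onI) (use mono in \<open>force+\<close>)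
  ultimately have "c (the_inv_into {0..} c y) = y" by (intro f_the_inv_into_f)
  with ge[OF s, of "the_inv_into {0..} c y"] show ?thesis by linarith
qed

lemma excess_le:
  assumes "0 < k"
  shows "\<bar>excess k t\<bar> \<le> (if k \<le> \<bar>t\<bar> then \<bar>t\<bar> else 0)"
  using assms by (auto simp: excess_def abs_if)

context musielak
begin

text \<open>The equation is tested with \<open>trunc j k \<circ> u\<close>. Testing it with \<open>u\<close> itself provides the integrable
  functions that dominate both sides as \<open>j\<close> tends to infinity.\<close>

lemma weak_solution_truncated:
  assumes ws: "weak_solution \<Omega> G A B u" and k: "0 < k"
  defines "a \<equiv> \<lambda>x. A x (u x) (weak_gradient \<Omega> u x) \<bullet> weak_gradient \<Omega> u x"
    and "b \<equiv> \<lambda>x. B x (u x) (weak_gradient \<Omega> u x)"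
  shows "integrable M (\<lambda>x. (if k \<le> \<bar>u x\<bar> then 1 else 0) * a x)" "integrable M (\<lambda>x. b x * excess k (u x))"
    and "(LINT x|M. (if k \<le> \<bar>u x\<bar> then 1 else 0) * a x) = (LINT x|M. b x * excess k (u x))"
proof -
  let ?U = "weak_gradient \<Omega> u"
  have u: "u \<in> W10_space \<Omega> G" using ws by (simp add: weak_solution_def)
  note uD = W1_space_D[OF W10_space_D[OF u]]
  note [measurable] = uD(1)
  have int: "integrable M a" "integrable M (\<lambda>x. b x * u x)"
    using ws u by (auto simp: weak_solution_def a_def b_def)
  note [measurable] = borel_measurable_integrable[OF int(1)]
  have bT: "integrable M (\<lambda>x. b x * trunc j k (u x))" and eq: "(LINT x|M. trunc' j k (u x) * a x) = (LINT x|M. b x * trunc j k (u x))" for j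
  proof -
    note comp = W10_space_compose[OF u smooth_real_trunc trunc_0 has_real_derivative_trunc trunc'_bounds, of j k]
    let ?V = "weak_gradient \<Omega> (\<lambda>x. trunc j k (u x))"
    have V: "integrable M (\<lambda>x. A x (u x) (?U x) \<bullet> ?V x)" "integrable M (\<lambda>x. b x * trunc j k (u x))"
      "(LINT x|M. A x (u x) (?U x) \<bullet> ?V x) = (LINT x|M. b x * trunc j k (u x))"
      using ws comp(1) by (auto simp: weak_solution_def b_def)
    show "integrable M (\<lambda>x. b x * trunc j k (u x))" by (rule V(2))
    have "(LINT x|M. A x (u x) (?U x) \<bullet> ?V x) = (LINT x|M. trunc' j k (u x) * a x)"
    proof (rule integral_cong_AE)
      show "(\<lambda>x. A x (u x) (?U x) \<bullet> ?V x) \<in> borel_measurable M" by (rule borel_measurable_integrable[OF V(1)])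
      show "(\<lambda>x. trunc' j k (u x) * a x) \<in> borel_measurable M" by measurable
      show "AE x in M. A x (u x) (?U x) \<bullet> ?V x = trunc' j k (u x) * a x"
        using comp(2) by eventually_elim (simp add: a_def)
    qed
    with V(3) show "(LINT x|M. trunc' j k (u x) * a x) = (LINT x|M. b x * trunc j k (u x))" by simp
  qed
  have am: "(\<lambda>x. (if k \<le> \<bar>u x\<bar> then 1 else 0) * a x) \<in> borel_measurable M" by measurable
  have bm: "(\<lambda>x. b x * excess k (u x)) \<in> borel_measurable M"
  proof (rule borel_measurable_LIMSEQ_real[where u="\<lambda>j x. b x * trunc j k (u x)"])
    show "(\<lambda>j. b x * trunc j k (u x)) \<longlonglongrightarrow> b x * excess k (u x)" for x
      by (rule tendsto_mult_left[OF trunc_limit])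
    show "(\<lambda>x. b x * trunc j k (u x)) \<in> borel_measurable M" for j by (rule borel_measurable_integrable[OF bT])
  qed
  have l1: "AE x in M. (\<lambda>j. trunc' j k (u x) * a x) \<longlonglongrightarrow> (if k \<le> \<bar>u x\<bar> then 1 else 0) * a x"
    by (intro AE_I2 tendsto_mult_right trunc'_limit k)
  have d1: "AE x in M. norm (trunc' j k (u x) * a x) \<le> 2 * \<bar>a x\<bar>" for j
    using trunc'_bounds by (intro AE_I2) (simp add: abs_mult mult_right_mono)
  have l2: "AE x in M. (\<lambda>j. b x * trunc j k (u x)) \<longlonglongrightarrow> b x * excess k (u x)"
    by (intro AE_I2 tendsto_mult_left trunc_limit)
  have d2: "AE x in M. norm (b x * trunc j k (u x)) \<le> 2 * \<bar>b x * u x\<bar>" for j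
  proof (rule AE_I2)
    fix x
    have "\<bar>b x\<bar> * \<bar>trunc j k (u x)\<bar> \<le> \<bar>b x\<bar> * (2 * \<bar>u x\<bar>)" by (intro mult_left_mono abs_trunc_le) simp
    then show "norm (b x * trunc j k (u x)) \<le> 2 * \<bar>b x * u x\<bar>" by (simp add: abs_mult mult_ac)
  qed
  have w: "integrable M (\<lambda>x. 2 * \<bar>a x\<bar>)" "integrable M (\<lambda>x. 2 * \<bar>b x * u x\<bar>)" using int by auto
  have m1: "(\<lambda>x. trunc' j k (u x) * a x) \<in> borel_measurable M" for j by measurable
  have m2: "(\<lambda>x. b x * trunc j k (u x)) \<in> borel_measurable M" for j by (rule borel_measurable_integrable[OF bT])
  show "integrable M (\<lambda>x. (if k \<le> \<bar>u x\<bar> then 1 else 0) * a x)"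
    by (rule integrable_dominated_convergence[OF am m1 w(1) l1 d1])
  show "integrable M (\<lambda>x. b x * excess k (u x))"
    by (rule integrable_dominated_convergence[OF bm m2 w(2) l2 d2])
  have "(\<lambda>j. LINT x|M. trunc' j k (u x) * a x) \<longlonglongrightarrow> (LINT x|M. (if k \<le> \<bar>u x\<bar> then 1 else 0) * a x)"
    by (rule integral_dominated_convergence[OF am m1 w(1) l1 d1])
  moreover have "(\<lambda>j. LINT x|M. b x * trunc j k (u x)) \<longlonglongrightarrow> (LINT x|M. b x * excess k (u x))"
    by (rule integral_dominated_convergence[OF bm m2 w(2) l2 d2])
  ultimately show "(LINT x|M. (if k \<le> \<bar>u x\<bar> then 1 else 0) * a x) = (LINT x|M. b x * excess k (u x))"
    unfolding eq by (rule LIMSEQ_unique)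
qed

text \<open>On \<open>k \<le> \<bar>u\<bar>\<close> with \<open>k \<ge> 1\<close> every term other than \<open>G x \<bar>Du\<bar>\<close> is at most a multiple of
  \<open>\<bar>u\<bar> powr qs\<close>. The gradient term of \<open>B\<close> is split by Young's inequality with a factor
  \<open>e\<close> so small that half of the coercivity of \<open>A\<close> survives.\<close>

lemma Caccioppoli:
  assumes ws: "weak_solution \<Omega> G A B u"
    and pos: "0 < a4" "0 < a5" "0 < a6" "0 < b1" "0 < b2" "0 < b3" "0 < F'" "1 \<le> qs"
    and A: "AE x in M. \<forall>s \<eta>. A x s \<eta> \<bullet> \<eta> \<ge> a4 * G x (norm \<eta>) - a5 * H x \<bar>s\<bar> - a6"
    and B: "AE x in M. \<forall>s \<eta>. \<bar>B x s \<eta>\<bar> \<le> b1 * \<mu> x (norm \<eta>) + b2 * h x \<bar>s\<bar> + b3"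
    and H: "AE x in M. \<forall>t\<ge>1. H x t \<le> F' * t powr qs \<and> h x t * t \<le> qs * H x t"
    and Young: "AE x in M. \<forall>s\<ge>0. \<forall>t\<ge>0. \<mu> x t * s \<le> G x t + H x s"
    and int: "integrable M (\<lambda>x. \<bar>u x\<bar> powr qs)"
  shows "\<exists>C>0. \<forall>k\<ge>1.
    (LINT x|M. indicator {x \<in> space M. k \<le> \<bar>u x\<bar>} x * norm (weak_gradient \<Omega> u x) powr p)
      \<le> C * (LINT x|M. indicator {x \<in> space M. k \<le> \<bar>u x\<bar>} x * \<bar>u x\<bar> powr qs)"
proof -
  let ?U = "weak_gradient \<Omega> u"
  have u: "u \<in> W10_space \<Omega> G" using ws by (simp add: weak_solution_def)
  note uD = W1_space_D[OF W10_space_D[OF u]]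
  note [measurable] = uD(1,4)
  have nU: "(\<lambda>x. norm (?U x)) \<in> borel_measurable M" by measurable
  have intG: "integrable M (\<lambda>x. G x (norm (?U x)))" and intp: "integrable M (\<lambda>x. norm (?U x) powr p)"
    using integrable_if_modular_finite(1,3)[OF nU uD(5)] by simp_all
  \<comment> \<open>the weight in Young's inequality; \<open>b1 * e \<le> a4 / 2\<close> keeps half of the coercive term\<close>
  define e where "e = min 1 (a4 / (2 * b1))"
  have e: "0 < e" "e \<le> 1" "b1 * e \<le> a4 / 2"
  proof -
    show "0 < e" "e \<le> 1" using pos by (auto simp: e_def)
    have "b1 * e \<le> b1 * (a4 / (2 * b1))" using pos by (intro mult_left_mono) (auto simp: e_def)
    then show "b1 * e \<le> a4 / 2" using pos by simp
  qed
  define K where "K = a5 * F' + a6 + b1 * e * F' * (1 / e) powr qs + b2 * qs * F' + b3"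
  have K: "0 < K" using pos e by (auto simp: K_def intro!: add_pos_pos mult_pos_pos)
  define C where "C = 1 + F * (2 * K / a4)"
  have "0 < C" using K pos F by (auto simp: C_def intro!: add_pos_nonneg)
  moreover have "(LINT x|M. indicator {x \<in> space M. k \<le> \<bar>u x\<bar>} x * norm (?U x) powr p)
      \<le> C * (LINT x|M. indicator {x \<in> space M. k \<le> \<bar>u x\<bar>} x * \<bar>u x\<bar> powr qs)" if k: "1 \<le> k" for k
  proof -
    have k0: "0 < k" using k by simp
    let ?S = "{x \<in> space M. k \<le> \<bar>u x\<bar>}"
    let ?a = "\<lambda>x. A x (u x) (?U x) \<bullet> ?U x" and ?b = "\<lambda>x. B x (u x) (?U x)"
    note wt = weak_solution_truncated[OF ws k0]
    have intS: "integrable M (\<lambda>x. indicator ?S x * f x)" if "integrable M f" for f :: "real^'n \<Rightarrow> real"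
    proof -
      have "?S \<in> sets M" by measurable
      from integrable_real_mult_indicator[OF this that] show ?thesis by (simp add: mult.commute)
    qed
    have pointwise: "AE x in M. indicator ?S x * (a4 / 2 * G x (norm (?U x)) - K * \<bar>u x\<bar> powr qs)
        \<le> (if k \<le> \<bar>u x\<bar> then 1 else 0) * ?a x - ?b x * excess k (u x)"
      using A B H Young G_growth AE_space
    proof eventually_elim
      case (elim x)
      show ?case
      proof (cases "k \<le> \<bar>u x\<bar>")
        case False
        then show ?thesis using excess_le[OF k0, of "u x"] by (simp add: indicator_def)
      next
        case True
        let ?v = "\<bar>u x\<bar>" and ?g = "G x (norm (?U x))"
        have v: "1 \<le> ?v" using True k by simp
        have vq: "?v \<le> ?v powr qs" "1 \<le> ?v powr qs"
          using v pos powr_mono[of 1 qs ?v] by (auto simp: ge_one_powr_ge_zero)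
        have H1: "H x ?v \<le> F' * ?v powr qs" "h x ?v * ?v \<le> qs * H x ?v"
          using elim(3) v by auto
        have ev: "1 \<le> 1 / e * ?v"
          using v e mult_mono[of 1 "1 / e" 1 ?v] by simp
        have H2: "H x (1 / e * ?v) \<le> F' * ((1 / e) powr qs * ?v powr qs)"
          using elim(3) ev e by (auto simp: powr_mult[symmetric])
        have a: "?a x \<ge> a4 * ?g - a5 * H x ?v - a6" using elim(1) by blast
        have "a5 * H x ?v \<le> a5 * (F' * ?v powr qs)" using pos H1 by (intro mult_left_mono) auto
        moreover have "a6 * 1 \<le> a6 * ?v powr qs" using pos vq by (intro mult_left_mono) auto
        ultimately have a': "?a x \<ge> a4 * ?g - (a5 * F' + a6) * ?v powr qs"
          using a by (simp add: algebra_simps)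
        have "\<bar>?b x\<bar> * ?v \<le> (b1 * \<mu> x (norm (?U x)) + b2 * h x ?v + b3) * ?v"
          using elim(2) by (intro mult_right_mono) auto
        also have "\<dots> = b1 * e * (\<mu> x (norm (?U x)) * (1 / e * ?v)) + b2 * (h x ?v * ?v) + b3 * ?v"
          using e by (simp add: algebra_simps)
        also have "\<dots> \<le> b1 * e * (?g + F' * ((1 / e) powr qs * ?v powr qs)) + b2 * (qs * (F' * ?v powr qs)) + b3 * ?v powr qs"
        proof (intro add_mono mult_left_mono)
          have "\<mu> x (norm (?U x)) * (1 / e * ?v) \<le> ?g + H x (1 / e * ?v)"
            using e by (intro elim(4)[rule_format]) auto
          then show "\<mu> x (norm (?U x)) * (1 / e * ?v) \<le> ?g + F' * ((1 / e) powr qs * ?v powr qs)"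
            using H2 by linarith
          have "qs * H x ?v \<le> qs * (F' * ?v powr qs)" using H1 pos by (intro mult_left_mono) auto
          then show "h x ?v * ?v \<le> qs * (F' * ?v powr qs)" using H1 by linarith
        qed (use pos e vq in auto)
        also have "b1 * e * (?g + F' * ((1 / e) powr qs * ?v powr qs)) = b1 * e * ?g + b1 * e * F' * (1 / e) powr qs * ?v powr qs"
          by (simp add: algebra_simps)
        finally have b: "\<bar>?b x\<bar> * ?v \<le> b1 * e * ?g + (b1 * e * F' * (1 / e) powr qs + b2 * qs * F' + b3) * ?v powr qs"
          by (simp add: algebra_simps)
        have "b1 * e * ?g \<le> a4 / 2 * ?g"
          by (rule mult_right_mono[OF e(3) pg_nonneg[OF elim(5) p F]])
        moreover have "K * ?v powr qs = (a5 * F' + a6) * ?v powr qs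
            + (b1 * e * F' * (1 / e) powr qs + b2 * qs * F' + b3) * ?v powr qs"
          by (simp add: K_def algebra_simps)
        ultimately have le: "a4 / 2 * ?g - K * ?v powr qs \<le> ?a x - \<bar>?b x\<bar> * ?v"
          using a' b by linarith
        have "\<bar>?b x * excess k (u x)\<bar> \<le> \<bar>?b x\<bar> * ?v"
          using excess_le[OF k0, of "u x"] True by (simp add: abs_mult mult_left_mono)
        then have b': "?b x * excess k (u x) \<le> \<bar>?b x\<bar> * ?v" by linarith
        from le b' show ?thesis using True elim(6) by (simp add: indicator_def)
      qed
    qed
    let ?X = "LINT x|M. indicator ?S x * G x (norm (?U x))"
    let ?Y = "LINT x|M. indicator ?S x * \<bar>u x\<bar> powr qs"
    have "a4 / 2 * ?X - K * ?Y
        = (LINT x|M. a4 / 2 * (indicator ?S x * G x (norm (?U x))) - K * (indicator ?S x * \<bar>u x\<bar> powr qs))"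
      using intS[OF intG] intS[OF int] by simp
    also have "\<dots> = (LINT x|M. indicator ?S x * (a4 / 2 * G x (norm (?U x)) - K * \<bar>u x\<bar> powr qs))"
      by (simp add: algebra_simps)
    also have "\<dots> \<le> (LINT x|M. (if k \<le> \<bar>u x\<bar> then 1 else 0) * ?a x - ?b x * excess k (u x))"
      using intG int by (intro integral_mono_AE pointwise intS Bochner_Integration.integrable_diff wt(1,2)) auto
    also have "\<dots> = 0"
      using wt by (simp add: Bochner_Integration.integral_diff)
    finally have X: "?X \<le> 2 * K / a4 * ?Y" using pos by (simp add: field_simps)
    have "(LINT x|M. indicator ?S x * norm (?U x) powr p)
        \<le> (LINT x|M. indicator ?S x * \<bar>u x\<bar> powr qs + F * (indicator ?S x * G x (norm (?U x))))"
    proof (rule integral_mono_AE)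
      show "AE x in M. indicator ?S x * norm (?U x) powr p
          \<le> indicator ?S x * \<bar>u x\<bar> powr qs + F * (indicator ?S x * G x (norm (?U x)))"
        using G_growth
      proof eventually_elim
        case (elim x)
        show ?case
        proof (cases "x \<in> ?S")
          case True
          then have "1 \<le> \<bar>u x\<bar> powr qs" using k pos by (intro ge_one_powr_ge_zero) auto
          then show ?thesis using True pg_ge_powr[OF elim p F, of "norm (?U x)"] by simp
        qed simp
      qed
    qed (use intS[OF intp] intS[OF int] intS[OF intG] in auto)
    also have "\<dots> = ?Y + F * ?X" using intS[OF int] intS[OF intG] by simp
    also have "\<dots> \<le> ?Y + F * (2 * K / a4 * ?Y)" using X F by (intro add_left_mono mult_left_mono) auto
    also have "\<dots> = C * ?Y" by (simp add: C_def algebra_simps)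
    finally show ?thesis .
  qed
  ultimately show ?thesis by blast
qed

end

section \<open>Boundedness of weak solutions\<close>

lemma power_growth_if_N_deriv_bounds:
  assumes "G x 0 = 0" "\<forall>t. G x (- t) = G x t" "continuous_on UNIV (G x)" "convex_on UNIV (G x)"
    "strict_mono_on {0..} (G x)" "\<forall>t>0. 0 < G x t" "inverse F \<le> G x 1" "G x 1 \<le> F" "1 < p" "p \<le> q"
    "\<forall>t>0. p \<le> N_deriv G x t * t / G x t \<and> N_deriv G x t * t / G x t \<le> q"
  shows "power_growth p q F (G x)"
  using assms by (intro power_growth_if_derivative_bounds) (auto simp: N_deriv_def inverse_eq_divide)

theorem theorem1p9:
  fixes \<Omega> :: "(real^'n) set"
    and G H1 H2 :: "real^'n \<Rightarrow> real \<Rightarrow> real"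
    and A :: "real^'n \<Rightarrow> real \<Rightarrow> real^'n \<Rightarrow> real^'n"
    and B :: "real^'n \<Rightarrow> real \<Rightarrow> real^'n \<Rightarrow> real"
    and gm gp :: real
    and u :: "real^'n \<Rightarrow> real"
  assumes "CARD('n) \<ge> 2"
    and "open \<Omega>" "connected \<Omega>" "\<Omega> \<noteq> {}" "bounded \<Omega>"
    and "gen_N_function UNIV G"
    and "cond_G0 G gm gp" "cond_G1 G" "cond_G2 G"
    and "gen_N_function \<Omega> H1" "gen_N_function \<Omega> H2"
    and "\<And>H. H \<in> {H1, H2} \<Longrightarrow>
           cond_H1 \<Omega> H \<and> cond_H2 \<Omega> H gm gp \<and> cond_H3 \<Omega> H \<and> cond_H4 \<Omega> G H"
    and "caratheodory \<Omega> A" "caratheodory \<Omega> B"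
    and "cond_A1 \<Omega> G H1 A" "cond_A2 \<Omega> G H1 A" "cond_B \<Omega> G H1 B"
    and "u \<in> W1_space \<Omega> G"
    and "weak_solution \<Omega> G A B u"
  shows "u \<in> L_infinity \<Omega>"
proof -
  let ?n = "real CARD('n)"
  define qs where "qs = ?n * gm / (?n - gm)"
  have g: "1 < gm" "gm \<le> gp" "gp < ?n"
    and G0: "\<forall>t>0. gm \<le> N_deriv G x t * t / G x t \<and> N_deriv G x t * t / G x t \<le> gp" for x
    using \<open>cond_G0 G gm gp\<close> by (auto simp: cond_G0_def)
  obtain F where F: "1 \<le> F" "AE x in lebesgue. inverse F \<le> G x 1 \<and> G x 1 \<le> F"
    using \<open>cond_G1 G\<close> by (auto simp: cond_G1_def)
  have S: "\<Omega> \<in> sets lebesgue" using \<open>open \<Omega>\<close> by auto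
  have GN: "AE x in lebesgue. (\<forall>t. G x (- t) = G x t) \<and> continuous_on UNIV (G x) \<and> convex_on UNIV (G x) \<and>
        strict_mono_on {0..} (G x) \<and> G x 0 = 0 \<and> (\<forall>t>0. G x t > 0)"
    using \<open>gen_N_function UNIV G\<close> unfolding gen_N_function_def lebesgue_on_UNIV_eq
    by (auto elim: eventually_mono)
  have pg: "AE x in lebesgue. power_growth gm gp F (G x)"
    using GN F(2) by eventually_elim (use g G0 in \<open>auto intro!: power_growth_if_N_deriv_bounds\<close>)
  have Gm: "(\<lambda>x. G x t) \<in> borel_measurable (lebesgue_on \<Omega>)" for t
    using \<open>gen_N_function UNIV G\<close> unfolding gen_N_function_def lebesgue_on_UNIV_eq
    by (auto intro: measurable_restrict_space1)
  interpret musielak \<Omega> G gm gp F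
  proof
    show "AE x in lebesgue_on \<Omega>. power_growth gm gp F (G x)"
      using pg S by (subst AE_restrict_space_iff) auto
  qed (use assms g F Gm in auto)
  obtain F' where F': "1 < F'" "\<And>x. x \<in> \<Omega> \<Longrightarrow> inverse F' \<le> H1 x 1 \<and> H1 x 1 \<le> F'"
    using assms(12)[of H1] by (auto simp: cond_H1_def)
  obtain hm hp where h: "gp \<le> hm" "hp \<le> qs"
    and hd: "\<And>x. x \<in> \<Omega> \<Longrightarrow> \<forall>t>0. hm \<le> N_deriv H1 x t * t / H1 x t \<and> N_deriv H1 x t * t / H1 x t \<le> hp"
    using assms(12)[of H1] by (auto simp: cond_H2_def qs_def)
  have "hm \<le> hp"
  proof -
    obtain x where "x \<in> \<Omega>" using \<open>\<Omega> \<noteq> {}\<close> by auto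
    from hd[OF this] show ?thesis by (meson order.trans zero_less_one)
  qed
  with h g have hq: "1 < hm" "hm \<le> qs" "1 \<le> qs" by auto
  have HN: "AE x in M. (\<forall>t. H1 x (- t) = H1 x t) \<and> continuous_on UNIV (H1 x) \<and> convex_on UNIV (H1 x) \<and>
        strict_mono_on {0..} (H1 x) \<and> H1 x 0 = 0 \<and> (\<forall>t>0. H1 x t > 0) \<and>
        ((\<lambda>t. H1 x t / t) \<longlongrightarrow> 0) (at 0) \<and> filterlim (\<lambda>t. H1 x t / t) at_top at_top"
    using \<open>gen_N_function \<Omega> H1\<close> unfolding gen_N_function_def by blast
  have H: "AE x in M. \<forall>t\<ge>1. H1 x t \<le> F' * t powr qs \<and> N_deriv H1 x t * t \<le> qs * H1 x t"
    using HN AE_space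
  proof eventually_elim
    case (elim x)
    then have x: "x \<in> \<Omega>" by simp
    have D: "\<forall>t>0. hm \<le> N_deriv H1 x t * t / H1 x t \<and> N_deriv H1 x t * t / H1 x t \<le> qs"
      using hd[OF x] h(2) by (meson order.trans)
    have "power_growth hm qs F' (H1 x)"
      using elim(1) D F'(2)[OF x] hq by (intro power_growth_if_N_deriv_bounds) auto
    from pg_le[OF this hq(1,2) less_imp_le[OF F'(1)]]
    have "H1 x t \<le> F' * t powr qs" if "1 \<le> t" for t using that by simp
    moreover have "N_deriv H1 x t * t \<le> qs * H1 x t" if "1 \<le> t" for t
    proof -
      have "0 < H1 x t" using elim(1) that by auto
      moreover have "N_deriv H1 x t * t / H1 x t \<le> qs" using D that by auto
      ultimately show ?thesis by (simp add: pos_divide_le_eq)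
    qed
    ultimately show ?case by blast
  qed
  have Young: "AE x in M. \<forall>s\<ge>0. \<forall>t\<ge>0. M_fun G H1 x t * s \<le> G x t + H1 x s"
    using HN G_growth
  proof eventually_elim
    case (elim x)
    show ?case
    proof (intro allI impI)
      fix s t :: real assume st: "0 \<le> s" "0 \<le> t"
      have "the_inv_into {0..} (\<lambda>t. SUP s\<in>{0..}. t * s - H1 x s) (G x t) * s \<le> G x t + H1 x s"
        using elim(1) st pg_nonneg[OF elim(2) p F(1)]
        by (intro complementary_function_inverse) auto
      moreover have "N_compl H1 x = (\<lambda>t. SUP s\<in>{0..}. t * s - H1 x s)"
        by (rule ext) (simp add: N_compl_def)
      ultimately show "M_fun G H1 x t * s \<le> G x t + H1 x s"
        by (simp add: M_fun_def N_inv_def)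
    qed
  qed
  obtain a4 a5 a6 where a: "0 < a4" "0 < a5" "0 < a6"
    "AE x in M. \<forall>s \<eta>. A x s \<eta> \<bullet> \<eta> \<ge> a4 * G x (norm \<eta>) - a5 * H1 x \<bar>s\<bar> - a6"
    using \<open>cond_A1 \<Omega> G H1 A\<close> by (auto simp: cond_A1_def)
  obtain b1 b2 b3 where b: "0 < b1" "0 < b2" "0 < b3"
    "AE x in M. \<forall>s \<eta>. \<bar>B x s \<eta>\<bar> \<le> b1 * M_fun G H1 x (norm \<eta>) + b2 * N_deriv H1 x \<bar>s\<bar> + b3"
    using \<open>cond_B \<Omega> G H1 B\<close> by (auto simp: cond_B_def)
  let ?U = "weak_gradient \<Omega> u"
  have u: "u \<in> W10_space \<Omega> G" using \<open>weak_solution \<Omega> G A B u\<close> by (simp add: weak_solution_def)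
  note uD = W1_space_D[OF W10_space_D[OF u]]
  have nU: "(\<lambda>x. norm (?U x)) \<in> borel_measurable M"
    by (rule measurable_compose[OF uD(4) borel_measurable_norm])
  let ?C = "2 * (2 / unit_ball_vol ?n) powr (1 / ?n)"
  interpret levels: critical_levels M "\<lambda>x. \<bar>u x\<bar>" "\<lambda>x. norm (?U x)" gm qs ?n ?C
  proof
    show "(\<lambda>x. \<bar>u x\<bar>) \<in> borel_measurable M" using uD(1) by simp
    show "integrable M (\<lambda>x. norm (?U x) powr gm)"
      using integrable_if_modular_finite(3)[OF nU uD(5)] by simp
    have "unit_ball_vol ?n \<noteq> 0" using unit_ball_vol_pos[of ?n] by linarith
    then show "0 < ?C" by simp
    show "(l - k) * measure M {x \<in> space M. l \<le> \<bar>u x\<bar>}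
        \<le> ?C * measure M {x \<in> space M. k \<le> \<bar>u x\<bar>} powr (1 / ?n)
            * (LINT x|M. indicator {x \<in> space M. k \<le> \<bar>u x\<bar> \<and> \<bar>u x\<bar> < l} x * norm (?U x))"
      if "0 < k" "k < l" for k l
      by (rule level_set_inequality[OF u that])
  qed (use nU g qs_def in auto)
  have "0 < F'" using F'(1) by simp
  from Caccioppoli[OF \<open>weak_solution \<Omega> G A B u\<close> a(1-3) b(1-3) this hq(3) a(4) b(4) H Young
      levels.integrable_powr_critical]
  obtain C where "0 < C" "\<And>k. 1 \<le> k \<Longrightarrow> levels.tail (\<lambda>x. norm (?U x) powr gm) k \<le> C * levels.tail (\<lambda>x. \<bar>u x\<bar> powr qs) k"
    by (auto simp: levels.tail_def)
  then have "\<exists>K. AE x in M. \<bar>u x\<bar> \<le> K"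
    by (intro levels.bounded_if_Caccioppoli)
  then show ?thesis using uD(1) by (simp add: L_infinity_def)
qed

end
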